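(* Let $\mathcal A$ and $\mathcal A^{+}$ be the two arrangements (of ovals with respect to three lines in $\mathbb{RP}^2$) described in the context, and let $\tau$ be the irregular primitive triangulation of the lattice triangle $T=[(0,0),(4,0),(0,4)]$ described in the context. Then for each of the arrangements $\mathcal A$ and $\mathcal A^{+}$ there is a distribution of signs $\delta:T\cap\mathbb Z^2\to\{+,-\}$ such that the PL curve obtained by the combinatorial patchworking from $(\tau,\delta)$, together with the three coordinate lines, realizes this arrangement.
   Context: The arrangements. Let $L_x,L_y,L_z\subset\mathbb{RP}^2$ be three lines in general position. They divide $\mathbb{RP}^2$ into four triangles $T_0,T_1,T_2,T_3$. For each $k\in\{x,y,z\}$, the two vertices lying on $L_k$ divide $L_k$ into two open segments. One of them is a side of $T_0$; denote the other one by $S_k$. Each $S_k$ is a common side of exactly two of the triangles $T_1,T_2,T_3$. The arrangement $\mathcal A$ consists of $L_x,L_y,L_z$ and three pairwise disjoint ovals $O_x,O_y,O_z$ (an oval is an embedded circle bounding a disk in $\mathbb{RP}^2$; the three disks are pairwise disjoint) such that, for each $k$: (1) $O_k$ meets $L_x\cup L_y\cup L_z$ in exactly four points, crossing at each of them, and all four lie on $S_k$; denote them $a_1,a_2,a_3,a_4$ in the order in which they occur along $S_k$; (2) in one of the two triangles adjacent to $S_k$, called the bulge side of $O_k$, the oval $O_k$ consists of an arc joining $a_1$ to $a_4$ and an arc joining $a_2$ to $a_3$, while in the other triangle adjacent to $S_k$ it consists of an arc joining $a_1$ to $a_2$ and an arc joining $a_3$ to $a_4$ (so the disk bounded by $O_k$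 meets $S_k$ in the segments $[a_1,a_2]$ and $[a_3,a_4]$); and moreover (3) the bulge sides of $O_x,O_y,O_z$ are three distinct triangles, i.e. each of $T_1,T_2,T_3$ is the bulge side of exactly one of the three ovals. In particular the three ovals are disjoint from $\overline{T_0}$. The arrangement $\mathcal A^{+}$ is obtained from $\mathcal A$ by adding one more oval contained in the open triangle $T_0$. A curve in $\mathbb{RP}^2$ together with three lines realizes an arrangement if there is a homeomorphism of $\mathbb{RP}^2$ which maps the union of the three lines to $L_x\cup L_y\cup L_z$ and the curve to the union of the ovals of the arrangement (the lines may be permuted). The triangulation. A lattice triangulation of $T$ is primitive if all its triangles have area $1/2$ (equivalently, all lattice points of $T$ are vertices). It is regular (convex, coherent) if there is a convex piecewise linear function on $T$ whose maximal domains of linearity are exactly the triangles of the triangulation; otherwise it is irregular. The triangulation $\tau$ (which up to symmetries of $T$ is the unique irregular primitive triangulation of $T$) consists of the following 16 triangles: the triangle $[(1,1),(2,1),(1,2)]$; the three triangles $[(0,0),(1,1),(2,1)]$, $[(4,0),(2,1),(1,2)]$, $[(0,4),(1,2),(1,1)]$; for each $i=0,1,2,3$ the triangles $[(i,0),(i+1,0),(2,1)]$, $[(0,i),(0,i+1),(1,1)]$ and $[(i,4-i),(i+1,3-i),(1,2)]$. Combinatorial patchworking. Given a lattice triangulation $\tau$ of $T$ and a distribution of signs $\delta$ on its vertices, let $T_*$ be the union of the four symmetric copies of $T$ in the quadrants, namely the images of $T$ under $(u,v)\mapsto(\varepsilon_1u,\varepsilon_2v)$, $\varepsilon_1,\varepsilon_2\in\{1,-1\}$.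 Extend $\tau$ to a triangulation of $T_*$ by symmetry. Extend the signs by the rule that the sign of $(\varepsilon_1 i,\varepsilon_2 j)$ is $\varepsilon_1^{i}\varepsilon_2^{j}\,\delta(i,j)$ for every vertex $(i,j)$ of $\tau$. In every triangle of $T_*$ whose vertices do not all have the same sign, draw the segment joining the midpoints of the two sides whose endpoints have opposite signs. Identifying each point $w$ of $\partial T_*$ with $-w$ turns $T_*$ into $\mathbb{RP}^2$, and the union of the drawn segments becomes a closed PL curve in $\mathbb{RP}^2$ (the patchworked curve of degree $4$). The three coordinate lines are the images of $T_*\cap\{v=0\}$, $T_*\cap\{u=0\}$ and $\partial T_*$. *)

theory Defs
  imports "HOL-Analysis.Analysis"
begin

section \<open>Quotient topologies and the real projective plane\<close>

definition quotient_topology :: "'a topology \<Rightarrow> ('a \<Rightarrow> 'b) \<Rightarrow> 'b topology" where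
  "quotient_topology X q =
     topology (\<lambda>U. U \<subseteq> q ` topspace X \<and> openin X {x \<in> topspace X. q x \<in> U})"

lemma openin_quotient_topology:
  "openin (quotient_topology X q) U \<longleftrightarrow>
     U \<subseteq> q ` topspace X \<and> openin X {x \<in> topspace X. q x \<in> U}"
proof -
  have "istopology (\<lambda>U. U \<subseteq> q ` topspace X \<and> openin X {x \<in> topspace X. q x \<in> U})"
    unfolding istopology_def
  proof (intro conjI allI impI)
    fix S T
    assume S: "S \<subseteq> q ` topspace X \<and> openin X {x \<in> topspace X. q x \<in> S}"
      and T: "T \<subseteq> q ` topspace X \<and> openin X {x \<in> topspace X. q x \<in> T}"
    show "S \<inter> T \<subseteq> q ` topspace X"
      using S by blast
    have "{x \<in> topspace X. q x \<in> S \<inter> T} =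
        {x \<in> topspace X. q x \<in> S} \<inter> {x \<in> topspace X. q x \<in> T}"
      by blast
    then show "openin X {x \<in> topspace X. q x \<in> S \<inter> T}"
      using S T openin_Int[of X] by (simp only:)
  next
    fix \<K>
    assume K: "\<forall>K\<in>\<K>. K \<subseteq> q ` topspace X \<and> openin X {x \<in> topspace X. q x \<in> K}"
    show "\<Union>\<K> \<subseteq> q ` topspace X"
      using K by blast
    have "{x \<in> topspace X. q x \<in> \<Union>\<K>} = (\<Union>K\<in>\<K>. {x \<in> topspace X. q x \<in> K})"
      by blast
    then show "openin X {x \<in> topspace X. q x \<in> \<Union>\<K>}"
      using K by auto
  qed
  then show ?thesis
    by (simp add: quotient_topology_def)
qed

lemma topspace_quotient_topology: "topspace (quotient_topology X q) = q ` topspace X"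
proof -
  have "{x \<in> topspace X. q x \<in> q ` topspace X} = topspace X"
    by blast
  then have "openin (quotient_topology X q) (q ` topspace X)"
    by (simp add: openin_quotient_topology)
  moreover have "topspace (quotient_topology X q) \<subseteq> q ` topspace X"
    using openin_topspace[of "quotient_topology X q"] unfolding openin_quotient_topology by (rule conjunct1)
  ultimately show ?thesis
    using openin_subset by blast
qed

lemma quotient_map_quotient_topology: "quotient_map X (quotient_topology X q) q"
  by (simp add: quotient_map_def topspace_quotient_topology openin_quotient_topology)

text \<open>A point of the projective plane is a one-dimensional linear subspace of \<open>real ^ 3\<close>.\<close>

type_synonym rp2_point = "(real ^ 3) set"

definition rp2_class :: "real ^ 3 \<Rightarrow> rp2_point" where
  "rp2_class v = span {v}"

definition rp2 :: "rp2_point topology" where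
  "rp2 = quotient_topology (top_of_set (UNIV - {0})) rp2_class"

definition projective_line :: "rp2_point set \<Rightarrow> bool" where
  "projective_line M \<longleftrightarrow> (\<exists>V. subspace V \<and> dim V = 2 \<and> M = rp2_class ` (V - {0}))"


section \<open>Three lines, triangles and segments\<close>

text \<open>The index type \<open>3\<close> plays the role of the labels $x,y,z$.\<close>

definition lines_in_general_position :: "(3 \<Rightarrow> rp2_point set) \<Rightarrow> bool" where
  "lines_in_general_position L \<longleftrightarrow>
     (\<forall>k. projective_line (L k)) \<and> inj L \<and> (\<Inter>k. L k) = {}"

definition triangles :: "(3 \<Rightarrow> rp2_point set) \<Rightarrow> rp2_point set set" where
  "triangles L = connected_components_of (subtopology rp2 (topspace rp2 - (\<Union>k. L k)))"

definition segments :: "(3 \<Rightarrow> rp2_point set) \<Rightarrow> 3 \<Rightarrow> rp2_point set set" where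
  "segments L k = connected_components_of (subtopology rp2 (L k - (\<Union>j\<in>-{k}. L j)))"

definition adjacent_triangles ::
    "(3 \<Rightarrow> rp2_point set) \<Rightarrow> rp2_point set \<Rightarrow> rp2_point set set" where
  "adjacent_triangles L S = {T \<in> triangles L. S \<subseteq> rp2 closure_of T}"

text \<open>The segment $S_k$: the one of the two open segments of $L_k$ that is not a side of $T_0$.\<close>

definition far_segment ::
    "(3 \<Rightarrow> rp2_point set) \<Rightarrow> rp2_point set \<Rightarrow> 3 \<Rightarrow> rp2_point set" where
  "far_segment L T0 k = (THE S. S \<in> segments L k \<and> T0 \<notin> adjacent_triangles L S)"


section \<open>Ovals and arcs\<close>

definition bounds_disk :: "rp2_point set \<Rightarrow> rp2_point set \<Rightarrow> bool" where
  "bounds_disk Q D \<longleftrightarrow>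
     (\<exists>f. embedding_map (top_of_set (cball (0 :: real \<times> real) 1)) rp2 f \<and>
          f ` cball 0 1 = D \<and> f ` sphere 0 1 = Q)"

definition oval :: "rp2_point set \<Rightarrow> bool" where
  "oval Q \<longleftrightarrow> (\<exists>D. bounds_disk Q D)"

definition arc_joining :: "rp2_point set \<Rightarrow> rp2_point \<Rightarrow> rp2_point \<Rightarrow> bool" where
  "arc_joining A p q \<longleftrightarrow>
     (\<exists>g. embedding_map (top_of_set {0..1 :: real}) rp2 g \<and> g 0 = p \<and> g 1 = q \<and> A = g ` {0..1})"

text \<open>
  The part of \<open>Q\<close> in the triangle \<open>T\<close> consists of an arc joining \<open>p\<close> to \<open>q\<close> and an arc
  joining \<open>r\<close> to \<open>s\<close>; the four end points lie on the boundary of \<open>T\<close>.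
\<close>

definition two_arcs_in ::
    "rp2_point set \<Rightarrow> rp2_point set \<Rightarrow> rp2_point \<Rightarrow> rp2_point \<Rightarrow> rp2_point \<Rightarrow> rp2_point \<Rightarrow> bool" where
  "two_arcs_in T Q p q r s \<longleftrightarrow>
     (\<exists>A B. arc_joining A p q \<and> arc_joining B r s \<and> A \<inter> B = {} \<and>
            A - {p, q} \<subseteq> T \<and> B - {r, s} \<subseteq> T \<and> Q \<inter> rp2 closure_of T = A \<union> B)"

text \<open>
  \<open>Q\<close> passes at \<open>p\<close> from one triangle to another one. For a point \<open>p\<close> of an open segment of one
  of the lines this is crossing in the usual local sense, since the two sides of the segment
  belong to different triangles.
\<close>

definition crosses_lines_at :: "(3 \<Rightarrow> rp2_point set) \<Rightarrow> rp2_point set \<Rightarrow> rp2_point \<Rightarrow> bool" where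
  "crosses_lines_at L Q p \<longleftrightarrow>
     (\<exists>g T T'. embedding_map (top_of_set {-1<..<1 :: real}) rp2 g \<and>
        g ` {-1<..<1} \<subseteq> Q \<and> g 0 = p \<and>
        T \<in> triangles L \<and> T' \<in> triangles L \<and> T \<noteq> T' \<and>
        g ` {-1<..<0} \<subseteq> T \<and> g ` {0<..<1} \<subseteq> T')"


section \<open>The two arrangements\<close>

text \<open>
  For given lines and \<open>T0\<close> the arrangements are topological types: the predicates below describe
  the systems of ovals of the type, and any two such systems differ by a homeomorphism preserving
  the union of the lines.
\<close>

text \<open>
  The position of one oval \<open>Q\<close> relative to the open segment \<open>S\<close>, with bulge side \<open>B\<close>. The map
  \<open>\<gamma>\<close> parametrizes \<open>S\<close>, so that \<open>\<gamma> t1, \<dots>, \<gamma> t4\<close> are the points $a_1,\dots,a_4$ in the order in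
  which they occur along \<open>S\<close>.
\<close>

definition oval_position ::
    "(3 \<Rightarrow> rp2_point set) \<Rightarrow> rp2_point set \<Rightarrow> rp2_point set \<Rightarrow> rp2_point set \<Rightarrow> bool" where
  "oval_position L S B Q \<longleftrightarrow>
     (\<exists>\<gamma> t1 t2 t3 t4 B'.
        embedding_map (top_of_set {0<..<1 :: real}) rp2 \<gamma> \<and> \<gamma> ` {0<..<1} = S \<and>
        0 < t1 \<and> t1 < t2 \<and> t2 < t3 \<and> t3 < t4 \<and> t4 < 1 \<and>
        Q \<inter> (\<Union>k. L k) = {\<gamma> t1, \<gamma> t2, \<gamma> t3, \<gamma> t4} \<and>
        (\<forall>p \<in> {\<gamma> t1, \<gamma> t2, \<gamma> t3, \<gamma> t4}. crosses_lines_at L Q p) \<and>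
        B \<in> adjacent_triangles L S \<and> B' \<in> adjacent_triangles L S \<and> B' \<noteq> B \<and>
        two_arcs_in B Q (\<gamma> t1) (\<gamma> t4) (\<gamma> t2) (\<gamma> t3) \<and>
        two_arcs_in B' Q (\<gamma> t1) (\<gamma> t2) (\<gamma> t3) (\<gamma> t4))"

definition arrangement_A ::
    "(3 \<Rightarrow> rp2_point set) \<Rightarrow> rp2_point set \<Rightarrow> (3 \<Rightarrow> rp2_point set) \<Rightarrow> bool" where
  "arrangement_A L T0 Q \<longleftrightarrow>
     lines_in_general_position L \<and> T0 \<in> triangles L \<and>
     (\<exists>D. (\<forall>k. bounds_disk (Q k) (D k)) \<and> (\<forall>j k. j \<noteq> k \<longrightarrow> D j \<inter> D k = {})) \<and>
     (\<exists>B. bij_betw B UNIV (triangles L - {T0}) \<and>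
          (\<forall>k. oval_position L (far_segment L T0 k) (B k) (Q k)))"

definition arrangement_A_plus ::
    "(3 \<Rightarrow> rp2_point set) \<Rightarrow> rp2_point set \<Rightarrow> (3 \<Rightarrow> rp2_point set) \<Rightarrow> rp2_point set \<Rightarrow> bool" where
  "arrangement_A_plus L T0 Q P \<longleftrightarrow> arrangement_A L T0 Q \<and> oval P \<and> P \<subseteq> T0"

text \<open>
  \<open>X\<close> is a model of the projective plane, \<open>M\<close> the union of three lines and \<open>C\<close> a curve in it;
  \<open>N\<close> is the union of the ovals of an arrangement with respect to the lines \<open>L\<close>.
\<close>

definition realizes ::
    "'a topology \<Rightarrow> 'a set \<Rightarrow> 'a set \<Rightarrow> (3 \<Rightarrow> rp2_point set) \<Rightarrow> rp2_point set \<Rightarrow> bool" where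
  "realizes X M C L N \<longleftrightarrow>
     (\<exists>f. homeomorphic_map X rp2 f \<and> f ` M = (\<Union>k. L k) \<and> f ` C = N)"


section \<open>Combinatorial patchworking in degree 4\<close>

definition lattice_pt :: "nat \<times> nat \<Rightarrow> real \<times> real" where
  "lattice_pt p = (real (fst p), real (snd p))"

definition big_triangle :: "(real \<times> real) set" where
  "big_triangle = convex hull {(0, 0), (4, 0), (0, 4)}"

definition lattice_points :: "(nat \<times> nat) set" where
  "lattice_points = {p. lattice_pt p \<in> big_triangle}"

definition quadrants :: "(int \<times> int) set" where
  "quadrants = {1, -1} \<times> {1, -1}"

definition reflect :: "int \<times> int \<Rightarrow> real \<times> real \<Rightarrow> real \<times> real" where
  "reflect e w = (of_int (fst e) * fst w, of_int (snd e) * snd w)"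

definition T_star :: "(real \<times> real) set" where
  "T_star = (\<Union>e\<in>quadrants. reflect e ` big_triangle)"

text \<open>The sign of the copy \<open>reflect e (lattice_pt p)\<close> of the vertex \<open>p\<close>.\<close>

definition copy_sign :: "(nat \<times> nat \<Rightarrow> int) \<Rightarrow> int \<times> int \<Rightarrow> nat \<times> nat \<Rightarrow> int" where
  "copy_sign \<delta> e p = fst e ^ fst p * snd e ^ snd p * \<delta> p"

text \<open>
  The union of the drawn segments in \<open>T_star\<close>. A triangulation is given by the vertex sets of its
  triangles; in a triangle with vertices \<open>p, q, r\<close>, not all of the same sign, \<open>p\<close> is the vertex
  whose sign differs from the other two.
\<close>

definition drawn_segments ::
    "(nat \<times> nat) set set \<Rightarrow> (nat \<times> nat \<Rightarrow> int) \<Rightarrow> (real \<times> real) set" where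
  "drawn_segments \<tau> \<delta> =
     \<Union>{closed_segment
           (midpoint (reflect e (lattice_pt p)) (reflect e (lattice_pt q)))
           (midpoint (reflect e (lattice_pt p)) (reflect e (lattice_pt r))) | e p q r.
         e \<in> quadrants \<and> {p, q, r} \<in> \<tau> \<and> q \<noteq> r \<and>
         copy_sign \<delta> e p \<noteq> copy_sign \<delta> e q \<and> copy_sign \<delta> e p \<noteq> copy_sign \<delta> e r}"

definition antipodal_class :: "real \<times> real \<Rightarrow> (real \<times> real) set" where
  "antipodal_class w = (if w \<in> frontier T_star then {w, -w} else {w})"

definition patchwork_plane :: "(real \<times> real) set topology" where
  "patchwork_plane = quotient_topology (top_of_set T_star) antipodal_class"

definition coordinate_lines :: "(real \<times> real) set set" where
  "coordinate_lines =
     antipodal_class ` (T_star \<inter> {w. snd w = 0}) \<union>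
     antipodal_class ` (T_star \<inter> {w. fst w = 0}) \<union>
     antipodal_class ` frontier T_star"

definition patchworked_curve ::
    "(nat \<times> nat) set set \<Rightarrow> (nat \<times> nat \<Rightarrow> int) \<Rightarrow> (real \<times> real) set set" where
  "patchworked_curve \<tau> \<delta> = antipodal_class ` drawn_segments \<tau> \<delta>"

definition irregular_triangulation :: "(nat \<times> nat) set set" where
  "irregular_triangulation =
     {{(1, 1), (2, 1), (1, 2)},
      {(0, 0), (1, 1), (2, 1)}, {(4, 0), (2, 1), (1, 2)}, {(0, 4), (1, 2), (1, 1)}} \<union>
     (\<Union>i\<in>{0, 1, 2, 3}.
        {{(i, 0), (i + 1, 0), (2, 1)},
         {(0, i), (0, i + 1), (1, 1)},
         {(i, 4 - i), (i + 1, 3 - i), (1, 2)}})"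

end

(*
  The map sending (u,v) to the line through (u, v, 4 - |u| - |v|) identifies T_* modulo its boundary
  identification with the upper half of an octahedron modulo antipodes, that is, with RP^2. The
  coordinate lines become coordinate planes, the four copies of T become faces, and a linear change
  of coordinates moves the coordinate planes to the given lines and the positive face to T0.

  Give all boundary points of T the sign +. With + on the three interior points the curve is the
  arrangement A; with - there it is A^+, the additional oval being the boundary of a triangle in
  the positive face. In homogeneous form the triangulation and the signs are invariant under the
  cyclic permutation of the coordinates, so the three ovals are rotations of one polygon, which
  lives in two adjacent faces and can be examined in a planar chart. It bounds a disk because,
  after a piecewise linear change of coordinates, it becomes star-shaped.
*)

theory Submission
  imports Defs
begin

section \<open>General topology\<close>

text \<open>The definitions speak of components, closures and embeddings in a quotient space,
  whereas the polygons are given by linear inequalities. The bridge is that the relevant triangles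
  and segments are sign conditions on homogeneous coordinates; permuting coordinates and changing
  their signs reduces every line to \<open>y = 0\<close> and every far segment to positive
  \<open>x\<close> and \<open>z\<close>. Each far segment borders two triangles, and the two sign
  distributions choose among them in opposite cyclic senses. This is the parameter \<open>s\<close>:
  it is 1 for A and -1 for A^+. Disjoint curves may bound nested disks, so disjointness of the disks
  does not follow from that of the ovals; it is derived from inequalities valid on the whole disks.
  Once all coordinates are doubled, the midpoints of lattice edges are integral. Identifying the
  patchworked curve with the ovals is then a finite comparison of integer segments, up to
  orientation and antipode.\<close>

lemma embedding_map_subtopology_domain:
  assumes "embedding_map X Y f"
  shows "embedding_map (subtopology X S) Y f"
proof -
  let ?T = "f ` (topspace X \<inter> S)"
  have "homeomorphic_map X (subtopology Y (f ` topspace X)) f"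
    using assms by (simp add: embedding_map_def)
  moreover from this have "?T = topspace (subtopology Y (f ` topspace X)) \<inter> ?T"
    using homeomorphic_imp_surjective_map by blast
  ultimately have "homeomorphic_map (subtopology X S)
      (subtopology (subtopology Y (f ` topspace X)) ?T) f"
    by (intro homeomorphic_map_subtopologies)
  moreover have "f ` topspace X \<inter> ?T = ?T" by blast
  ultimately show ?thesis
    by (simp add: embedding_map_def subtopology_subtopology)
qed

lemma embedding_map_compact_into_Hausdorff:
  fixes S :: "'a::metric_space set"
  assumes "compact S" "Hausdorff_space Y" "continuous_map (top_of_set S) Y f" "inj_on f S"
  shows "embedding_map (top_of_set S) Y f"
  by (rule continuous_imp_embedding_map) (use assms in \<open>auto simp: compact_space_subtopology\<close>)

text \<open>The complement of a part is the union of the other parts, so every part is clopen and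
  contains the component of each of its points; connectedness of the part gives the other
  inclusion.\<close>

lemma connected_components_of_open_partition:
  assumes U: "topspace X = \<Union>\<U>" and conn: "\<And>A. A \<in> \<U> \<Longrightarrow> connectedin X A"
    and opn: "\<And>A. A \<in> \<U> \<Longrightarrow> openin X A" and ne: "{} \<notin> \<U>" and disj: "pairwise disjnt \<U>"
  shows "connected_components_of X = \<U>"
proof -
  have *: "connected_component_of_set X x = A" if "A \<in> \<U>" "x \<in> A" for A x
  proof
    show "A \<subseteq> connected_component_of_set X x"
      using connected_component_of_maximal conn that by metis
    have "topspace X - A = \<Union>(\<U> - {A})"
      using U disj that unfolding pairwise_def disjnt_def by fast
    then have "openin X (topspace X - A)"
      using opn by (simp only:) (rule openin_Union, auto)
    then have "closedin X A"
      using U that by (auto simp: closedin_def)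
    then show "connected_component_of_set X x \<subseteq> A"
      using connectedin_clopen_cases[OF connectedin_connected_component_of[of X x] _ opn[OF that(1)]]
        connected_component_of_refl[of X x] U that unfolding disjnt_iff by auto
  qed
  show ?thesis
  proof
    show "connected_components_of X \<subseteq> \<U>"
      unfolding connected_components_of_def using * U by auto
    show "\<U> \<subseteq> connected_components_of X"
      unfolding connected_components_of_def
    proof
      fix A assume A: "A \<in> \<U>"
      then obtain x where x: "x \<in> A" using ne by (metis ex_in_conv)
      then have "x \<in> topspace X" using A U by blast
      then show "A \<in> connected_component_of_set X ` topspace X"
        using *[OF A x] by (metis image_eqI)
    qed
  qed
qed

text \<open>The radial rescaling turns the norm ball into the unit ball of the gauge \<open>F\<close>.\<close>

lemma gauge_ball_homeo:
  fixes F :: "'a::euclidean_space \<Rightarrow> real"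
  assumes cont: "continuous_on UNIV F" and hom: "\<And>t x. t \<ge> 0 \<Longrightarrow> F (t *\<^sub>R x) = t * F x"
    and pos: "\<And>x. x \<noteq> 0 \<Longrightarrow> F x > 0"
  obtains g :: "'a \<Rightarrow> 'a" where "continuous_on (cball 0 1) g" "inj_on g (cball 0 1)"
    "g ` cball 0 1 = {x. F x \<le> 1}" "g ` sphere 0 1 = {x. F x = 1}"
proof -
  define g where "g x = (norm x / F x) *\<^sub>R x" for x
  have F0: "F 0 = 0" using hom[of 0 0] by simp
  have Fg: "F (g x) = norm x" for x
    using hom[of "norm x / F x" x] pos[of x] F0 by (cases "x = 0") (auto simp: g_def)
  have g0: "g 0 = 0" by (simp add: g_def)
  have g_surj: "\<exists>x. norm x = F y \<and> g x = y" for y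
  proof (cases "y = 0")
    case True
    then show ?thesis using F0 g0 by auto
  next
    case False
    define x where "x = (F y / norm y) *\<^sub>R y"
    have p: "F y > 0" "norm y > 0" using False pos by auto
    have n: "norm x = F y" using p by (simp add: x_def)
    have "F x = F y / norm y * F y" using p hom by (simp add: x_def)
    then have "g x = (F y / (F y / norm y * F y) * (F y / norm y)) *\<^sub>R y"
      using n by (simp add: g_def x_def)
    also have "\<dots> = y" using p by simp
    finally show ?thesis using n by blast
  qed
  \<comment> \<open>Compactness of the unit sphere gives a lower bound for \<open>F\<close> in terms
    of the norm. It is what makes \<open>g\<close> continuous at the origin, where the factor
    \<open>norm x / F x\<close> may have no limit.\<close>
  obtain m where m: "m > 0" "\<And>x. m * norm x \<le> F x"
  proof -
    have "compact (sphere (0::'a) 1)" "sphere (0::'a) 1 \<noteq> {}" by auto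
    then obtain u where u: "u \<in> sphere 0 1" "\<And>x. x \<in> sphere 0 1 \<Longrightarrow> F u \<le> F x"
      using continuous_attains_inf[of "sphere 0 1" F] cont continuous_on_subset by blast
    have "F u * norm x \<le> F x" for x
    proof (cases "x = 0")
      case False
      have "F u \<le> F ((1 / norm x) *\<^sub>R x)" using False by (intro u) simp
      also have "\<dots> = 1 / norm x * F x" by (rule hom) simp
      finally show ?thesis using False by (simp add: field_simps)
    qed (simp add: F0)
    moreover have "F u > 0" using u(1) by (intro pos) auto
    ultimately show ?thesis using that by blast
  qed
  have "isCont g x" for x
  proof (cases "x = 0")
    case False
    have "isCont F x" using cont by (simp add: continuous_on_eq_continuous_at)
    then show ?thesis using pos[OF False] unfolding g_def[abs_def]
      by (intro continuous_intros) auto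
  next
    case True
    have b: "norm (g y) \<le> norm y / m" for y
    proof (cases "y = 0")
      case False
      have "norm (g y) = norm y * norm y / F y" using pos[OF False] by (simp add: g_def)
      also have "\<dots> \<le> norm y * norm y / (m * norm y)"
        using m pos False by (intro divide_left_mono) auto
      finally show ?thesis using False by simp
    qed (simp add: g0)
    have "((\<lambda>y::'a. norm y / m) \<longlongrightarrow> 0) (at 0)"
      using m by (auto intro!: tendsto_eq_intros)
    with m have "(g \<longlongrightarrow> 0) (at 0)"
      by (intro Lim_null_comparison[where f = g and g = "\<lambda>y. norm y / m"]) (simp_all add: b)
    then show ?thesis using True g0 by (simp add: isCont_def)
  qed
  then have "continuous_on (cball 0 1) g" by (simp add: continuous_at_imp_continuous_on)
  moreover have "inj_on g (cball 0 1)"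
  proof (rule inj_onI)
    fix x y assume e: "g x = g y"
    then have n: "norm x = norm y" using Fg by metis
    show "x = y"
    proof (cases "x = 0 \<or> y = 0")
      case False
      define a b where "a = norm x / F x" and "b = norm y / F y"
      have ab: "a > 0" "b > 0" using False pos by (auto simp: a_def b_def)
      have "a *\<^sub>R x = b *\<^sub>R y" using e by (simp add: g_def a_def b_def)
      moreover from this have "a * norm x = b * norm y"
        using ab by (metis abs_of_pos norm_scaleR)
      ultimately show ?thesis using n ab False by auto
    qed (use n in auto)
  qed
  moreover have "g ` cball 0 1 = {x. F x \<le> 1}"
  proof (intro set_eqI iffI)
    fix y assume "y \<in> {x. F x \<le> 1}"
    moreover obtain x where "norm x = F y" "g x = y" using g_surj by blast
    ultimately show "y \<in> g ` cball 0 1" by (intro image_eqI[of _ _ x]) auto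
  qed (auto simp: Fg)
  moreover have "g ` sphere 0 1 = {x. F x = 1}"
  proof (intro set_eqI iffI)
    fix y assume "y \<in> {x. F x = 1}"
    moreover obtain x where "norm x = F y" "g x = y" using g_surj by blast
    ultimately show "y \<in> g ` sphere 0 1" by (intro image_eqI[of _ _ x]) auto
  qed (auto simp: Fg)
  ultimately show ?thesis by (rule that)
qed

section \<open>Homogeneous coordinates on the projective plane\<close>

lemma rp2_class_eq_iff:
  assumes "v \<noteq> 0" "w \<noteq> 0"
  shows "rp2_class v = rp2_class w \<longleftrightarrow> (\<exists>c. c \<noteq> 0 \<and> v = c *\<^sub>R w)"
proof
  assume "rp2_class v = rp2_class w"
  then have "v \<in> span {w}" using span_base[of v "{v}"] by (auto simp: rp2_class_def)
  then show "\<exists>c. c \<noteq> 0 \<and> v = c *\<^sub>R w" using assms by (auto simp: span_singleton)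
next
  assume "\<exists>c. c \<noteq> 0 \<and> v = c *\<^sub>R w"
  then obtain c where c: "c \<noteq> 0" "v = c *\<^sub>R w" by blast
  have "k *\<^sub>R w \<in> range (\<lambda>k. (k * c) *\<^sub>R w)" for k
    using c by (intro image_eqI[where x = "k / c"]) auto
  then show "rp2_class v = rp2_class w"
    using c by (auto simp: rp2_class_def span_singleton)
qed

lemma topspace_rp2: "topspace rp2 = rp2_class ` (UNIV - {0})"
  by (simp add: rp2_def topspace_quotient_topology)

lemma quotient_map_rp2_class: "quotient_map (top_of_set (UNIV - {0})) rp2 rp2_class"
  unfolding rp2_def by (rule quotient_map_quotient_topology)

text \<open>
  A line is determined by the orthogonal projection onto it; the matrix of this projection
  depends continuously on the line, so distinct lines are separated.
\<close>

lemma Hausdorff_rp2: "Hausdorff_space rp2"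
proof -
  define p :: "real ^ 3 \<Rightarrow> real ^ 3 ^ 3" where "p v = (\<chi> i j. v $ i * v $ j / (v \<bullet> v))" for v
  define H where "H P = p (SOME v. v \<noteq> 0 \<and> rp2_class v = P)" for P
  have p_eq: "p v = p w" if nz: "v \<noteq> 0" "w \<noteq> 0" "rp2_class v = rp2_class w" for v w
  proof -
    obtain c where c: "c \<noteq> 0" "v = c *\<^sub>R w"
      using nz rp2_class_eq_iff[OF nz(1,2)] by metis
    have "(c *\<^sub>R w) $ i * (c *\<^sub>R w) $ j / ((c *\<^sub>R w) \<bullet> (c *\<^sub>R w)) = w $ i * w $ j / (w \<bullet> w)" for i j
      using c(1) by simp
    then show ?thesis unfolding p_def c(2) by presburger
  qed
  have H: "H (rp2_class v) = p v" if "v \<noteq> 0" for v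
  proof -
    have "(SOME w. w \<noteq> 0 \<and> rp2_class w = rp2_class v) \<noteq> 0 \<and>
        rp2_class (SOME w. w \<noteq> 0 \<and> rp2_class w = rp2_class v) = rp2_class v"
      by (rule someI[where x = v]) (use that in simp)
    then show ?thesis unfolding H_def by (metis p_eq that)
  qed
  have pv: "p w *v v = ((w \<bullet> v) / (w \<bullet> w)) *\<^sub>R w" for v w
  proof -
    have "(p w *v v) $ i = (\<Sum>j\<in>UNIV. w $ j * v $ j) / (w \<bullet> w) * w $ i" for i
      unfolding p_def matrix_vector_mult_def by (simp add: sum_3 add_divide_distrib algebra_simps)
    then show ?thesis by (simp add: vec_eq_iff inner_vec_def)
  qed
  \<comment> \<open>The projection attached to \<open>v\<close> fixes \<open>v\<close>; if it is
    also the one attached to \<open>w\<close>, then \<open>v\<close> is a multiple of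
    \<open>w\<close>.\<close>
  have inj: "inj_on H (topspace rp2)"
  proof (rule inj_onI)
    fix P R assume "P \<in> topspace rp2" "R \<in> topspace rp2" and e: "H P = H R"
    then obtain v w where vw: "v \<noteq> 0" "w \<noteq> 0" "P = rp2_class v" "R = rp2_class w"
      by (auto simp: topspace_rp2)
    then have pvw: "p v = p w" using e H by metis
    have "((v \<bullet> v) / (v \<bullet> v)) *\<^sub>R v = ((w \<bullet> v) / (w \<bullet> w)) *\<^sub>R w"
      using pv[of v v] pv[of w v] pvw by metis
    moreover have "(v \<bullet> v) / (v \<bullet> v) = 1" using vw by simp
    ultimately have v: "v = ((w \<bullet> v) / (w \<bullet> w)) *\<^sub>R w" by (metis scaleR_one)
    then have "(w \<bullet> v) / (w \<bullet> w) \<noteq> 0" using vw(1) by (metis scaleR_zero_left)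
    then show "P = R" using v vw rp2_class_eq_iff[OF vw(1,2)] by metis
  qed
  have "continuous_on (UNIV - {0}) p"
    unfolding p_def by (intro continuous_intros) auto
  then have "continuous_on (UNIV - {0}) (H \<circ> rp2_class)"
    using H by (subst continuous_on_cong[OF refl, of _ _ p]) auto
  then have "continuous_map rp2 euclidean H"
    by (intro continuous_compose_quotient_map[OF quotient_map_rp2_class]) simp
  then show ?thesis
    by (rule Hausdorff_space_injective_preimage[OF Hausdorff_space_euclidean _ inj])
qed

section \<open>Coordinate triples and subsets of the projective plane given by sign
  conditions\<close>

type_synonym r3 = "real \<times> real \<times> real"

definition proj_pt :: "(r3 \<Rightarrow> real ^ 3) \<Rightarrow> r3 \<Rightarrow> rp2_point" where
  "proj_pt M v = rp2_class (M v)"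

text \<open>For such a predicate, membership in the region below can be tested on any representative
  of a projective point.\<close>

definition homogeneous :: "(r3 \<Rightarrow> bool) \<Rightarrow> bool" where
  "homogeneous P \<longleftrightarrow> (\<forall>c v. c \<noteq> 0 \<longrightarrow> P v \<longrightarrow> P (c *\<^sub>R v))"

definition region :: "(r3 \<Rightarrow> real ^ 3) \<Rightarrow> (r3 \<Rightarrow> bool) \<Rightarrow> rp2_point set" where
  "region M P = proj_pt M ` {v. v \<noteq> 0 \<and> P v}"

text \<open>The image of an open octant and of its opposite; the signs \<open>a\<close>, \<open>b\<close>, \<open>c\<close> are \<open>\<plusminus>1\<close>.\<close>

definition octant :: "(r3 \<Rightarrow> real ^ 3) \<Rightarrow> real \<Rightarrow> real \<Rightarrow> real \<Rightarrow> rp2_point set" where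
  "octant M a b c = region M (\<lambda>(x, y, z). 0 < (a * x) * (b * y) \<and> 0 < (a * x) * (c * z))"

text \<open>A linear bijection \<open>M\<close> is a choice of homogeneous coordinates. Precomposing
  it with a linear automorphism of the triples changes the coordinates while the projective plane
  and the given lines stay fixed.\<close>

locale homogeneous_coordinates =
  fixes M :: "r3 \<Rightarrow> real ^ 3"
  assumes lin: "linear M" and bij: "bij M"
begin

lemma M_nonzero: "v \<noteq> 0 \<Longrightarrow> M v \<noteq> 0"
  using bij lin by (metis bij_is_inj injD linear_0)

lemma proj_pt_eq_iff:
  assumes "v \<noteq> 0" "w \<noteq> 0"
  shows "proj_pt M v = proj_pt M w \<longleftrightarrow> (\<exists>c. c \<noteq> 0 \<and> v = c *\<^sub>R w)"
proof -
  have "M v = c *\<^sub>R M w \<longleftrightarrow> v = c *\<^sub>R w" for c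
    using bij lin by (metis bij_is_inj injD linear_scale)
  then show ?thesis
    using rp2_class_eq_iff[OF M_nonzero M_nonzero] assms by (simp add: proj_pt_def)
qed

lemma proj_pt_scale: "c \<noteq> 0 \<Longrightarrow> v \<noteq> 0 \<Longrightarrow> proj_pt M (c *\<^sub>R v) = proj_pt M v"
  by (subst proj_pt_eq_iff) auto

lemma topspace_rp2_eq: "topspace rp2 = proj_pt M ` (UNIV - {0})"
proof -
  have "M ` (UNIV - {0}) = UNIV - {0}"
    using bij lin by (metis bij_def image_set_diff image_insert image_empty linear_0)
  then show ?thesis
    by (metis (no_types, lifting) image_cong image_image proj_pt_def topspace_rp2)
qed

lemma proj_pt_in_topspace: "v \<noteq> 0 \<Longrightarrow> proj_pt M v \<in> topspace rp2"
  by (simp add: topspace_rp2_eq)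

lemma continuous_map_proj_pt: "continuous_map (top_of_set (UNIV - {0})) rp2 (proj_pt M)"
proof -
  have "continuous_map (top_of_set (UNIV - {0})) (top_of_set (UNIV - {0})) M"
    using lin M_nonzero
    by (auto simp: continuous_map_in_subtopology linear_continuous_on linear_linear)
  then have "continuous_map (top_of_set (UNIV - {0})) rp2 (rp2_class \<circ> M)"
    using quotient_imp_continuous_map[OF quotient_map_rp2_class] continuous_map_compose by blast
  then show ?thesis by (simp add: o_def proj_pt_def[abs_def])
qed

lemma continuous_map_proj_pt_comp:
  assumes "continuous_on S h" "\<And>x. x \<in> S \<Longrightarrow> h x \<noteq> 0"
  shows "continuous_map (top_of_set S) rp2 (\<lambda>x. proj_pt M (h x))"
proof -
  have "continuous_map (top_of_set S) (top_of_set (UNIV - {0})) h"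
    using assms by (auto simp: continuous_map_in_subtopology)
  from continuous_map_compose[OF this continuous_map_proj_pt] show ?thesis
    by (simp add: o_def)
qed

lemma proj_pt_in_region:
  assumes "homogeneous P" "v \<noteq> 0"
  shows "proj_pt M v \<in> region M P \<longleftrightarrow> P v"
proof
  assume "proj_pt M v \<in> region M P"
  then obtain w where "w \<noteq> 0" "P w" "proj_pt M v = proj_pt M w"
    by (auto simp: region_def)
  then show "P v"
    using assms proj_pt_eq_iff unfolding homogeneous_def by metis
qed (use assms in \<open>auto simp: region_def\<close>)

lemma region_subset_topspace: "region M P \<subseteq> topspace rp2"
  by (auto simp: region_def intro: proj_pt_in_topspace)

text \<open>The preimage of the region in \<open>real ^ 3\<close> is the image of an open set under
  a surjective linear map, hence open.\<close>

lemma openin_region: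
  assumes hP: "homogeneous P" and P: "open {v. P v}"
  shows "openin rp2 (region M P)"
proof -
  let ?U = "{v. v \<noteq> 0 \<and> P v}"
  have "?U = {v. P v} - {0}" by auto
  then have "open ?U" using P by (simp add: open_delete)
  then have "open (M ` ?U)"
    using open_surjective_linear_image lin bij_is_surj[OF bij] by blast
  moreover have "{x \<in> UNIV - {0}. rp2_class x \<in> region M P} = M ` ?U"
  proof (intro set_eqI iffI)
    fix x assume "x \<in> {x \<in> UNIV - {0}. rp2_class x \<in> region M P}"
    moreover obtain v where v: "x = M v" using bij by (metis bij_pointE)
    ultimately have "v \<noteq> 0" "proj_pt M v \<in> region M P"
      using lin by (auto simp: proj_pt_def linear_0)
    then show "x \<in> M ` ?U" using proj_pt_in_region[OF hP] v by auto
  qed (use M_nonzero in \<open>auto simp: region_def proj_pt_def[abs_def]\<close>)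
  moreover have "region M P \<subseteq> rp2_class ` (UNIV - {0})"
    using region_subset_topspace topspace_rp2 by simp
  ultimately show ?thesis
    using open_subset[of "M ` ?U" "UNIV - {0}"] M_nonzero
    by (auto simp: rp2_def openin_quotient_topology)
qed

lemma connectedin_proj_pt_image:
  assumes "connected C" "0 \<notin> C"
  shows "connectedin rp2 (proj_pt M ` C)"
proof -
  have "connectedin (top_of_set (UNIV - {0})) C"
    using assms by (auto simp: connectedin_subtopology)
  then show ?thesis
    using connectedin_continuous_map_image continuous_map_proj_pt by blast
qed

lemma proj_pt_in_closure:
  assumes "v \<in> closure C" "v \<noteq> 0" "0 \<notin> C"
  shows "proj_pt M v \<in> rp2 closure_of (proj_pt M ` C)"
proof -
  have "v \<in> (top_of_set (UNIV - {0})) closure_of C"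
  proof -
    have "(UNIV - {0}) \<inter> C = C" using assms(3) by blast
    then show ?thesis
      using assms(1,2) unfolding closure_of_subtopology by simp
  qed
  then show ?thesis
    using continuous_map_image_closure_subset[OF continuous_map_proj_pt, of C] by blast
qed

lemma homogeneous_octant:
  "homogeneous (\<lambda>(x, y, z). 0 < (a * x) * (b * y) \<and> 0 < (a * x) * (c * z))"
proof -
  have *: "0 < (a * (k * x)) * (b * (k * y)) \<longleftrightarrow> 0 < (a * x) * (b * y)" if "k \<noteq> 0" for a b k x y :: real
  proof -
    have "(a * (k * x)) * (b * (k * y)) = (k * k) * ((a * x) * (b * y))" by (simp add: mult_ac)
    moreover have "0 < k * k" using that by (metis not_real_square_gt_zero)
    ultimately show ?thesis by (metis zero_less_mult_pos mult_pos_pos)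
  qed
  show ?thesis by (auto simp: homogeneous_def *)
qed

lemma proj_pt_in_octant:
  assumes "(x, y, z) \<noteq> 0"
  shows "proj_pt M (x, y, z) \<in> octant M a b c \<longleftrightarrow> 0 < (a * x) * (b * y) \<and> 0 < (a * x) * (c * z)"
  using proj_pt_in_region[OF homogeneous_octant assms] by (simp add: octant_def)

text \<open>The sign condition defining an octant describes two opposite open cones. Selecting the
  representative in one of them gives a convex set, which is the form suited to connectedness and
  closures.\<close>

lemma octant_image: "octant M a b c = proj_pt M ` {(x, y, z). 0 < a * x \<and> 0 < b * y \<and> 0 < c * z}"
proof (intro set_eqI iffI)
  fix p assume "p \<in> octant M a b c"
  then obtain x y z where p: "p = proj_pt M (x, y, z)" "(x, y, z) \<noteq> 0"
      "0 < (a * x) * (b * y)" "0 < (a * x) * (c * z)"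
    by (auto simp: octant_def region_def)
  show "p \<in> proj_pt M ` {(x, y, z). 0 < a * x \<and> 0 < b * y \<and> 0 < c * z}"
  proof (cases "0 < a * x")
    case True
    then have "0 < b * y" "0 < c * z" using p(3,4) zero_less_mult_pos by blast+
    then show ?thesis using True p(1) by blast
  next
    case False
    have "p = proj_pt M (- x, - y, - z)"
      using proj_pt_scale[of "-1" "(x, y, z)"] p by simp
    moreover have "0 < a * (- x)" "0 < b * (- y)" "0 < c * (- z)"
      using p(3,4) False unfolding zero_less_mult_iff[of "a * x"] by auto
    ultimately show ?thesis by (intro image_eqI[of _ _ "(- x, - y, - z)"]) simp_all
  qed
next
  fix p assume "p \<in> proj_pt M ` {(x, y, z). 0 < a * x \<and> 0 < b * y \<and> 0 < c * z}"
  then obtain x y z where "p = proj_pt M (x, y, z)" "0 < a * x" "0 < b * y" "0 < c * z" by auto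
  moreover from this have "(x, y, z) \<noteq> 0" by (auto simp: zero_prod_def)
  ultimately show "p \<in> octant M a b c"
    by (simp add: proj_pt_in_octant)
qed

lemma openin_octant: "openin rp2 (octant M a b c)"
  unfolding octant_def
proof (rule openin_region[OF homogeneous_octant])
  have "{v. case v of (x, y, z) \<Rightarrow> 0 < (a * x) * (b * y) \<and> 0 < (a * x) * (c * z)} =
      {v. 0 < (a * fst v) * (b * fst (snd v))} \<inter> {v. 0 < (a * fst v) * (c * snd (snd v))}" by auto
  also have "open \<dots>"
    by (intro open_Int open_Collect_less continuous_intros)
  finally show "open {v. case v of (x, y, z) \<Rightarrow> 0 < (a * x) * (b * y) \<and> 0 < (a * x) * (c * z)}" .
qed

lemma connectedin_octant: "connectedin rp2 (octant M a b c)"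
proof -
  have "{(x, y, z). 0 < a * x \<and> 0 < b * y \<and> 0 < c * z} =
    {x. 0 < a * x} \<times> {y. 0 < b * y} \<times> {z. 0 < c * z}" by auto
  moreover have "convex {x::real. 0 < a * x}" for a
    using convex_halfspace_gt[of 0 a] by (simp add: inner_real_def)
  ultimately have "convex {(x, y, z). 0 < a * x \<and> 0 < b * y \<and> 0 < c * z}"
    by (auto intro!: convex_Times)
  then show ?thesis unfolding octant_image
    by (intro connectedin_proj_pt_image convex_connected) (auto simp: zero_prod_def)
qed

lemma octant_nonempty: "a \<noteq> 0 \<Longrightarrow> b \<noteq> 0 \<Longrightarrow> c \<noteq> 0 \<Longrightarrow> octant M a b c \<noteq> {}"
proof -
  assume "a \<noteq> 0" "b \<noteq> 0" "c \<noteq> 0"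
  then have "0 < a * a" "0 < b * b" "0 < c * c" by (auto simp: zero_less_mult_iff)
  then have "proj_pt M (a, b, c) \<in> octant M a b c" unfolding octant_image by blast
  then show ?thesis by blast
qed

lemma octant_uminus: "octant M (- a) (- b) (- c) = octant M a b c"
  by (simp add: octant_def)

text \<open>Replacing the vanishing coordinate by a small number of the sign of \<open>b\<close>
  leads into the octant.\<close>

lemma side_in_closure_octant:
  assumes "0 < (a * x) * (c * z)" "b \<noteq> 0"
  shows "proj_pt M (x, 0, z) \<in> rp2 closure_of octant M a b c"
proof -
  have *: "proj_pt M (x, 0, z) \<in> rp2 closure_of octant M a b c" if "0 < a * x" "0 < c * z" for x z
    unfolding octant_image
  proof (rule proj_pt_in_closure)
    show "(x, 0, z) \<in> closure {(x, y, z). 0 < a * x \<and> 0 < b * y \<and> 0 < c * z}"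
      unfolding closure_approachable
    proof (intro allI impI)
      fix e :: real assume "0 < e"
      then have "0 < b * (sgn b * (e / 2))" "dist (x, sgn b * (e / 2), z) (x, 0, z) < e"
        using assms(2) by (auto simp: dist_Pair_Pair dist_real_def abs_mult sgn_if mult_neg_pos)
      then show "\<exists>v\<in>{(x, y, z). 0 < a * x \<and> 0 < b * y \<and> 0 < c * z}. dist v (x, 0, z) < e"
        using that by blast
    qed
  qed (use that in \<open>auto simp: zero_prod_def\<close>)
  consider "0 < a * x" "0 < c * z" | "0 < a * (- x)" "0 < c * (- z)"
    using assms(1) unfolding zero_less_mult_iff[of "a * x"] by auto
  then show ?thesis
  proof cases
    case 2
    then have "(x, 0 :: real, z) \<noteq> 0" by (auto simp: zero_prod_def)
    then have "proj_pt M (x, 0, z) = proj_pt M (- x, 0, - z)"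
      using proj_pt_scale[of "-1" "(x, 0, z)"] by simp
    then show ?thesis using *[OF 2] by simp
  qed (rule *)
qed

end

text \<open>The cyclic order of labels matches that of the coordinates and puts line
  \<open>k\<close> at \<open>y = 0\<close>. Shifting \<open>k\<close> by one is then the same as
  rotating the coordinates, and statements about \<open>y = 0\<close> serve all three lines.\<close>

definition adapted :: "(3 \<Rightarrow> rp2_point set) \<Rightarrow> 3 \<Rightarrow> (r3 \<Rightarrow> real ^ 3) \<Rightarrow> bool" where
  "adapted L k M \<longleftrightarrow> homogeneous_coordinates M \<and> L k = region M (\<lambda>(x, y, z). y = 0) \<and>
     L (k + 1) = region M (\<lambda>(x, y, z). z = 0) \<and> L (k + 2) = region M (\<lambda>(x, y, z). x = 0)"

lemma UNIV_3_shift: "(UNIV :: 3 set) = {k, k + 1, k + 2}" "- {k} = {k + 1, k + 2}"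
  "k + 1 + 1 = k + (2::3)" "k + 2 + 1 = (k::3)" "k + 1 + 2 = (k::3)"
proof -
  have a: "(4::3) = 1" "(5::3) = 2" by simp_all
  show U: "(UNIV :: 3 set) = {k, k + 1, k + 2}"
    using exhaust_3[of k] unfolding UNIV_3 by (elim disjE, simp_all add: a) (blast+)
  show "k + 1 + 1 = k + 2" "k + 2 + 1 = k" "k + 1 + 2 = k"
    by (simp_all add: add.assoc)
  have "k + 1 \<noteq> k" "k + 2 \<noteq> k" by simp_all
  then show "- {k} = {k + 1, k + 2}" unfolding Compl_eq_Diff_UNIV U by auto
qed

lemma region_Un: "region M P \<union> region M Q = region M (\<lambda>v. P v \<or> Q v)"
  by (auto simp: region_def)

lemma region_eqI:
  assumes "\<And>v. v \<noteq> 0 \<Longrightarrow> P v \<longleftrightarrow> Q v"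
  shows "region M P = region M Q"
  using assms by (auto simp: region_def)

lemma exhaust_3_shift: "j = k \<or> j = k + 1 \<or> j = k + (2::3)"
  using UNIV_3_shift(1)[of k] by blast

lemma adapted_Union:
  assumes "adapted L k M"
  shows "(\<Union>j. L j) = region M (\<lambda>(x, y, z). x = 0 \<or> y = 0 \<or> z = 0)"
proof -
  have "(\<Union>j. L j) = L k \<union> L (k + 1) \<union> L (k + 2)"
  proof
    show "(\<Union>j. L j) \<subseteq> L k \<union> L (k + 1) \<union> L (k + 2)"
    proof
      fix p assume "p \<in> (\<Union>j. L j)"
      then obtain j where "p \<in> L j" by blast
      then show "p \<in> L k \<union> L (k + 1) \<union> L (k + 2)" using exhaust_3_shift[of j k] by blast
    qed
  qed blast
  also have "\<dots> = region M (\<lambda>v. ((case v of (x, y, z) \<Rightarrow> y = 0) \<or> (case v of (x, y, z) \<Rightarrow> z = 0)) \<or> (case v of (x, y, z) \<Rightarrow> x = 0))"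
    using assms unfolding adapted_def by (metis region_Un)
  also have "\<dots> = region M (\<lambda>(x, y, z). x = 0 \<or> y = 0 \<or> z = 0)"
    by (rule region_eqI) auto
  finally show ?thesis .
qed

section \<open>Triangles and segments of three coordinate lines\<close>

text \<open>The two open segments of the line \<open>y = 0\<close>: with \<open>c = 1\<close> the
  coordinates \<open>x\<close> and \<open>z\<close> have equal signs, which is a side of the
  positive octant; \<open>c = -1\<close> gives the far segment.\<close>

definition side :: "(r3 \<Rightarrow> real ^ 3) \<Rightarrow> real \<Rightarrow> rp2_point set" where
  "side M c = region M (\<lambda>(x, y, z). y = 0 \<and> 0 < x * (c * z))"

lemma homogeneous_mult_pos: "homogeneous (\<lambda>(x, y, z). 0 < x * (c * z))"
proof -
  have "0 < (k * x) * (c * (k * z))" if "k \<noteq> 0" "0 < x * (c * z)" for k x z :: real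
  proof -
    have "0 < k * k" using that by (metis not_real_square_gt_zero)
    then have "0 < (k * k) * (x * (c * z))" using that(2) by (rule mult_pos_pos)
    then show ?thesis by (simp add: mult_ac)
  qed
  then show ?thesis by (simp add: homogeneous_def)
qed

lemma homogeneous_side: "homogeneous (\<lambda>(x, y, z). y = 0 \<and> 0 < x * (c * z))"
  using homogeneous_mult_pos[of c] by (simp add: homogeneous_def)

lemma homogeneous_zero:
  "homogeneous (\<lambda>(x, y, z). x = 0)" "homogeneous (\<lambda>(x, y, z). y = 0)"
  "homogeneous (\<lambda>(x, y, z). z = 0)" "homogeneous (\<lambda>(x, y, z). x = 0 \<or> y = 0 \<or> z = 0)"
  by (auto simp: homogeneous_def)

context homogeneous_coordinates
begin

lemma rp2_point_cases:
  assumes "p \<in> topspace rp2"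
  obtains x y z where "(x, y, z) \<noteq> 0" "p = proj_pt M (x, y, z)"
  using assms unfolding topspace_rp2_eq by (metis Diff_iff imageE prod_cases3 singletonI)

lemma proj_pt_in_side:
  assumes "(x, y, z) \<noteq> 0"
  shows "proj_pt M (x, y, z) \<in> side M c \<longleftrightarrow> y = 0 \<and> 0 < x * (c * z)"
  using proj_pt_in_region[OF homogeneous_side assms] by (simp add: side_def)

lemma proj_pt_on_lines:
  assumes "(x, y, z) \<noteq> 0"
  shows "proj_pt M (x, y, z) \<in> region M (\<lambda>(x, y, z). x = 0 \<or> y = 0 \<or> z = 0) \<longleftrightarrow>
    x = 0 \<or> y = 0 \<or> z = 0"
  using proj_pt_in_region[OF homogeneous_zero(4) assms] by simp

lemma side_image: "side M c = proj_pt M ` ({x. 0 < x} \<times> {0} \<times> {z. 0 < c * z})"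
proof (intro set_eqI iffI)
  fix p assume "p \<in> side M c"
  then obtain v where v: "p = proj_pt M v" "v \<noteq> 0" "case v of (x, y, z) \<Rightarrow> y = 0 \<and> 0 < x * (c * z)"
    unfolding side_def region_def by blast
  obtain x y z where xyz: "v = (x, y, z)" by (rule prod_cases3)
  have p: "p = proj_pt M (x, 0, z)" "(x, 0 :: real, z) \<noteq> 0" "0 < x * (c * z)"
    using v unfolding xyz by auto
  show "p \<in> proj_pt M ` ({x. 0 < x} \<times> {0} \<times> {z. 0 < c * z})"
  proof (cases "0 < x")
    case True
    then have "0 < c * z" using p(3) zero_less_mult_pos by blast
    then show ?thesis using True p(1) by blast
  next
    case False
    have "p = proj_pt M (- x, 0, - z)"
      using proj_pt_scale[of "-1" "(x, 0, z)"] p by simp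
    moreover have "0 < - x" "0 < c * (- z)"
      using p(3) False unfolding zero_less_mult_iff[of x] by auto
    ultimately show ?thesis by blast
  qed
next
  fix p assume "p \<in> proj_pt M ` ({x. 0 < x} \<times> {0} \<times> {z. 0 < c * z})"
  then obtain x z where "p = proj_pt M (x, 0, z)" "0 < x" "0 < c * z" by auto
  moreover from this have "(x, 0 :: real, z) \<noteq> 0" by (auto simp: zero_prod_def)
  ultimately show "p \<in> side M c" by (simp add: proj_pt_in_side)
qed

lemma connectedin_side: "connectedin rp2 (side M c)"
proof -
  have "convex {x::real. 0 < a * x}" for a
    using convex_halfspace_gt[of 0 a] by (simp add: inner_real_def)
  from this[of 1] this[of c] have "convex ({x::real. 0 < x} \<times> {0::real} \<times> {z::real. 0 < c * z})"
    by (intro convex_Times) auto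
  then show ?thesis unfolding side_image
    by (intro connectedin_proj_pt_image convex_connected) (auto simp: zero_prod_def)
qed

lemma openin_same_sign: "openin rp2 (region M (\<lambda>(x, y, z). 0 < x * (c * z)))"
proof (rule openin_region[OF homogeneous_mult_pos])
  have "open {v::r3. 0 < fst v * (c * snd (snd v))}"
    by (intro open_Collect_less continuous_intros)
  then show "open {v :: r3. case v of (x, y, z) \<Rightarrow> 0 < x * (c * z)}"
    by (simp add: case_prod_beta)
qed

text \<open>Up to a common sign change, at most one of three nonzero numbers is negative.\<close>

lemma octants_cover:
  assumes "x \<noteq> 0" "y \<noteq> 0" "z \<noteq> 0"
  shows "proj_pt M (x, y, z) \<in>
    octant M 1 1 1 \<union> octant M (-1) 1 1 \<union> octant M 1 (-1) 1 \<union> octant M 1 1 (-1)"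
proof -
  have "(x, y, z) \<noteq> 0" using assms by (auto simp: zero_prod_def)
  then show ?thesis using assms
    by (simp add: proj_pt_in_octant mult_less_0_iff zero_less_mult_iff) linarith
qed

lemma octants_disjoint:
  "disjnt (octant M 1 1 1) (octant M (-1) 1 1)" "disjnt (octant M 1 1 1) (octant M 1 (-1) 1)"
  "disjnt (octant M 1 1 1) (octant M 1 1 (-1))" "disjnt (octant M (-1) 1 1) (octant M 1 (-1) 1)"
  "disjnt (octant M (-1) 1 1) (octant M 1 1 (-1))" "disjnt (octant M 1 (-1) 1) (octant M 1 1 (-1))"
proof -
  have *: "disjnt (octant M a b c) (octant M a' b' c')"
    if "\<And>x y z. \<not> (0 < (a * x) * (b * y) \<and> 0 < (a * x) * (c * z) \<and>
      0 < (a' * x) * (b' * y) \<and> 0 < (a' * x) * (c' * z))" for a b c a' b' c'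
    unfolding disjnt_iff
  proof (intro allI notI)
    fix p assume p: "p \<in> octant M a b c \<and> p \<in> octant M a' b' c'"
    then have "p \<in> topspace rp2" using openin_octant openin_subset by blast
    then obtain x y z where "(x, y, z) \<noteq> 0" "p = proj_pt M (x, y, z)" by (rule rp2_point_cases)
    then show False using p that[of x y z] by (simp add: proj_pt_in_octant)
  qed
  show "disjnt (octant M 1 1 1) (octant M (-1) 1 1)" "disjnt (octant M 1 1 1) (octant M 1 (-1) 1)"
    "disjnt (octant M 1 1 1) (octant M 1 1 (-1))" "disjnt (octant M (-1) 1 1) (octant M 1 (-1) 1)"
    "disjnt (octant M (-1) 1 1) (octant M 1 1 (-1))" "disjnt (octant M 1 (-1) 1) (octant M 1 1 (-1))"
    by (rule *; auto)+
qed

lemma octants_distinct: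
  "distinct [octant M 1 1 1, octant M (-1) 1 1, octant M 1 (-1) 1, octant M 1 1 (-1)]"
  using octants_disjoint octant_nonempty[of 1 1 1] octant_nonempty[of "-1" 1 1]
    octant_nonempty[of 1 "-1" 1] by (auto simp: disjnt_def)

lemma octant_off_lines:
  assumes "p \<in> octant M a b c"
  shows "p \<in> topspace rp2" "p \<notin> region M (\<lambda>(x, y, z). x = 0 \<or> y = 0 \<or> z = 0)"
proof -
  show p: "p \<in> topspace rp2" using assms openin_octant openin_subset by blast
  then obtain x y z where "(x, y, z) \<noteq> 0" "p = proj_pt M (x, y, z)" by (rule rp2_point_cases)
  then show "p \<notin> region M (\<lambda>(x, y, z). x = 0 \<or> y = 0 \<or> z = 0)"
    using assms by (auto simp: proj_pt_on_lines proj_pt_in_octant)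
qed

text \<open>The sign relation between \<open>x\<close> and \<open>z\<close> that holds on the
  segment persists on an open neighbourhood of it, so a set on which it fails cannot accumulate
  there.\<close>

lemma side_not_in_closure:
  assumes "p \<in> side M c" "T \<inter> region M (\<lambda>(x, y, z). 0 < x * (c * z)) = {}"
  shows "p \<notin> rp2 closure_of T"
proof -
  have "p \<in> region M (\<lambda>(x, y, z). 0 < x * (c * z))"
    using assms(1) by (auto simp: side_def region_def)
  then show ?thesis using assms(2) openin_same_sign[of c] by (auto simp: in_closure_of)
qed

lemma side_nonempty: "c \<noteq> 0 \<Longrightarrow> side M c \<noteq> {}"
proof -
  assume "c \<noteq> 0"
  then have "0 < c * c" by (auto simp: zero_less_mult_iff)
  then have "proj_pt M (1, 0, c) \<in> side M c" unfolding side_image by auto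
  then show ?thesis by blast
qed

end

lemma connected_components_of_open_partition_subtopology:
  assumes "X \<subseteq> topspace Y" "X = \<Union>\<U>" "\<And>A. A \<in> \<U> \<Longrightarrow> connectedin Y A" "{} \<notin> \<U>"
    "pairwise disjnt \<U>" "\<And>A. A \<in> \<U> \<Longrightarrow> \<exists>W. openin Y W \<and> A = W \<inter> X"
  shows "connected_components_of (subtopology Y X) = \<U>"
proof (rule connected_components_of_open_partition)
  show "topspace (subtopology Y X) = \<Union>\<U>" using assms(1,2) by auto
  show "connectedin (subtopology Y X) A" if "A \<in> \<U>" for A
    using assms(2,3) that by (auto simp: connectedin_subtopology)
  show "openin (subtopology Y X) A" if "A \<in> \<U>" for A
    using assms(6) that by (auto simp: openin_subtopology)
qed (use assms in auto)

lemma triangles_adapted: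
  assumes "adapted L k M"
  shows "triangles L = {octant M 1 1 1, octant M (-1) 1 1, octant M 1 (-1) 1, octant M 1 1 (-1)}"
    (is "_ = ?U")
  unfolding triangles_def adapted_Union[OF assms]
proof (rule connected_components_of_open_partition_subtopology)
  interpret homogeneous_coordinates M using assms by (simp add: adapted_def)
  let ?X = "topspace rp2 - region M (\<lambda>(x, y, z). x = 0 \<or> y = 0 \<or> z = 0)"
  show "?X \<subseteq> topspace rp2" by blast
  show X: "?X = \<Union>?U"
  proof
    show "?X \<subseteq> \<Union>?U"
    proof
      fix p assume p: "p \<in> ?X"
      then obtain x y z where "(x, y, z) \<noteq> 0" "p = proj_pt M (x, y, z)"
        using rp2_point_cases by blast
      then show "p \<in> \<Union>?U" using octants_cover[of x y z] p proj_pt_on_lines[of x y z] by auto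
    qed
    show "\<Union>?U \<subseteq> ?X" using octant_off_lines by blast
  qed
  show "connectedin rp2 A" if "A \<in> ?U" for A using that connectedin_octant by blast
  show "\<exists>W. openin rp2 W \<and> A = W \<inter> ?X" if "A \<in> ?U" for A
  proof -
    have "openin rp2 A" using that openin_octant by blast
    moreover have "A = A \<inter> ?X" using X that by blast
    ultimately show ?thesis by blast
  qed
  show "{} \<notin> ?U" using octant_nonempty by (simp add: eq_commute[of "{}"])
  show "pairwise disjnt ?U"
    by (auto simp only: pairwise_insert pairwise_empty octants_disjoint octants_disjoint[THEN disjnt_sym]
        insert_iff empty_iff)
qed

text \<open>A segment is not open in the projective plane, but it is the trace on the punctured line
  of the open region where \<open>x\<close> and \<open>z\<close> have the given sign
  relation.\<close>

lemma segments_adapted: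
  assumes "adapted L k M"
  shows "segments L k = {side M 1, side M (-1)}"
  unfolding segments_def
proof (rule connected_components_of_open_partition_subtopology)
  interpret homogeneous_coordinates M using assms by (simp add: adapted_def)
  let ?X = "L k - (\<Union>j\<in>-{k}. L j)"
  have L: "L k = region M (\<lambda>(x, y, z). y = 0)" "L (k + 1) = region M (\<lambda>(x, y, z). z = 0)"
    "L (k + 2) = region M (\<lambda>(x, y, z). x = 0)" using assms by (auto simp: adapted_def)
  have X: "?X = region M (\<lambda>(x, y, z). y = 0) - region M (\<lambda>(x, y, z). z = 0) - region M (\<lambda>(x, y, z). x = 0)"
  proof -
    have "(\<Union>j\<in>-{k}. L j) = L (k + 1) \<union> L (k + 2)" unfolding UNIV_3_shift(2) by simp
    then show ?thesis unfolding L by blast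
  qed
  show t: "?X \<subseteq> topspace rp2" using X region_subset_topspace by blast
  have inX: "proj_pt M (x, y, z) \<in> ?X \<longleftrightarrow> y = 0 \<and> x \<noteq> 0 \<and> z \<noteq> 0" if "(x, y, z) \<noteq> 0" for x y z
    unfolding X using proj_pt_in_region[OF homogeneous_zero(1) that]
      proj_pt_in_region[OF homogeneous_zero(2) that] proj_pt_in_region[OF homogeneous_zero(3) that]
    unfolding Diff_iff case_prod_conv by blast
  have side_eq: "side M c = region M (\<lambda>(x, y, z). 0 < x * (c * z)) \<inter> ?X" for c
  proof (intro set_eqI)
    fix p
    have "p \<in> topspace rp2" if "p \<in> side M c \<or> p \<in> ?X"
      using that t region_subset_topspace unfolding side_def by blast
    moreover have "p \<in> side M c \<longleftrightarrow> p \<in> region M (\<lambda>(x, y, z). 0 < x * (c * z)) \<inter> ?X" if "p \<in> topspace rp2"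
    proof -
      obtain x y z where "(x, y, z) \<noteq> 0" "p = proj_pt M (x, y, z)"
        using \<open>p \<in> topspace rp2\<close> by (rule rp2_point_cases)
      then show ?thesis
        using inX[of x y z] proj_pt_in_region[OF homogeneous_mult_pos, of "(x, y, z)" c]
          proj_pt_in_side[of x y z c] by force
    qed
    ultimately show "p \<in> side M c \<longleftrightarrow> p \<in> region M (\<lambda>(x, y, z). 0 < x * (c * z)) \<inter> ?X" by blast
  qed
  show "?X = \<Union>{side M 1, side M (-1)}"
  proof
    show "?X \<subseteq> \<Union>{side M 1, side M (-1)}"
    proof
      fix p assume p: "p \<in> ?X"
      then obtain x y z where xyz: "(x, y, z) \<noteq> 0" "p = proj_pt M (x, y, z)"
        using t rp2_point_cases by blast
      then have "y = 0" "x \<noteq> 0" "z \<noteq> 0" using p inX by auto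
      then show "p \<in> \<Union>{side M 1, side M (-1)}"
        using xyz by (simp add: proj_pt_in_side zero_less_mult_iff mult_less_0_iff) linarith
    qed
    show "\<Union>{side M 1, side M (-1)} \<subseteq> ?X" using side_eq by blast
  qed
  show "connectedin rp2 A" if "A \<in> {side M 1, side M (-1)}" for A
    using that connectedin_side by blast
  show "{} \<notin> {side M 1, side M (-1)}" using side_nonempty by (simp add: eq_commute[of "{}"])
  show "\<exists>W. openin rp2 W \<and> A = W \<inter> ?X" if "A \<in> {side M 1, side M (-1)}" for A
    using that side_eq[of 1] side_eq[of "-1"] openin_same_sign[of 1] openin_same_sign[of "-1"]
    by (elim insertE) (metis empty_iff)+
  have "disjnt (side M 1) (side M (-1))"
    unfolding disjnt_iff
  proof (intro allI notI)
    fix p assume p: "p \<in> side M 1 \<and> p \<in> side M (-1)"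
    then obtain x y z where "(x, y, z) \<noteq> 0" "p = proj_pt M (x, y, z)"
      using region_subset_topspace rp2_point_cases unfolding side_def by blast
    then show False using p by (auto simp: proj_pt_in_side)
  qed
  then show "pairwise disjnt {side M 1, side M (-1)}"
    by (simp add: pairwise_insert disjnt_sym)
qed

text \<open>On the far segment \<open>x\<close> and \<open>z\<close> have opposite signs. The two
  octants in which their signs agree stay away from it; the other two have it on their
  boundary.\<close>

lemma adjacent_triangles_far_side:
  assumes "adapted L k M"
  shows "adjacent_triangles L (side M (-1)) = {octant M 1 1 (-1), octant M (-1) 1 1}"
proof -
  interpret homogeneous_coordinates M using assms by (simp add: adapted_def)
  have "side M (-1) \<subseteq> rp2 closure_of octant M 1 1 (-1)" "side M (-1) \<subseteq> rp2 closure_of octant M (-1) 1 1"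
    by (auto simp: side_image mult_less_0_iff intro!: side_in_closure_octant)
  moreover have "\<not> side M (-1) \<subseteq> rp2 closure_of octant M 1 b 1" for b
  proof -
    have "octant M 1 b 1 \<inter> region M (\<lambda>(x, y, z). 0 < x * ((-1) * z)) = {}"
    proof (rule ccontr)
      assume "octant M 1 b 1 \<inter> region M (\<lambda>(x, y, z). 0 < x * ((-1) * z)) \<noteq> {}"
      then obtain p where p: "p \<in> octant M 1 b 1" "p \<in> region M (\<lambda>(x, y, z). 0 < x * ((-1) * z))" by blast
      then obtain x y z where "(x, y, z) \<noteq> 0" "p = proj_pt M (x, y, z)"
        using octant_off_lines(1) rp2_point_cases by blast
      then show False using p proj_pt_in_region[OF homogeneous_mult_pos, of "(x, y, z)" "-1"]
        by (auto simp: proj_pt_in_octant)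
    qed
    moreover obtain p where "p \<in> side M (-1)" using side_nonempty[of "-1"] by fastforce
    ultimately show ?thesis using side_not_in_closure by blast
  qed
  ultimately show ?thesis
    unfolding adjacent_triangles_def triangles_adapted[OF assms] by auto
qed

lemma far_segment_adapted:
  assumes "adapted L k M" "T0 = octant M 1 1 1"
  shows "far_segment L T0 k = side M (-1)"
proof -
  interpret homogeneous_coordinates M using assms by (simp add: adapted_def)
  have "side M 1 \<subseteq> rp2 closure_of octant M 1 1 1"
    by (auto simp: side_image intro!: side_in_closure_octant)
  then have "T0 \<in> adjacent_triangles L (side M 1)"
    unfolding adjacent_triangles_def triangles_adapted[OF assms(1)] using assms(2) by simp
  moreover have "T0 \<notin> adjacent_triangles L (side M (-1))"
    unfolding adjacent_triangles_far_side[OF assms(1)] using assms(2) octants_distinct by simp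
  ultimately show ?thesis
    unfolding far_segment_def segments_adapted[OF assms(1)] by (intro the_equality) auto
qed

section \<open>The planar polygon of one oval\<close>

text \<open>On a segment that is not horizontal the second coordinate determines the parameter.
  Eliminating it leaves linear constraints once the end points are numerals.\<close>

lemma mem_segment_up:
  fixes a b c d x y :: real
  assumes "b < d"
  shows "(x, y) \<in> closed_segment (a, b) (c, d) \<longleftrightarrow> b \<le> y \<and> y \<le> d \<and> (x - a) * (d - b) = (c - a) * (y - b)"
proof
  assume "(x, y) \<in> closed_segment (a, b) (c, d)"
  then obtain u where u: "0 \<le> u" "u \<le> 1" "x = (1 - u) * a + u * c" "y = (1 - u) * b + u * d"
    by (auto simp: closed_segment_def)
  have y: "y - b = u * (d - b)" "d - y = (1 - u) * (d - b)"
    unfolding u(4) by (simp_all only: algebra_simps)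
  have x: "x - a = u * (c - a)" unfolding u(3) by (simp add: algebra_simps)
  have "0 \<le> y - b" "0 \<le> d - y" unfolding y using u assms by simp_all
  moreover have "(x - a) * (d - b) = (c - a) * (y - b)"
    unfolding x y by (simp add: mult_ac)
  ultimately show "b \<le> y \<and> y \<le> d \<and> (x - a) * (d - b) = (c - a) * (y - b)" by simp
next
  assume *: "b \<le> y \<and> y \<le> d \<and> (x - a) * (d - b) = (c - a) * (y - b)"
  define u where "u = (y - b) / (d - b)"
  have "y - b = u * (d - b)" using assms by (simp add: u_def)
  moreover from this have "(x - a) * (d - b) = (u * (c - a)) * (d - b)" using * by (simp add: mult_ac)
  then have "x - a = u * (c - a)" using assms by simp
  ultimately have "(x, y) = (1 - u) *\<^sub>R (a, b) + u *\<^sub>R (c, d)"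
    by (simp add: algebra_simps)
  moreover have "0 \<le> u" "u \<le> 1" using * assms by (auto simp: u_def field_simps)
  ultimately show "(x, y) \<in> closed_segment (a, b) (c, d)"
    unfolding closed_segment_def by blast
qed

lemma mem_segment_down:
  fixes a b c d x y :: real
  assumes "d < b"
  shows "(x, y) \<in> closed_segment (a, b) (c, d) \<longleftrightarrow> d \<le> y \<and> y \<le> b \<and> (x - c) * (b - d) = (a - c) * (y - d)"
  using mem_segment_up[OF assms, of x y c a] by (simp add: closed_segment_commute)

text \<open>
  The polygon of one oval, in a chart in which the line is the axis \<open>y = 0\<close> and the bulge side lies
  above it. Only the vertices \<open>V\<close> and \<open>W\<close> differ between the two arrangements.
\<close>

definition outer_path :: "real \<times> real \<Rightarrow> real \<times> real \<Rightarrow> real \<Rightarrow> real \<times> real" where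
  "outer_path V W = linepath (1, 0) (3, 2) +++ linepath (3, 2) V +++ linepath V W +++ linepath W (7, 0)"

definition inner_path :: "real \<Rightarrow> real \<times> real" where
  "inner_path = linepath (3, 0) (4, 1) +++ linepath (4, 1) (5, 0)"

definition left_path :: "real \<Rightarrow> real \<times> real" where
  "left_path = linepath (1, 0) (3, -1) +++ linepath (3, -1) (3, 0)"

definition right_path :: "real \<Rightarrow> real \<times> real" where
  "right_path = linepath (5, 0) (5, -1) +++ linepath (5, -1) (7, 0)"

lemmas oval_path_defs = outer_path_def inner_path_def left_path_def right_path_def

text \<open>All vertices are sums of the two ends of a lattice edge, that is, doubled midpoints. The
  points 1, 3, 5, 7 of the axis come from the four unit edges on one side of T, whose ends alternate
  in sign along the far segment. The first two paths lie on the bulge side; the other two are the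
  feet beyond the axis.\<close>

definition polygon :: "real \<times> real \<Rightarrow> real \<times> real \<Rightarrow> (real \<times> real) set" where
  "polygon V W = path_image (outer_path V W) \<union> path_image inner_path \<union>
     (path_image left_path \<union> path_image right_path)"

lemma path_images:
  "path_image (outer_path V W) = closed_segment (1, 0) (3, 2) \<union> closed_segment (3, 2) V \<union>
     closed_segment V W \<union> closed_segment W (7, 0)"
  "path_image inner_path = closed_segment (3, 0) (4, 1) \<union> closed_segment (4, 1) (5, 0)"
  "path_image left_path = closed_segment (1, 0) (3, -1) \<union> closed_segment (3, -1) (3, 0)"
  "path_image right_path = closed_segment (5, 0) (5, -1) \<union> closed_segment (5, -1) (7, 0)"
  by (simp_all add: oval_path_defs path_image_join Un_assoc)

lemma oval_path_ends [simp]: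
  "pathstart (outer_path V W) = (1, 0)" "pathfinish (outer_path V W) = (7, 0)"
  "pathstart inner_path = (3, 0)" "pathfinish inner_path = (5, 0)"
  "pathstart left_path = (1, 0)" "pathfinish left_path = (3, 0)"
  "pathstart right_path = (5, 0)" "pathfinish right_path = (7, 0)"
  by (simp_all add: oval_path_defs)

lemma arc_small_paths: "arc inner_path" "arc left_path" "arc right_path"
  unfolding oval_path_defs
  by (auto intro!: arc_join arc_linepath simp: mem_segment_up mem_segment_down)

text \<open>The vertices \<open>VA\<close>, \<open>WA\<close> belong to the arrangement $\mathcal A$, the vertices \<open>VP\<close>, \<open>WP\<close> to $\mathcal A^{+}$.\<close>

abbreviation "VA \<equiv> (2, 3) :: real \<times> real"
abbreviation "WA \<equiv> (1, 6) :: real \<times> real"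
abbreviation "VP \<equiv> (3, 3) :: real \<times> real"
abbreviation "WP \<equiv> (6, 1) :: real \<times> real"

lemma arc_outer_path: "arc (outer_path VA WA)" "arc (outer_path VP WP)"
  unfolding oval_path_defs
  by (auto intro!: arc_join arc_linepath simp: path_image_join mem_segment_up mem_segment_down)

text \<open>
  The polygon is not star-shaped because its feet point towards each other. Spreading the half-plane
  below the axis makes it star-shaped about \<open>(4, 2)\<close>; \<open>plane_fold\<close> undoes the spreading, and the
  gauges below are those of the two spread polygons, with \<open>(4, 2)\<close> moved to the origin.
\<close>

definition plane_fold :: "real \<times> real \<Rightarrow> real \<times> real" where
  "plane_fold w = (4 + max 0 (fst w + 3 * min (snd w + 2) 0) - max 0 (- fst w + 3 * min (snd w + 2) 0),
     snd w + 2)"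

text \<open>In a unit ball \<open>max\<close> intersects half-planes and \<open>min\<close> unites
  them, and every linear form is scaled so that its edge is at level 1. The two arguments of
  \<open>min\<close> are the bounds of the left and of the right foot along the notch between
  them.\<close>

definition gauge_below :: "real \<times> real \<Rightarrow> real" where
  "gauge_below = (\<lambda>(x, y). min (max (x - y) ((x - 3 * y) / 5)) (max (- (x + y)) (- (x + 3 * y) / 5)))"

text \<open>The form \<open>x + y\<close> is the long edge ending at (7, 0); the \<open>min\<close>
  term is the reentrant corner at (3, 2), which has moved to (-1, 0).\<close>

definition gauge_A :: "real \<times> real \<Rightarrow> real" where
  "gauge_A = (\<lambda>(x, y). max (max (x + y) (min (max (- (x + y)) (- (3 * x + y) / 5)) (y - x)))
     (gauge_below (x, y)))"

text \<open>Compared with \<open>gauge_A\<close>, the form \<open>2 * x + 3 * y\<close> cuts off the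
  bulge along the edge from \<open>VP\<close> to \<open>WP\<close>, and the edge at the reentrant
  corner is vertical.\<close>

definition gauge_P :: "real \<times> real \<Rightarrow> real" where
  "gauge_P = (\<lambda>(x, y). max (max (max (x + y) (2 * x + 3 * y)) (min (- x) (y - x)))
     (gauge_below (x, y)))"

section \<open>Properties of the gauges and of the fold\<close>

lemmas gauge_defs = gauge_A_def gauge_P_def gauge_below_def

lemma gauge_continuous: "continuous_on UNIV gauge_A" "continuous_on UNIV gauge_P"
  unfolding gauge_defs case_prod_beta by (intro continuous_intros; simp)+

lemma gauge_homogeneous:
  assumes "t \<ge> 0"
  shows "gauge_A (t *\<^sub>R w) = t * gauge_A w" "gauge_P (t *\<^sub>R w) = t * gauge_P w"
proof -
  have m: "t * max a b = max (t * a) (t * b)" "t * min a b = min (t * a) (t * b)" for a b :: real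
    using assms by (simp_all add: max_mult_distrib_left min_mult_distrib_left)
  obtain x y where w: "w = (x, y)" by (cases w)
  show "gauge_A (t *\<^sub>R w) = t * gauge_A w" "gauge_P (t *\<^sub>R w) = t * gauge_P w"
    unfolding w gauge_defs scaleR_Pair real_scaleR_def prod.case m right_diff_distrib distrib_left
      mult_minus_right times_divide_eq_right mult.left_commute[of t 3] mult.left_commute[of t 2]
    by (rule refl)+
qed

lemma gauge_pos:
  assumes "w \<noteq> 0"
  shows "0 < gauge_A w" "0 < gauge_P w"
proof -
  obtain x y where w: "w = (x, y)" "x \<noteq> 0 \<or> y \<noteq> 0" using assms by (cases w) (auto simp: zero_prod_def)
  then show "0 < gauge_A w" "0 < gauge_P w"
    by (auto simp: gauge_defs max_def min_def split: if_splits)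
qed

lemma continuous_plane_fold: "continuous_on S plane_fold"
  unfolding plane_fold_def by (intro continuous_intros)

lemma real_divide_5: "a / 5 \<le> (1 :: real) \<longleftrightarrow> a \<le> 5" "1 \<le> a / (5 :: real) \<longleftrightarrow> 5 \<le> a"
  by auto

text \<open>Here and in the next lemmas a comparison of a gauge with 1 becomes a Boolean combination
  of linear inequalities, free of \<open>min\<close>, \<open>max\<close> and division. The
  statements about polygons are thereby reduced to linear arithmetic.\<close>

lemma gauge_below_le_1: "gauge_below (x, y) \<le> 1 \<longleftrightarrow>
    x - y \<le> 1 \<and> x - 3 * y \<le> 5 \<or> - (x + y) \<le> 1 \<and> - (x + 3 * y) \<le> 5"
  by (simp only: gauge_below_def prod.case min_le_iff_disj max.bounded_iff real_divide_5 conj_assoc)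

lemma gauge_A_le_1: "gauge_A (x, y) \<le> 1 \<longleftrightarrow> x + y \<le> 1 \<and>
    (- (x + y) \<le> 1 \<and> - (3 * x + y) \<le> 5 \<or> y - x \<le> 1) \<and> gauge_below (x, y) \<le> 1"
  by (simp only: gauge_A_def prod.case min_le_iff_disj max.bounded_iff real_divide_5 conj_assoc)

lemma gauge_P_le_1: "gauge_P (x, y) \<le> 1 \<longleftrightarrow> x + y \<le> 1 \<and> 2 * x + 3 * y \<le> 1 \<and>
    (- x \<le> 1 \<or> y - x \<le> 1) \<and> gauge_below (x, y) \<le> 1"
  by (simp only: gauge_P_def prod.case min_le_iff_disj max.bounded_iff real_divide_5 conj_assoc)

lemma gauge_below_ge_1: "1 \<le> gauge_below (x, y) \<longleftrightarrow>
    (1 \<le> x - y \<or> 5 \<le> x - 3 * y) \<and> (1 \<le> - (x + y) \<or> 5 \<le> - (x + 3 * y))"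
  by (simp only: gauge_below_def prod.case le_max_iff_disj min.bounded_iff real_divide_5 disj_assoc)

lemma gauge_A_ge_1: "1 \<le> gauge_A (x, y) \<longleftrightarrow> 1 \<le> x + y \<or>
    (1 \<le> - (x + y) \<or> 5 \<le> - (3 * x + y)) \<and> 1 \<le> y - x \<or> 1 \<le> gauge_below (x, y)"
  by (simp only: gauge_A_def prod.case le_max_iff_disj min.bounded_iff real_divide_5 disj_assoc)

lemma gauge_P_ge_1: "1 \<le> gauge_P (x, y) \<longleftrightarrow> 1 \<le> x + y \<or> 1 \<le> 2 * x + 3 * y \<or>
    1 \<le> - x \<and> 1 \<le> y - x \<or> 1 \<le> gauge_below (x, y)"
  by (simp only: gauge_P_def prod.case le_max_iff_disj min.bounded_iff real_divide_5 disj_assoc)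

lemma gauge_below_le: "gauge_below w \<le> gauge_A w" "gauge_below w \<le> gauge_P w"
  by (cases w; simp only: gauge_A_def gauge_P_def prod.case max.cobounded2)+

text \<open>Below the axis the two halves are pushed towards each other by three times the depth.
  With the factor 3 the outer edges of the spread feet continue the lines \<open>v - u = 1\<close>
  and \<open>u + v = 1\<close> that carry the first and the last edge of the outer path.\<close>

lemma plane_fold_eq:
  "- 2 \<le> v \<Longrightarrow> plane_fold (u, v) = (u + 4, v + 2)"
  "v \<le> - 2 \<Longrightarrow> - u \<le> 3 * (v + 2) \<Longrightarrow> plane_fold (u, v) = (u + 3 * v + 10, v + 2)"
  "v \<le> - 2 \<Longrightarrow> u \<le> 3 * (v + 2) \<Longrightarrow> plane_fold (u, v) = (u - 3 * v - 2, v + 2)"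
  by (auto simp: plane_fold_def max_def)

text \<open>The fold collapses the wedge between the spread feet to a vertical segment or ray at
  abscissa 4, so it is harmless only away from this wedge. The notch keeps a margin of 1, whence the
  folded feet lie at abscissae at least 5 and at most 3.\<close>

lemma plane_fold_cases:
  assumes "gauge_below (u, v) \<le> 1"
  obtains (above) "- 2 \<le> v" "plane_fold (u, v) = (u + 4, v + 2)"
  | (right) "v < - 2" "- u + 1 \<le> 3 * (v + 2)" "plane_fold (u, v) = (u + 3 * v + 10, v + 2)"
  | (left) "v < - 2" "u + 1 \<le> 3 * (v + 2)" "plane_fold (u, v) = (u - 3 * v - 2, v + 2)"
proof (cases "- 2 \<le> v")
  case False
  then have "- u + 1 \<le> 3 * (v + 2) \<or> u + 1 \<le> 3 * (v + 2)"
    using assms unfolding gauge_below_le_1 by argo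
  then show ?thesis using False plane_fold_eq(2,3)[of v u] that(2,3) by fastforce
qed (use plane_fold_eq(1) that(1) in blast)

text \<open>The fold preserves heights up to a shift, and at a fixed height it is a translation on
  each foot; the two translated feet are separated by the margin just found.\<close>

lemma inj_on_plane_fold: "inj_on plane_fold {w. gauge_A w \<le> 1}" "inj_on plane_fold {w. gauge_P w \<le> 1}"
proof -
  have "inj_on plane_fold {w. gauge_below w \<le> 1}"
  proof (rule inj_onI)
    fix v w :: "real \<times> real"
    assume *: "v \<in> {w. gauge_below w \<le> 1}" "w \<in> {w. gauge_below w \<le> 1}" "plane_fold v = plane_fold w"
    obtain x y where v: "v = (x, y)" by (cases v)
    obtain x' where w: "w = (x', y)" using *(3) v by (cases w) (auto simp: plane_fold_def)
    have "gauge_below (x, y) \<le> 1" "gauge_below (x', y) \<le> 1" using *(1,2) v w by auto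
    then show "v = w" using *(3) unfolding v w
      by (elim plane_fold_cases) (simp_all only: prod.inject, auto)
  qed
  then show "inj_on plane_fold {w. gauge_A w \<le> 1}" "inj_on plane_fold {w. gauge_P w \<le> 1}"
    using gauge_below_le order_trans by (blast intro: inj_on_subset)+
qed

text \<open>
  The part of the disk below the axis stays closer to the axis than \<open>1\<close>, except for two vertices;
  this is what keeps it away from the bulge of the neighbouring oval.
\<close>

lemma plane_fold_gauge_bounds:
  assumes "(x, y) \<in> plane_fold ` {w. gauge_A w \<le> 1} \<union> plane_fold ` {w. gauge_P w \<le> 1}"
  shows "0 < x" "x + \<bar>y\<bar> < 8" "y < 0 \<Longrightarrow> - 1 < y \<or> y = -1 \<and> (x = 3 \<or> x = 5)"
proof -
  obtain u v where uv: "gauge_A (u, v) \<le> 1 \<or> gauge_P (u, v) \<le> 1" "(x, y) = plane_fold (u, v)"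
    using assms by auto
  then have b: "gauge_below (u, v) \<le> 1" using gauge_below_le order_trans by blast
  have "0 < x \<and> x + \<bar>y\<bar> < 8 \<and> (y < 0 \<longrightarrow> - 1 < y \<or> y = -1 \<and> (x = 3 \<or> x = 5))"
    using b
  proof (cases rule: plane_fold_cases)
    case above
    then show ?thesis using uv(1) uv(2) unfolding gauge_A_le_1 gauge_P_le_1 gauge_below_le_1 by auto
  next
    case right
    then show ?thesis using uv(1) uv(2) unfolding gauge_A_le_1 gauge_P_le_1 gauge_below_le_1 by auto
  next
    case left
    then show ?thesis using uv(1) uv(2) unfolding gauge_A_le_1 gauge_P_le_1 gauge_below_le_1 by auto
  qed
  then show "0 < x" "x + \<bar>y\<bar> < 8" "y < 0 \<Longrightarrow> - 1 < y \<or> y = -1 \<and> (x = 3 \<or> x = 5)" by auto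
qed

text \<open>For A the feet of one oval compete with the neighbouring bulge near the plane
  \<open>x = 0\<close>. This bound is the counterpart of the depth bound on the feet: the bulge
  comes within distance 1 only at the vertex \<open>WA\<close>.\<close>

lemma plane_fold_gauge_A_above:
  assumes "(x, y) \<in> plane_fold ` {w. gauge_A w \<le> 1}" "0 < y"
  shows "1 < x \<or> x = 1 \<and> y = 6"
proof -
  obtain u v where uv: "gauge_A (u, v) \<le> 1" "(x, y) = plane_fold (u, v)"
    using assms by auto
  then have "gauge_below (u, v) \<le> 1" using gauge_below_le order_trans by blast
  then have "- 2 \<le> v" "x = u + 4" "y = v + 2"
    using uv(2) assms(2) by (cases rule: plane_fold_cases; simp)+
  then show ?thesis
    using uv(1) assms(2) unfolding gauge_A_le_1 gauge_below_le_1 by auto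
qed

text \<open>For A^+ the competition takes place near the third coordinate plane, so the relevant
  distance is \<open>8 - x - y\<close>. It drops to 1 only along the edge from \<open>WP\<close> to
  (7, 0).\<close>

lemma plane_fold_gauge_P_above:
  assumes "(x, y) \<in> plane_fold ` {w. gauge_P w \<le> 1}" "0 < y"
  shows "x + y < 7 \<or> x + y = 7 \<and> y \<le> 1"
proof -
  obtain u v where uv: "gauge_P (u, v) \<le> 1" "(x, y) = plane_fold (u, v)"
    using assms by auto
  then have "gauge_below (u, v) \<le> 1" using gauge_below_le order_trans by blast
  then have "- 2 \<le> v" "x = u + 4" "y = v + 2"
    using uv(2) assms(2) by (cases rule: plane_fold_cases; simp)+
  then show ?thesis
    using uv(1) assms(2) unfolding gauge_P_le_1 gauge_below_le_1 by auto
qed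

lemma mem_polygon_edge:
  fixes x y :: real
  shows
  "(x, y) \<in> closed_segment (1, 0) (3, 2) \<longleftrightarrow> x = y + 1 \<and> 0 \<le> y \<and> y \<le> 2"
  "(x, y) \<in> closed_segment (3, 2) VA \<longleftrightarrow> x + y = 5 \<and> 2 \<le> y \<and> y \<le> 3"
  "(x, y) \<in> closed_segment VA WA \<longleftrightarrow> 3 * x + y = 9 \<and> 3 \<le> y \<and> y \<le> 6"
  "(x, y) \<in> closed_segment WA (7, 0) \<longleftrightarrow> x + y = 7 \<and> 0 \<le> y \<and> y \<le> 6"
  "(x, y) \<in> closed_segment (3, 2) VP \<longleftrightarrow> x = 3 \<and> 2 \<le> y \<and> y \<le> 3"
  "(x, y) \<in> closed_segment VP WP \<longleftrightarrow> 2 * x + 3 * y = 15 \<and> 1 \<le> y \<and> y \<le> 3"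
  "(x, y) \<in> closed_segment WP (7, 0) \<longleftrightarrow> x + y = 7 \<and> 0 \<le> y \<and> y \<le> 1"
  "(x, y) \<in> closed_segment (3, 0) (4, 1) \<longleftrightarrow> x = y + 3 \<and> 0 \<le> y \<and> y \<le> 1"
  "(x, y) \<in> closed_segment (4, 1) (5, 0) \<longleftrightarrow> x + y = 5 \<and> 0 \<le> y \<and> y \<le> 1"
  "(x, y) \<in> closed_segment (1, 0) (3, -1) \<longleftrightarrow> x = 1 - 2 * y \<and> - 1 \<le> y \<and> y \<le> 0"
  "(x, y) \<in> closed_segment (3, -1) (3, 0) \<longleftrightarrow> x = 3 \<and> - 1 \<le> y \<and> y \<le> 0"
  "(x, y) \<in> closed_segment (5, 0) (5, -1) \<longleftrightarrow> x = 5 \<and> - 1 \<le> y \<and> y \<le> 0"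
  "(x, y) \<in> closed_segment (5, -1) (7, 0) \<longleftrightarrow> x = 7 + 2 * y \<and> - 1 \<le> y \<and> y \<le> 0"
  by (auto simp: mem_segment_up mem_segment_down)

lemma mem_polygon_A: "(x, y) \<in> polygon VA WA \<longleftrightarrow>
    x = y + 1 \<and> 0 \<le> y \<and> y \<le> 2 \<or>
    x + y = 5 \<and> 2 \<le> y \<and> y \<le> 3 \<or>
    3 * x + y = 9 \<and> 3 \<le> y \<and> y \<le> 6 \<or>
    x + y = 7 \<and> 0 \<le> y \<and> y \<le> 6 \<or>
    x = y + 3 \<and> 0 \<le> y \<and> y \<le> 1 \<or>
    x + y = 5 \<and> 0 \<le> y \<and> y \<le> 1 \<or>
    x = 1 - 2 * y \<and> - 1 \<le> y \<and> y \<le> 0 \<or>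
    x = 3 \<and> - 1 \<le> y \<and> y \<le> 0 \<or>
    x = 5 \<and> - 1 \<le> y \<and> y \<le> 0 \<or>
    x = 7 + 2 * y \<and> - 1 \<le> y \<and> y \<le> 0"
  by (simp only: polygon_def path_images Un_iff mem_polygon_edge disj_assoc)

lemma mem_polygon_P: "(x, y) \<in> polygon VP WP \<longleftrightarrow>
    x = y + 1 \<and> 0 \<le> y \<and> y \<le> 2 \<or>
    x = 3 \<and> 2 \<le> y \<and> y \<le> 3 \<or>
    2 * x + 3 * y = 15 \<and> 1 \<le> y \<and> y \<le> 3 \<or>
    x + y = 7 \<and> 0 \<le> y \<and> y \<le> 1 \<or>
    x = y + 3 \<and> 0 \<le> y \<and> y \<le> 1 \<or>
    x + y = 5 \<and> 0 \<le> y \<and> y \<le> 1 \<or>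
    x = 1 - 2 * y \<and> - 1 \<le> y \<and> y \<le> 0 \<or>
    x = 3 \<and> - 1 \<le> y \<and> y \<le> 0 \<or>
    x = 5 \<and> - 1 \<le> y \<and> y \<le> 0 \<or>
    x = 7 + 2 * y \<and> - 1 \<le> y \<and> y \<le> 0"
  by (simp only: polygon_def path_images Un_iff mem_polygon_edge disj_assoc)

text \<open>A preimage under the fold: translate back, and spread the points below the axis
  again.\<close>

lemma plane_fold_section:
  "0 \<le> y \<Longrightarrow> (x, y) = plane_fold (x - 4, y - 2)"
  "y \<le> 0 \<Longrightarrow> x \<le> 4 \<Longrightarrow> (x, y) = plane_fold (x - 4 + 3 * y, y - 2)"
  "y \<le> 0 \<Longrightarrow> 4 \<le> x \<Longrightarrow> (x, y) = plane_fold (x - 4 - 3 * y, y - 2)"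
  using plane_fold_eq[of "y - 2"] by auto

text \<open>One inclusion runs through the three cases of the fold, the other through the three
  preimages. With level 1 written as two inequalities, each case is decided by linear arithmetic
  over the edges.\<close>

lemma plane_fold_gauge_sphere:
  "plane_fold ` {w. gauge_A w = 1} = polygon VA WA" "plane_fold ` {w. gauge_P w = 1} = polygon VP WP"
proof -
  show "plane_fold ` {w. gauge_A w = 1} = polygon VA WA"
  proof (intro set_eqI iffI)
    fix p assume "p \<in> plane_fold ` {w. gauge_A w = 1}"
    then obtain u v where w: "gauge_A (u, v) = 1" "p = plane_fold (u, v)" by auto
    then have g: "gauge_A (u, v) \<le> 1" "1 \<le> gauge_A (u, v)" by auto
    then have "gauge_below (u, v) \<le> 1" using gauge_below_le order_trans by blast
    then show "p \<in> polygon VA WA"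
    proof (cases rule: plane_fold_cases)
      case above
      then show ?thesis
        using g unfolding w(2) gauge_A_le_1 gauge_A_ge_1 gauge_below_le_1 gauge_below_ge_1
        by (simp only: mem_polygon_A) argo
    next
      case right
      then show ?thesis
        using g unfolding w(2) gauge_A_le_1 gauge_A_ge_1 gauge_below_le_1 gauge_below_ge_1
        by (simp only: mem_polygon_A) argo
    next
      case left
      then show ?thesis
        using g unfolding w(2) gauge_A_le_1 gauge_A_ge_1 gauge_below_le_1 gauge_below_ge_1
        by (simp only: mem_polygon_A) argo
    qed
  next
    fix p assume p: "p \<in> polygon VA WA"
    obtain x y where xy: "p = (x, y)" by (cases p)
    consider "0 \<le> y" | "y < 0" "x \<le> 4" | "y < 0" "4 \<le> x" by linarith
    then show "p \<in> plane_fold ` {w. gauge_A w = 1}"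
    proof cases
      case 1
      then have "gauge_A (x - 4, y - 2) = 1"
        using p unfolding xy mem_polygon_A gauge_A_le_1 gauge_A_ge_1 gauge_below_le_1 gauge_below_ge_1 eq_iff
        by argo
      then show ?thesis using plane_fold_section(1) 1 unfolding xy by blast
    next
      case 2
      then have "gauge_A (x - 4 + 3 * y, y - 2) = 1"
        using p unfolding xy mem_polygon_A gauge_A_le_1 gauge_A_ge_1 gauge_below_le_1 gauge_below_ge_1 eq_iff
        by argo
      then show ?thesis using plane_fold_section(2) 2 unfolding xy by (blast intro: less_imp_le)
    next
      case 3
      then have "gauge_A (x - 4 - 3 * y, y - 2) = 1"
        using p unfolding xy mem_polygon_A gauge_A_le_1 gauge_A_ge_1 gauge_below_le_1 gauge_below_ge_1 eq_iff
        by argo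
      then show ?thesis using plane_fold_section(3) 3 unfolding xy by (blast intro: less_imp_le)
    qed
  qed
  show "plane_fold ` {w. gauge_P w = 1} = polygon VP WP"
  proof (intro set_eqI iffI)
    fix p assume "p \<in> plane_fold ` {w. gauge_P w = 1}"
    then obtain u v where w: "gauge_P (u, v) = 1" "p = plane_fold (u, v)" by auto
    then have g: "gauge_P (u, v) \<le> 1" "1 \<le> gauge_P (u, v)" by auto
    then have "gauge_below (u, v) \<le> 1" using gauge_below_le order_trans by blast
    then show "p \<in> polygon VP WP"
    proof (cases rule: plane_fold_cases)
      case above
      then show ?thesis
        using g unfolding w(2) gauge_P_le_1 gauge_P_ge_1 gauge_below_le_1 gauge_below_ge_1
        by (simp only: mem_polygon_P) argo
    next
      case right
      then show ?thesis
        using g unfolding w(2) gauge_P_le_1 gauge_P_ge_1 gauge_below_le_1 gauge_below_ge_1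
        by (simp only: mem_polygon_P) argo
    next
      case left
      then show ?thesis
        using g unfolding w(2) gauge_P_le_1 gauge_P_ge_1 gauge_below_le_1 gauge_below_ge_1
        by (simp only: mem_polygon_P) argo
    qed
  next
    fix p assume p: "p \<in> polygon VP WP"
    obtain x y where xy: "p = (x, y)" by (cases p)
    consider "0 \<le> y" | "y < 0" "x \<le> 4" | "y < 0" "4 \<le> x" by linarith
    then show "p \<in> plane_fold ` {w. gauge_P w = 1}"
    proof cases
      case 1
      then have "gauge_P (x - 4, y - 2) = 1"
        using p unfolding xy mem_polygon_P gauge_P_le_1 gauge_P_ge_1 gauge_below_le_1 gauge_below_ge_1 eq_iff
        by argo
      then show ?thesis using plane_fold_section(1) 1 unfolding xy by blast
    next
      case 2
      then have "gauge_P (x - 4 + 3 * y, y - 2) = 1"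
        using p unfolding xy mem_polygon_P gauge_P_le_1 gauge_P_ge_1 gauge_below_le_1 gauge_below_ge_1 eq_iff
        by argo
      then show ?thesis using plane_fold_section(2) 2 unfolding xy by (blast intro: less_imp_le)
    next
      case 3
      then have "gauge_P (x - 4 - 3 * y, y - 2) = 1"
        using p unfolding xy mem_polygon_P gauge_P_le_1 gauge_P_ge_1 gauge_below_le_1 gauge_below_ge_1 eq_iff
        by argo
      then show ?thesis using plane_fold_section(3) 3 unfolding xy by (blast intro: less_imp_le)
    qed
  qed
qed

section \<open>Ovals in the projective plane\<close>

lemma mem_segment_horizontal:
  fixes a b c x y :: real
  assumes "a \<le> c"
  shows "(x, y) \<in> closed_segment (a, b) (c, b) \<longleftrightarrow> y = b \<and> a \<le> x \<and> x \<le> c"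
proof -
  have "closed_segment (a, b) (c, b) = (\<lambda>x. (x, b)) ` closed_segment a c"
    by (force simp: closed_segment_def algebra_simps)
  then show ?thesis using assms by (auto simp: closed_segment_eq_real_ivl)
qed

text \<open>The scale \<open>8\<close> makes the midpoints of lattice edges integral.\<close>

definition lift :: "real \<times> real \<Rightarrow> r3" where
  "lift w = (fst w, snd w, 8 - fst w - \<bar>snd w\<bar>)"

definition chart :: "(r3 \<Rightarrow> real ^ 3) \<Rightarrow> real \<times> real \<Rightarrow> rp2_point" where
  "chart M w = proj_pt M (lift w)"

text \<open>Two faces glued along the axis. The apexes (0, 8) and (0, -8) are left out because their
  lifts span the same line.\<close>

definition chart_domain :: "(real \<times> real) set" where
  "chart_domain = {(x, y). 0 \<le> x \<and> x + \<bar>y\<bar> \<le> 8 \<and> \<bar>y\<bar> < 8}"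

definition chart_interior :: "(real \<times> real) set" where
  "chart_interior = {(x, y). 0 < x \<and> x + \<bar>y\<bar> < 8}"

lemma chart_interior_subset: "chart_interior \<subseteq> chart_domain"
  by (auto simp: chart_interior_def chart_domain_def)

lemma lift_nonzero: "lift w \<noteq> 0"
  by (auto simp: lift_def zero_prod_def)

lemma polygon_path_bounds:
  "(x, y) \<in> path_image (outer_path VA WA) \<Longrightarrow> 0 \<le> y \<and> 0 < x \<and> x + y < 8 \<and> (y = 0 \<longrightarrow> x = 1 \<or> x = 7)"
  "(x, y) \<in> path_image (outer_path VP WP) \<Longrightarrow> 0 \<le> y \<and> 0 < x \<and> x + y < 8 \<and> (y = 0 \<longrightarrow> x = 1 \<or> x = 7)"
  "(x, y) \<in> path_image inner_path \<Longrightarrow> 0 \<le> y \<and> 0 < x \<and> x + y < 8 \<and> (y = 0 \<longrightarrow> x = 3 \<or> x = 5)"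
  "(x, y) \<in> path_image left_path \<Longrightarrow> y \<le> 0 \<and> 0 < x \<and> x - y < 8 \<and> (y = 0 \<longrightarrow> x = 1 \<or> x = 3)"
  "(x, y) \<in> path_image right_path \<Longrightarrow> y \<le> 0 \<and> 0 < x \<and> x - y < 8 \<and> (y = 0 \<longrightarrow> x = 5 \<or> x = 7)"
  unfolding path_images Un_iff mem_polygon_edge by argo+

lemma polygon_paths_disjoint:
  "path_image (outer_path VA WA) \<inter> path_image inner_path = {}"
  "path_image (outer_path VP WP) \<inter> path_image inner_path = {}"
  "path_image left_path \<inter> path_image right_path = {}"
proof -
  have *: "A \<inter> B = {}" if "\<And>x y. (x, y) \<in> A \<Longrightarrow> (x, y) \<in> B \<Longrightarrow> False" for A B :: "(real \<times> real) set"
    using that by auto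
  show "path_image (outer_path VA WA) \<inter> path_image inner_path = {}"
    "path_image (outer_path VP WP) \<inter> path_image inner_path = {}"
    "path_image left_path \<inter> path_image right_path = {}"
    by (rule *; unfold path_images Un_iff mem_polygon_edge; argo)+
qed

lemma plane_fold_in_interior:
  "plane_fold ` {w. gauge_A w \<le> 1} \<subseteq> chart_interior" "plane_fold ` {w. gauge_P w \<le> 1} \<subseteq> chart_interior"
proof -
  have "p \<in> chart_interior"
    if "p \<in> plane_fold ` {w. gauge_A w \<le> 1} \<union> plane_fold ` {w. gauge_P w \<le> 1}" for p
    using that plane_fold_gauge_bounds(1,2)[of "fst p" "snd p"]
    by (simp add: chart_interior_def case_prod_beta)
  then show "plane_fold ` {w. gauge_A w \<le> 1} \<subseteq> chart_interior"
    "plane_fold ` {w. gauge_P w \<le> 1} \<subseteq> chart_interior" by blast+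
qed

section \<open>Disks, arcs and crossings seen in the chart\<close>

context homogeneous_coordinates
begin

lemma continuous_map_chart:
  assumes "continuous_on S g"
  shows "continuous_map (top_of_set S) rp2 (\<lambda>t. chart M (g t))"
  unfolding chart_def
  by (rule continuous_map_proj_pt_comp)
    (use assms lift_nonzero in \<open>auto simp: lift_def intro!: continuous_intros\<close>)

text \<open>Two lifts of the same projective point differ by a factor \<open>c\<close>. A factor
  that is not positive would put the point at an excluded apex; a positive one preserves the sum
  \<open>x + \<bar>y\<bar> + z = 8\<close> only if it is 1.\<close>

lemma inj_on_chart: "inj_on (chart M) chart_domain"
proof (rule inj_onI)
  fix v w assume vw: "v \<in> chart_domain" "w \<in> chart_domain" "chart M v = chart M w"
  obtain x y x' y' where xy: "v = (x, y)" "w = (x', y')" by (cases v, cases w)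
  obtain c where "c \<noteq> 0" "lift v = c *\<^sub>R lift w"
    using vw(3) proj_pt_eq_iff[OF lift_nonzero lift_nonzero] by (auto simp: chart_def)
  then have c: "x = c * x'" "y = c * y'" "8 - x - \<bar>y\<bar> = c * (8 - x' - \<bar>y'\<bar>)"
    by (auto simp: lift_def xy)
  have d: "0 \<le> x" "x + \<bar>y\<bar> \<le> 8" "\<bar>y\<bar> < 8" "0 \<le> x'" "x' + \<bar>y'\<bar> \<le> 8" "\<bar>y'\<bar> < 8"
    using vw(1,2) by (auto simp: chart_domain_def xy)
  have "0 < c"
  proof (rule ccontr)
    assume "\<not> 0 < c"
    then have "x \<le> 0" "8 - x - \<bar>y\<bar> \<le> 0"
      using c d by (simp_all add: mult_nonpos_nonneg)
    then show False using d by linarith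
  qed
  then have "\<bar>y\<bar> = c * \<bar>y'\<bar>" using c(2) by (simp add: abs_mult)
  then have "8 = c * 8" using c by (simp add: algebra_simps)
  then show "v = w" using c by (simp add: xy)
qed

lemma embedding_chart:
  fixes S :: "'a::metric_space set"
  assumes "compact S" "continuous_on S g" "inj_on g S" "g ` S \<subseteq> chart_domain"
  shows "embedding_map (top_of_set S) rp2 (\<lambda>t. chart M (g t))"
proof -
  have "inj_on (\<lambda>t. chart M (g t)) S"
    using comp_inj_on[OF assms(3) inj_on_subset[OF inj_on_chart assms(4)]] by (simp add: o_def)
  then show ?thesis
    by (rule embedding_map_compact_into_Hausdorff[OF assms(1) Hausdorff_rp2 continuous_map_chart[OF assms(2)]])
qed

text \<open>Open intervals are not compact, so their embeddings are obtained by restricting an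
  embedding of a compact interval.\<close>

lemma embedding_chart_subset:
  fixes S :: "'a::metric_space set"
  assumes "compact S" "continuous_on S g" "inj_on g S" "g ` S \<subseteq> chart_domain" "R \<subseteq> S"
  shows "embedding_map (top_of_set R) rp2 (\<lambda>t. chart M (g t))"
  using embedding_map_subtopology_domain[OF embedding_chart[OF assms(1-4)], of R] assms(5)
  by (simp add: subtopology_subtopology Int_absorb1)

lemma chart_in_octant:
  assumes "(x, y) \<in> chart_interior"
  shows "chart M (x, y) \<in> octant M 1 b 1 \<longleftrightarrow> 0 < b * y"
proof -
  have "0 < x" "0 < 8 - x - \<bar>y\<bar>" using assms by (auto simp: chart_interior_def)
  then have "0 < x * (8 - x - \<bar>y\<bar>)" by simp
  then show ?thesis
    using proj_pt_in_octant[of x y "8 - x - \<bar>y\<bar>" 1 b 1] lift_nonzero[of "(x, y)"] \<open>0 < x\<close>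
    by (auto simp: chart_def lift_def zero_less_mult_iff)
qed

lemma chart_in_side:
  assumes "(x, y) \<in> chart_interior"
  shows "chart M (x, y) \<in> side M 1 \<longleftrightarrow> y = 0"
proof -
  have "0 < x" "0 < 8 - x - \<bar>y\<bar>" using assms by (auto simp: chart_interior_def)
  then have "0 < x * (8 - x - \<bar>y\<bar>)" by simp
  then show ?thesis
    using proj_pt_in_side[of x y "8 - x - \<bar>y\<bar>" 1] lift_nonzero[of "(x, y)"]
    by (auto simp: chart_def lift_def)
qed

lemma chart_on_lines:
  assumes "(x, y) \<in> chart_interior"
  shows "chart M (x, y) \<in> region M (\<lambda>(x, y, z). x = 0 \<or> y = 0 \<or> z = 0) \<longleftrightarrow> y = 0"
  using assms proj_pt_on_lines[of x y "8 - x - \<bar>y\<bar>"] lift_nonzero[of "(x, y)"]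
  by (auto simp: chart_interior_def chart_def lift_def)

lemma side_chart: "side M 1 = (\<lambda>t. chart M (8 * t, 0)) ` {0<..<1}"
proof
  show "side M 1 \<subseteq> (\<lambda>t. chart M (8 * t, 0)) ` {0<..<1}"
  proof
    fix p assume "p \<in> side M 1"
    then obtain x z where p: "p = proj_pt M (x, 0, z)" "0 < x" "0 < z"
      unfolding side_image by auto
    have "lift (8 * (x / (x + z)), 0) = (8 / (x + z)) *\<^sub>R (x, 0, z)"
      using p by (simp add: lift_def field_simps)
    then have "chart M (8 * (x / (x + z)), 0) = p"
      using p proj_pt_scale[of "8 / (x + z)" "(x, 0, z)"] by (simp add: chart_def zero_prod_def)
    moreover have "x / (x + z) \<in> {0<..<1}" using p by simp
    ultimately show "p \<in> (\<lambda>t. chart M (8 * t, 0)) ` {0<..<1}" by blast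
  qed
  show "(\<lambda>t. chart M (8 * t, 0)) ` {0<..<1} \<subseteq> side M 1"
    using chart_in_side by (auto simp: chart_interior_def)
qed

lemma arc_joining_chart:
  assumes "arc g" "path_image g \<subseteq> chart_interior"
  shows "arc_joining (chart M ` path_image g) (chart M (pathstart g)) (chart M (pathfinish g))"
  unfolding arc_joining_def
proof (intro exI conjI)
  show "embedding_map (top_of_set {0..1}) rp2 (\<lambda>t. chart M (g t))"
    using assms chart_interior_subset
    by (intro embedding_chart) (auto simp: arc_def path_def path_image_def)
qed (auto simp: pathstart_def pathfinish_def path_image_def)

text \<open>The sign \<open>b\<close> selects the face above or below the axis, and \<open>R\<close>
  is the rest of the oval. Apart from shared end points \<open>R\<close> lies in the opposite face,
  which is open and disjoint from the chosen one, hence misses its closure.\<close>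

lemma two_arcs_in_chart:
  assumes b: "b = 1 \<or> b = -1" and arcs: "arc g" "arc h" and dj: "path_image g \<inter> path_image h = {}"
    and int: "path_image g \<union> path_image h \<union> R \<subseteq> chart_interior"
    and g: "\<And>x y. (x, y) \<in> path_image g \<Longrightarrow> (x, y) \<noteq> pathstart g \<Longrightarrow> (x, y) \<noteq> pathfinish g \<Longrightarrow> 0 < b * y"
    and h: "\<And>x y. (x, y) \<in> path_image h \<Longrightarrow> (x, y) \<noteq> pathstart h \<Longrightarrow> (x, y) \<noteq> pathfinish h \<Longrightarrow> 0 < b * y"
    and ends: "snd (pathstart g) = 0" "snd (pathfinish g) = 0" "snd (pathstart h) = 0" "snd (pathfinish h) = 0"
    and R: "\<And>x y. (x, y) \<in> R \<Longrightarrow> b * y < 0 \<or> (x, y) \<in> path_image g \<union> path_image h"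
  shows "two_arcs_in (octant M 1 b 1) (chart M ` (path_image g \<union> path_image h \<union> R))
    (chart M (pathstart g)) (chart M (pathfinish g)) (chart M (pathstart h)) (chart M (pathfinish h))"
  unfolding two_arcs_in_def
proof (intro exI conjI)
  show "arc_joining (chart M ` path_image g) (chart M (pathstart g)) (chart M (pathfinish g))"
    "arc_joining (chart M ` path_image h) (chart M (pathstart h)) (chart M (pathfinish h))"
    using arcs int by (auto intro!: arc_joining_chart)
  have "inj_on (chart M) (path_image g \<union> path_image h)"
    using inj_on_chart chart_interior_subset int by (blast intro: inj_on_subset)
  then show "chart M ` path_image g \<inter> chart M ` path_image h = {}"
    using dj by (metis image_Int_subset inj_on_image_Int Un_upper1 Un_upper2 image_empty)
  have o: "chart M (x, y) \<in> octant M 1 b 1" if "(x, y) \<in> path_image g \<union> path_image h" "0 < b * y" for x y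
    using chart_in_octant that int by blast
  show "chart M ` path_image g - {chart M (pathstart g), chart M (pathfinish g)} \<subseteq> octant M 1 b 1"
  proof
    fix p assume p: "p \<in> chart M ` path_image g - {chart M (pathstart g), chart M (pathfinish g)}"
    then obtain x y where xy: "(x, y) \<in> path_image g" "p = chart M (x, y)" by auto
    moreover from this have "(x, y) \<noteq> pathstart g" "(x, y) \<noteq> pathfinish g" using p by auto
    ultimately show "p \<in> octant M 1 b 1" using g[of x y] o[of x y] by blast
  qed
  show "chart M ` path_image h - {chart M (pathstart h), chart M (pathfinish h)} \<subseteq> octant M 1 b 1"
  proof
    fix p assume p: "p \<in> chart M ` path_image h - {chart M (pathstart h), chart M (pathfinish h)}"
    then obtain x y where xy: "(x, y) \<in> path_image h" "p = chart M (x, y)" by auto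
    moreover from this have "(x, y) \<noteq> pathstart h" "(x, y) \<noteq> pathfinish h" using p by auto
    ultimately show "p \<in> octant M 1 b 1" using h[of x y] o[of x y] by blast
  qed
  have "chart M (x, y) \<in> rp2 closure_of octant M 1 b 1" if xy: "(x, y) \<in> path_image g \<union> path_image h" for x y
  proof (cases "0 < b * y")
    case True
    then show ?thesis using o[OF xy] closure_of_subset[OF openin_subset[OF openin_octant]] by blast
  next
    case False
    then have "y = 0" using g[of x y] h[of x y] xy ends by (metis Un_iff snd_conv)
    moreover have "0 < x" "0 < 8 - x" using int xy \<open>y = 0\<close> by (auto simp: chart_interior_def)
    ultimately show ?thesis
      using side_in_closure_octant[of 1 x 1 "8 - x" b] b by (auto simp: chart_def lift_def)
  qed
  moreover have "chart M (x, y) \<notin> rp2 closure_of octant M 1 b 1"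
    if xy: "(x, y) \<in> R" "b * y < 0" for x y
  proof -
    have "chart M (x, y) \<in> octant M 1 (- b) 1"
      using chart_in_octant[of x y "- b"] xy int by auto
    moreover have "octant M 1 (- b) 1 \<inter> octant M 1 b 1 = {}"
      using octants_disjoint(2) b by (auto simp: disjnt_def)
    ultimately show ?thesis using openin_octant[of 1 "- b" 1] by (auto simp: in_closure_of)
  qed
  ultimately show "chart M ` (path_image g \<union> path_image h \<union> R) \<inter> rp2 closure_of octant M 1 b 1 =
      chart M ` path_image g \<union> chart M ` path_image h"
    using R by (fastforce simp: image_iff)
qed

lemma crosses_lines_at_chart:
  assumes T: "octant M 1 1 1 \<in> triangles L" "octant M 1 (-1) 1 \<in> triangles L"
    and a: "snd a = 0" and p: "0 < snd p" and q: "snd q < 0"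
    and seg: "closed_segment a p \<subseteq> R" "closed_segment a q \<subseteq> R" and R: "R \<subseteq> chart_interior"
  shows "crosses_lines_at L (chart M ` R) (chart M a)"
proof -
  \<comment> \<open>The curve comes in along the edge to \<open>q\<close> and leaves along the edge
    to \<open>p\<close>. Its height is a positive multiple of the parameter on each half, which
    yields injectivity and both triangle conditions.\<close>
  define g where "g t = (if 0 \<le> t then linepath a p t else linepath a q (- t))" for t
  have g': "g t = a + max t 0 *\<^sub>R (p - a) + max (- t) 0 *\<^sub>R (q - a)" for t
    by (simp add: g_def linepath_def algebra_simps max_def)
  have g2: "snd (g t) = max t 0 * snd p + max (- t) 0 * snd q" for t
    using a by (simp add: g')
  have cont: "continuous_on S g" for S unfolding g'[abs_def] by (intro continuous_intros)
  have pos: "0 < t \<Longrightarrow> 0 < snd (g t)" and neg: "t < 0 \<Longrightarrow> snd (g t) < 0" for t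
    using p q by (auto simp: g2 max_def mult_pos_neg mult_neg_neg)
  have inj: "inj g"
  proof (rule injI)
    fix s t assume "g s = g t"
    then have e: "snd (g s) = snd (g t)" by simp
    consider "s < 0" "t < 0" | "0 < s" "0 < t" | "s = 0" "t = 0"
      using pos[of s] pos[of t] neg[of s] neg[of t] e g2[of 0] by (metis less_asym linorder_neqE mult_zero_left max.idem add_0 neg_0_equal_iff_equal less_irrefl minus_zero)
    then show "s = t"
      by cases (use e p q in \<open>auto simp: g2 max_def\<close>)
  qed
  have gR: "g t \<in> R" if "t \<in> {-1..1}" for t
  proof (cases "0 \<le> t")
    case True
    then show ?thesis using that linepath_in_path[of t a p] seg(1) by (auto simp: g_def)
  next
    case False
    then show ?thesis using that linepath_in_path[of "- t" a q] seg(2) by (auto simp: g_def)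
  qed
  have gd: "g ` {-1..1} \<subseteq> chart_domain" using gR R chart_interior_subset by blast
  have oc: "chart M (g t) \<in> octant M 1 b 1" if "t \<in> {-1..1}" "0 < b * snd (g t)" for t b
    using chart_in_octant[of "fst (g t)" "snd (g t)" b] gR[OF that(1)] R that(2) by auto
  show ?thesis
    unfolding crosses_lines_at_def
  proof (intro exI conjI)
    show "embedding_map (top_of_set {-1<..<1}) rp2 (\<lambda>t. chart M (g t))"
      by (rule embedding_chart_subset[of "{-1..1}"]) (use cont gd inj in \<open>auto intro: inj_on_subset\<close>)
    show "(\<lambda>t. chart M (g t)) ` {-1<..<1} \<subseteq> chart M ` R" using gR by auto
    show "chart M (g 0) = chart M a" by (simp add: g')
    show "octant M 1 (-1) 1 \<noteq> octant M 1 1 1" using octants_distinct by auto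
    show "(\<lambda>t. chart M (g t)) ` {-1<..<0} \<subseteq> octant M 1 (-1) 1" using oc neg by auto
    show "(\<lambda>t. chart M (g t)) ` {0<..<1} \<subseteq> octant M 1 1 1" using oc pos by auto
  qed (use T in auto)
qed

lemma bounds_disk_chart:
  fixes F :: "real \<times> real \<Rightarrow> real" and h :: "real \<times> real \<Rightarrow> real \<times> real"
  assumes F: "continuous_on UNIV F" "\<And>t x. t \<ge> 0 \<Longrightarrow> F (t *\<^sub>R x) = t * F x" "\<And>x. x \<noteq> 0 \<Longrightarrow> 0 < F x"
    and h: "continuous_on UNIV h" "inj_on h {w. F w \<le> 1}" "h ` {w. F w \<le> 1} \<subseteq> chart_domain"
  shows "bounds_disk (chart M ` h ` {w. F w = 1}) (chart M ` h ` {w. F w \<le> 1})"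
proof -
  obtain g :: "real \<times> real \<Rightarrow> real \<times> real" where g: "continuous_on (cball 0 1) g" "inj_on g (cball 0 1)"
    "g ` cball 0 1 = {x. F x \<le> 1}" "g ` sphere 0 1 = {x. F x = 1}"
    using gauge_ball_homeo[OF F] by blast
  have c: "continuous_on (cball 0 1) (h \<circ> g)"
    by (rule continuous_on_compose[OF g(1)]) (rule continuous_on_subset[OF h(1) subset_UNIV])
  have i: "inj_on (h \<circ> g) (cball 0 1)"
    by (rule comp_inj_on[OF g(2)]) (simp add: g(3) h(2))
  have s: "(h \<circ> g) ` cball 0 1 \<subseteq> chart_domain"
    using h(3) by (simp only: image_comp[symmetric] g(3))
  have "embedding_map (top_of_set (cball 0 1)) rp2 (\<lambda>t. chart M ((h \<circ> g) t))"
    by (rule embedding_chart[OF compact_cball c i s])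
  moreover have im: "(\<lambda>t. chart M ((h \<circ> g) t)) ` X = chart M ` h ` g ` X" for X
    by (simp add: image_image)
  ultimately show ?thesis
    unfolding bounds_disk_def
    by (intro exI[of _ "\<lambda>t. chart M ((h \<circ> g) t)"] conjI) (simp_all only: im g(3,4))
qed

lemma bounds_disk_polygon:
  "bounds_disk (chart M ` polygon VA WA) (chart M ` plane_fold ` {w. gauge_A w \<le> 1})"
  "bounds_disk (chart M ` polygon VP WP) (chart M ` plane_fold ` {w. gauge_P w \<le> 1})"
  unfolding plane_fold_gauge_sphere[symmetric]
  using plane_fold_in_interior chart_interior_subset
  by (intro bounds_disk_chart gauge_continuous gauge_homogeneous gauge_pos continuous_plane_fold
      inj_on_plane_fold; blast)+

lemma oval_position_polygon:
  assumes VW: "V = VA \<and> W = WA \<or> V = VP \<and> W = WP"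
    and lines: "(\<Union>k. L k) = region M (\<lambda>(x, y, z). x = 0 \<or> y = 0 \<or> z = 0)"
    and adj: "{octant M 1 1 1, octant M 1 (-1) 1} \<subseteq> adjacent_triangles L (side M 1)"
  shows "oval_position L (side M 1) (octant M 1 1 1) (chart M ` polygon V W)"
proof -
  have o: "arc (outer_path V W)" "path_image (outer_path V W) \<inter> path_image inner_path = {}"
    "\<And>x y. (x, y) \<in> path_image (outer_path V W) \<Longrightarrow> 0 \<le> y \<and> 0 < x \<and> x + y < 8 \<and> (y = 0 \<longrightarrow> x = 1 \<or> x = 7)"
    using VW arc_outer_path polygon_paths_disjoint(1,2) polygon_path_bounds(1,2) by blast+
  note c = o(3) polygon_path_bounds(3,4,5)
  have int: "polygon V W \<subseteq> chart_interior"
  proof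
    fix p assume p: "p \<in> polygon V W"
    obtain x y where xy: "p = (x, y)" by (cases p)
    show "p \<in> chart_interior"
      using p c[of x y] unfolding xy polygon_def chart_interior_def by auto
  qed
  have axis: "(x, 0) \<in> polygon V W \<longleftrightarrow> x = 1 \<or> x = 3 \<or> x = 5 \<or> x = 7" for x
  proof
    assume "(x, 0) \<in> polygon V W"
    then show "x = 1 \<or> x = 3 \<or> x = 5 \<or> x = 7" using c[of x 0] unfolding polygon_def by auto
  next
    have "(1, 0) \<in> polygon V W" "(3, 0) \<in> polygon V W" "(5, 0) \<in> polygon V W" "(7, 0) \<in> polygon V W"
      unfolding polygon_def path_images by auto
    then show "(x, 0) \<in> polygon V W" if "x = 1 \<or> x = 3 \<or> x = 5 \<or> x = 7" using that by auto
  qed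
  \<comment> \<open>The factor 8 stretches the unit interval over the whole segment, so the four
    crossings occur at odd multiples of 1/8.\<close>
  define \<gamma> where "\<gamma> t = chart M (8 * t, 0)" for t
  have \<gamma>: "\<gamma> (1/8) = chart M (1, 0)" "\<gamma> (3/8) = chart M (3, 0)" "\<gamma> (5/8) = chart M (5, 0)" "\<gamma> (7/8) = chart M (7, 0)"
    by (simp_all add: \<gamma>_def)
  have T: "octant M 1 1 1 \<in> triangles L" "octant M 1 (-1) 1 \<in> triangles L"
    using adj by (auto simp: adjacent_triangles_def)
  have emb: "embedding_map (top_of_set {0<..<1}) rp2 \<gamma>"
    unfolding \<gamma>_def
    by (rule embedding_chart_subset[of "{0..1}"])
      (auto simp: chart_domain_def inj_on_def intro!: continuous_intros)
  have "chart M ` polygon V W \<inter> (\<Union>k. L k) = chart M ` {(1, 0), (3, 0), (5, 0), (7, 0)}"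
  proof
    show "chart M ` polygon V W \<inter> (\<Union>k. L k) \<subseteq> chart M ` {(1, 0), (3, 0), (5, 0), (7, 0)}"
    proof
      fix p assume p: "p \<in> chart M ` polygon V W \<inter> (\<Union>k. L k)"
      then obtain x y where xy: "(x, y) \<in> polygon V W" "p = chart M (x, y)" by auto
      then have "y = 0" using p chart_on_lines int lines by auto
      then show "p \<in> chart M ` {(1, 0), (3, 0), (5, 0), (7, 0)}" using xy axis by auto
    qed
    have "chart M (x, 0) \<in> (\<Union>k. L k)" if "(x, 0) \<in> polygon V W" for x
      using chart_on_lines[of x 0] int lines that by blast
    then show "chart M ` {(1, 0), (3, 0), (5, 0), (7, 0)} \<subseteq> chart M ` polygon V W \<inter> (\<Union>k. L k)"
      using axis by auto
  qed
  then have meets: "chart M ` polygon V W \<inter> (\<Union>k. L k) = {\<gamma> (1/8), \<gamma> (3/8), \<gamma> (5/8), \<gamma> (7/8)}"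
    unfolding \<gamma> by simp
  have crosses: "crosses_lines_at L (chart M ` polygon V W) p" if "p \<in> {\<gamma> (1/8), \<gamma> (3/8), \<gamma> (5/8), \<gamma> (7/8)}" for p
  proof -
    have "crosses_lines_at L (chart M ` polygon V W) (chart M (1, 0))"
      by (rule crosses_lines_at_chart[of _ _ "(3, 2)" "(3, -1)"]) (use T int in \<open>auto simp: polygon_def path_images\<close>)
    moreover have "crosses_lines_at L (chart M ` polygon V W) (chart M (3, 0))"
      by (rule crosses_lines_at_chart[of _ _ "(4, 1)" "(3, -1)"])
        (use T int in \<open>auto simp: polygon_def path_images closed_segment_commute[of "(3, 0)" "(3, -1)"]\<close>)
    moreover have "crosses_lines_at L (chart M ` polygon V W) (chart M (5, 0))"
      by (rule crosses_lines_at_chart[of _ _ "(4, 1)" "(5, -1)"])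
        (use T int in \<open>auto simp: polygon_def path_images closed_segment_commute[of "(5, 0)" "(4, 1)"]\<close>)
    moreover have "crosses_lines_at L (chart M ` polygon V W) (chart M (7, 0))"
      by (rule crosses_lines_at_chart[of _ _ W "(5, -1)"])
        (use T int VW in \<open>auto simp: polygon_def path_images closed_segment_commute[of "(7, 0)"]\<close>)
    ultimately show ?thesis using that \<gamma> by auto
  qed
  \<comment> \<open>Two groupings of the same union: the arcs of the face under consideration come
    first, the remainder takes the role of \<open>R\<close>.\<close>
  have R: "polygon V W = path_image (outer_path V W) \<union> path_image inner_path \<union> (path_image left_path \<union> path_image right_path)"
    "polygon V W = path_image left_path \<union> path_image right_path \<union> (path_image (outer_path V W) \<union> path_image inner_path)"
    by (auto simp: polygon_def)
  have ends: "(1, 0) \<in> path_image (outer_path V W)" "(7, 0) \<in> path_image (outer_path V W)"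
    "(3, 0) \<in> path_image inner_path" "(5, 0) \<in> path_image inner_path"
    "(1, 0) \<in> path_image left_path" "(3, 0) \<in> path_image left_path"
    "(5, 0) \<in> path_image right_path" "(7, 0) \<in> path_image right_path"
    unfolding path_images by auto
  have up: "two_arcs_in (octant M 1 1 1) (chart M ` polygon V W) (\<gamma> (1/8)) (\<gamma> (7/8)) (\<gamma> (3/8)) (\<gamma> (5/8))"
  proof -
    have "two_arcs_in (octant M 1 1 1) (chart M ` polygon V W)
        (chart M (pathstart (outer_path V W))) (chart M (pathfinish (outer_path V W)))
        (chart M (pathstart inner_path)) (chart M (pathfinish inner_path))"
      unfolding R(1)
    proof (rule two_arcs_in_chart)
      show "1 * y < 0 \<or> (x, y) \<in> path_image (outer_path V W) \<union> path_image inner_path"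
        if "(x, y) \<in> path_image left_path \<union> path_image right_path" for x y :: real
        using that c(3,4)[of x y] ends by (cases "y = 0") auto
      show "0 < 1 * y" if "(x, y) \<in> path_image (outer_path V W)" "(x, y) \<noteq> pathstart (outer_path V W)"
        "(x, y) \<noteq> pathfinish (outer_path V W)" for x y :: real using that c(1)[of x y] by auto
      show "0 < 1 * y" if "(x, y) \<in> path_image inner_path" "(x, y) \<noteq> pathstart inner_path"
        "(x, y) \<noteq> pathfinish inner_path" for x y :: real using that c(2)[of x y] by auto
    qed (use o arc_small_paths int R(1) in auto)
    then show ?thesis by (simp add: \<gamma>)
  qed
  have down: "two_arcs_in (octant M 1 (-1) 1) (chart M ` polygon V W) (\<gamma> (1/8)) (\<gamma> (3/8)) (\<gamma> (5/8)) (\<gamma> (7/8))"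
  proof -
    have "two_arcs_in (octant M 1 (-1) 1) (chart M ` polygon V W)
        (chart M (pathstart left_path)) (chart M (pathfinish left_path))
        (chart M (pathstart right_path)) (chart M (pathfinish right_path))"
      unfolding R(2)
    proof (rule two_arcs_in_chart)
      show "-1 * y < 0 \<or> (x, y) \<in> path_image left_path \<union> path_image right_path"
        if "(x, y) \<in> path_image (outer_path V W) \<union> path_image inner_path" for x y :: real
        using that c(1,2)[of x y] ends by (cases "y = 0") auto
      show "0 < -1 * y" if "(x, y) \<in> path_image left_path" "(x, y) \<noteq> pathstart left_path"
        "(x, y) \<noteq> pathfinish left_path" for x y :: real using that c(3)[of x y] by auto
      show "0 < -1 * y" if "(x, y) \<in> path_image right_path" "(x, y) \<noteq> pathstart right_path"
        "(x, y) \<noteq> pathfinish right_path" for x y :: real using that c(4)[of x y] by auto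
    qed (use polygon_paths_disjoint(3) arc_small_paths int R(2) in auto)
    then show ?thesis by (simp add: \<gamma>)
  qed
  show ?thesis
    unfolding oval_position_def
  proof (intro exI conjI)
    show "embedding_map (top_of_set {0<..<1}) rp2 \<gamma>" by (rule emb)
    show "\<gamma> ` {0<..<1} = side M 1" unfolding side_chart \<gamma>_def ..
    show "octant M 1 1 1 \<in> adjacent_triangles L (side M 1)" "octant M 1 (-1) 1 \<in> adjacent_triangles L (side M 1)"
      using adj by auto
    show "octant M 1 (-1) 1 \<noteq> octant M 1 1 1" using octants_distinct by auto
    show "\<forall>p\<in>{\<gamma> (1/8), \<gamma> (3/8), \<gamma> (5/8), \<gamma> (7/8)}. crosses_lines_at L (chart M ` polygon V W) p"
      using crosses by blast
  qed (use meets up down in simp_all)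
qed

lemma central_oval:
  "oval (chart M ` (closed_segment (1, 1) (6, 1) \<union> closed_segment (6, 1) (1, 6) \<union> closed_segment (1, 6) (1, 1)))"
  "chart M ` (closed_segment (1, 1) (6, 1) \<union> closed_segment (6, 1) (1, 6) \<union> closed_segment (1, 6) (1, 1))
    \<subseteq> octant M 1 1 1"
proof -
  \<comment> \<open>The gauge of the triangle with vertices (1, 1), (6, 1), (1, 6), seen from its
    interior point (2, 2).\<close>
  define F :: "real \<times> real \<Rightarrow> real" where "F w = max (max (- fst w) (- snd w)) ((fst w + snd w) / 3)" for w
  define h :: "real \<times> real \<Rightarrow> real \<times> real" where "h w = w + (2, 2)" for w
  let ?P = "closed_segment (1, 1) (6, 1) \<union> closed_segment (6, 1) (1, 6) \<union> closed_segment (1, 6) (1, 1) :: (real \<times> real) set"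
  have P: "(x, y) \<in> ?P \<longleftrightarrow> y = 1 \<and> 1 \<le> x \<and> x \<le> 6 \<or> x + y = 7 \<and> 1 \<le> y \<and> y \<le> 6 \<or> x = 1 \<and> 1 \<le> y \<and> y \<le> 6" for x y
  proof -
    have "(x, y) \<in> closed_segment (1, 1) (6, 1) \<longleftrightarrow> y = 1 \<and> 1 \<le> x \<and> x \<le> 6"
      by (simp add: mem_segment_horizontal)
    moreover have "(x, y) \<in> closed_segment (6, 1) (1, 6) \<longleftrightarrow> x + y = 7 \<and> 1 \<le> y \<and> y \<le> 6"
      by (auto simp: mem_segment_up)
    moreover have "(x, y) \<in> closed_segment (1, 6) (1, 1) \<longleftrightarrow> x = 1 \<and> 1 \<le> y \<and> y \<le> 6"
      by (auto simp: mem_segment_down)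
    ultimately show ?thesis by blast
  qed
  have "bounds_disk (chart M ` h ` {w. F w = 1}) (chart M ` h ` {w. F w \<le> 1})"
  proof (rule bounds_disk_chart)
    show "continuous_on UNIV F" unfolding F_def by (intro continuous_intros) auto
    show "F (t *\<^sub>R w) = t * F w" if "t \<ge> 0" for t w
      using that unfolding F_def max_mult_distrib_left by (simp add: algebra_simps)
    show "0 < F w" if "w \<noteq> 0" for w
      using that by (cases w) (auto simp: F_def zero_prod_def less_max_iff_disj)
    show "continuous_on UNIV h" unfolding h_def by (intro continuous_intros)
    show "inj_on h {w. F w \<le> 1}" by (auto simp: h_def inj_on_def)
    show "h ` {w. F w \<le> 1} \<subseteq> chart_domain" by (auto simp: h_def F_def chart_domain_def)
  qed
  moreover have "h ` {w. F w = 1} = ?P"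
  proof (intro set_eqI iffI)
    fix p assume "p \<in> h ` {w. F w = 1}"
    then obtain u v where uv: "F (u, v) = 1" "p = (u + 2, v + 2)" by (auto simp: h_def)
    then have "- u \<le> 1" "- v \<le> 1" "u + v \<le> 3" "- u = 1 \<or> - v = 1 \<or> u + v = 3"
      by (auto simp: F_def max_def split: if_splits)
    then show "p \<in> ?P" unfolding uv(2) P by argo
  next
    fix p assume p: "p \<in> ?P"
    obtain x y where xy: "p = (x, y)" by (cases p)
    have "F (x - 2, y - 2) = 1" using p unfolding xy P by (auto simp: F_def max_def)
    then show "p \<in> h ` {w. F w = 1}" unfolding xy
      by (intro image_eqI[of _ _ "(x - 2, y - 2)"]) (auto simp: h_def)
  qed
  ultimately show "oval (chart M ` ?P)" unfolding oval_def by auto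
  show "chart M ` ?P \<subseteq> octant M 1 1 1"
  proof
    fix p assume "p \<in> chart M ` ?P"
    then obtain x y where xy: "(x, y) \<in> ?P" "p = chart M (x, y)" by auto
    then have "(x, y) \<in> chart_interior" "0 < 1 * y" unfolding P by (auto simp: chart_interior_def)
    then show "p \<in> octant M 1 1 1" using chart_in_octant xy(2) by blast
  qed
qed

end

section \<open>Rotating one oval into three\<close>

definition sign_change :: "real \<Rightarrow> real \<Rightarrow> real \<Rightarrow> r3 \<Rightarrow> r3" where
  "sign_change a b c = (\<lambda>(x, y, z). (a * x, b * y, c * z))"

definition rotate3 :: "'a \<times> 'a \<times> 'a \<Rightarrow> 'a \<times> 'a \<times> 'a" where
  "rotate3 = (\<lambda>(x, y, z). (z, x, y))"

lemma linear_sign_change: "linear (sign_change a b c)"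
  by (auto simp: sign_change_def linear_iff algebra_simps)

lemma linear_rotate3: "linear (rotate3 :: r3 \<Rightarrow> r3)"
  by (auto simp: rotate3_def linear_iff)

lemma bij_sign_change:
  assumes "a = 1 \<or> a = -1" "b = 1 \<or> b = -1" "c = 1 \<or> c = -1"
  shows "bij (sign_change a b c)"
  by (rule involuntory_imp_bij) (use assms in \<open>auto simp: sign_change_def\<close>)

lemma bij_rotate3: "bij (rotate3 :: 'a \<times> 'a \<times> 'a \<Rightarrow> 'a \<times> 'a \<times> 'a)"
  by (rule o_bij[where g = "\<lambda>(x, y, z). (y, z, x)"]) (auto simp: rotate3_def fun_eq_iff)

lemma homogeneous_coordinates_comp:
  assumes "homogeneous_coordinates M" "linear f" "bij f"
  shows "homogeneous_coordinates (M \<circ> f)"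
  using assms by (auto simp: homogeneous_coordinates_def intro: linear_compose bij_comp)

lemma region_comp:
  assumes f: "linear f" "bij f" and PQ: "\<And>v. Q (f v) \<longleftrightarrow> P v"
  shows "region (M \<circ> f) P = region M Q"
proof -
  have nz: "f v = 0 \<longleftrightarrow> v = 0" for v
    using f by (metis bij_is_inj injD linear_0)
  have "f ` {v. v \<noteq> 0 \<and> P v} = {v. v \<noteq> 0 \<and> Q v}"
  proof (intro set_eqI iffI)
    fix w assume w: "w \<in> {v. v \<noteq> 0 \<and> Q v}"
    obtain v where "w = f v" using f(2) by (metis bij_pointE)
    then show "w \<in> f ` {v. v \<noteq> 0 \<and> P v}" using w nz PQ by auto
  qed (use nz PQ in auto)
  then show ?thesis
    unfolding region_def by (metis (no_types, lifting) comp_apply image_cong image_image proj_pt_def)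
qed

lemma octant_sign_change:
  assumes "a = 1 \<or> a = -1" "b = 1 \<or> b = -1" "c = 1 \<or> c = -1"
  shows "octant (M \<circ> sign_change a b c) a' b' c' = octant M (a * a') (b * b') (c * c')"
  unfolding octant_def
  by (rule region_comp[OF linear_sign_change bij_sign_change[OF assms]])
    (use assms in \<open>auto simp: sign_change_def\<close>)

lemma octant_rotate3: "octant (M \<circ> rotate3) a b c = octant M c a b"
proof -
  have "0 < w * u \<and> 0 < w * v \<longleftrightarrow> 0 < u * v \<and> 0 < u * w" for u v w :: real
    by (auto simp: zero_less_mult_iff)
  then show ?thesis
    unfolding octant_def
    by (intro region_comp[OF linear_rotate3 bij_rotate3]) (simp add: rotate3_def case_prod_beta)
qed

lemma side_sign_change:
  assumes "s = 1 \<or> s = -1"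
  shows "side (M \<circ> sign_change 1 s (-1)) 1 = side M (-1)"
  unfolding side_def
  by (rule region_comp[OF linear_sign_change bij_sign_change]) (use assms in \<open>auto simp: sign_change_def\<close>)

lemma adapted_rotate3:
  assumes "adapted L k M"
  shows "adapted L (k + 1) (M \<circ> rotate3)"
proof -
  have "region (M \<circ> rotate3) (\<lambda>(x, y, z). y = 0) = region M (\<lambda>(x, y, z). z = 0)"
    "region (M \<circ> rotate3) (\<lambda>(x, y, z). z = 0) = region M (\<lambda>(x, y, z). x = 0)"
    "region (M \<circ> rotate3) (\<lambda>(x, y, z). x = 0) = region M (\<lambda>(x, y, z). y = 0)"
    by (rule region_comp[OF linear_rotate3 bij_rotate3]; simp add: rotate3_def case_prod_beta)+
  then show ?thesis
    using assms homogeneous_coordinates_comp[OF _ linear_rotate3 bij_rotate3, of M]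
    unfolding adapted_def UNIV_3_shift(3,5) by (simp add: UNIV_3_shift(3-5))
qed

lemma adapted_sign_change:
  assumes "adapted L k M" "a = 1 \<or> a = -1" "b = 1 \<or> b = -1" "c = 1 \<or> c = -1"
  shows "adapted L k (M \<circ> sign_change a b c)"
proof -
  note r = region_comp[OF linear_sign_change bij_sign_change[OF assms(2-4)]]
  have "region (M \<circ> sign_change a b c) (\<lambda>(x, y, z). x = 0) = region M (\<lambda>(x, y, z). x = 0)"
    "region (M \<circ> sign_change a b c) (\<lambda>(x, y, z). y = 0) = region M (\<lambda>(x, y, z). y = 0)"
    "region (M \<circ> sign_change a b c) (\<lambda>(x, y, z). z = 0) = region M (\<lambda>(x, y, z). z = 0)"
    by (rule r; use assms in \<open>auto simp: sign_change_def\<close>)+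
  then show ?thesis
    using assms(1) homogeneous_coordinates_comp[OF _ linear_sign_change bij_sign_change[OF assms(2-4)], of M]
    unfolding adapted_def by simp
qed

text \<open>Each line is the kernel of a linear functional. General position says that the three
  functionals vanish together only at 0, so they form a linear isomorphism, and its inverse is the
  required coordinate system.\<close>

lemma lines_adapted_coordinates:
  assumes "lines_in_general_position L"
  obtains A where "adapted L 2 A"
proof -
  have "\<exists>n. L k = rp2_class ` {x. x \<noteq> 0 \<and> n \<bullet> x = 0}" for k
  proof -
    have "projective_line (L k)" using assms by (simp add: lines_in_general_position_def)
    then obtain V where V: "subspace V" "dim V = 2" "L k = rp2_class ` (V - {0})"
      unfolding projective_line_def by blast
    obtain n where "span V = {x. n \<bullet> x = 0}"
      using lowdim_eq_hyperplane[of V] V(2) by auto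
    then have "V - {0} = {x. x \<noteq> 0 \<and> n \<bullet> x = 0}" using V(1) by (auto simp: span_eq_iff[THEN iffD2])
    then show ?thesis using V(3) by auto
  qed
  then have "\<forall>k. \<exists>n. L k = rp2_class ` {x. x \<noteq> 0 \<and> n \<bullet> x = 0}" by blast
  from choice[OF this] obtain n where n: "\<And>k. L k = rp2_class ` {x. x \<noteq> 0 \<and> n k \<bullet> x = 0}" by blast
  define N where "N x = (n 1 \<bullet> x, n 2 \<bullet> x, n 3 \<bullet> x)" for x
  have linN: "linear N" by (auto simp: N_def linear_iff inner_add_right)
  have "x = 0" if "N x = 0" for x
  proof (rule ccontr)
    assume "x \<noteq> 0"
    have "n 1 \<bullet> x = 0" "n 2 \<bullet> x = 0" "n 3 \<bullet> x = 0" using that by (simp_all add: N_def zero_prod_def)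
    then have "n k \<bullet> x = 0" for k using exhaust_3[of k] by metis
    then have "rp2_class x \<in> (\<Inter>k. L k)" using \<open>x \<noteq> 0\<close> n by auto
    moreover have "(\<Inter>k. L k) = {}" using assms unfolding lines_in_general_position_def by blast
    ultimately show False by blast
  qed
  then have injN: "inj N" using linN by (simp add: linear_injective_0)
  have "dim (range N) = dim (UNIV :: r3 set)"
    using dim_image_eq[OF linN, of UNIV] injN by simp
  then have "range N = UNIV"
    using linear_subspace_image[OF linN subspace_UNIV] by (metis dim_eq_full dim_UNIV span_eq_iff)
  then have bijN: "bij N" using injN by (simp add: bij_def)
  define A where "A = inv N"
  have NA: "N (A v) = v" and AN: "A (N x) = x" for v x
    using bijN by (auto simp: A_def bij_is_surj surj_f_inv_f injN)
  have linA: "linear A"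
  proof (rule linearI)
    show "A (v + w) = A v + A w" for v w
      using AN[of "A v + A w"] by (simp add: linear_add[OF linN] NA)
    show "A (c *\<^sub>R v) = c *\<^sub>R A v" for c v
      using AN[of "c *\<^sub>R A v"] by (simp add: linear_scale[OF linN] NA)
  qed
  have hc: "homogeneous_coordinates A"
    using linA bij_imp_bij_inv[OF bijN] by (simp add: homogeneous_coordinates_def A_def)
  have reg: "region A P = rp2_class ` {x. x \<noteq> 0 \<and> P (N x)}" for P
  proof -
    have "A ` {v. v \<noteq> 0 \<and> P v} = {x. x \<noteq> 0 \<and> P (N x)}"
    proof (intro set_eqI iffI)
      fix x assume "x \<in> {x. x \<noteq> 0 \<and> P (N x)}"
      then show "x \<in> A ` {v. v \<noteq> 0 \<and> P v}"
        using AN[of x] linear_0[OF linA] by (intro image_eqI[of _ _ "N x"]) auto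
    next
      fix x assume "x \<in> A ` {v. v \<noteq> 0 \<and> P v}"
      then obtain v where v: "x = A v" "v \<noteq> 0" "P v" by blast
      then have "N x = v" using NA by simp
      then show "x \<in> {x. x \<noteq> 0 \<and> P (N x)}" using v linear_0[OF linN] by auto
    qed
    then show ?thesis unfolding region_def by (metis (no_types, lifting) image_cong image_image proj_pt_def)
  qed
  \<comment> \<open>Arithmetic in the type \<open>3\<close> is modulo 3. Label 2 is the one whose
    functional is the second coordinate, as \<open>adapted\<close> demands.\<close>
  have four: "(2::3) + 1 = 3" "(2::3) + 2 = 1" by simp_all
  have "adapted L 2 A"
    unfolding adapted_def four reg using hc n by (simp add: N_def)
  then show ?thesis by (rule that)
qed

text \<open>Sign changes preserve the coordinate planes and permute the octants, so they can move
  the given triangle to the positive octant.\<close>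

lemma triangle_adapted_coordinates:
  assumes "lines_in_general_position L" "T0 \<in> triangles L"
  obtains A where "adapted L 2 A" "T0 = octant A 1 1 1"
proof -
  obtain A where A: "adapted L 2 A" using lines_adapted_coordinates[OF assms(1)] .
  have "\<exists>a b c. (a = 1 \<or> a = -1) \<and> (b = 1 \<or> b = -1) \<and> (c = 1 \<or> c = -1) \<and> T0 = octant A a b c"
    using assms(2) unfolding triangles_adapted[OF A] by blast
  then obtain a b c where abc: "a = 1 \<or> a = -1" "b = 1 \<or> b = -1" "c = 1 \<or> c = -1" "T0 = octant A a b c"
    by blast
  show ?thesis
    by (rule that[OF adapted_sign_change[OF A abc(1-3)]]) (simp add: octant_sign_change[OF abc(1-3)] abc(4))
qed

text \<open>The number of rotations is chosen so that line \<open>k\<close> becomes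
  \<open>y = 0\<close>: none for label 2, one for 3, two for 1.\<close>

definition coords :: "(r3 \<Rightarrow> real ^ 3) \<Rightarrow> 3 \<Rightarrow> r3 \<Rightarrow> real ^ 3" where
  "coords A k = (if k = 2 then A else if k = 3 then A \<circ> rotate3 else A \<circ> rotate3 \<circ> rotate3)"

text \<open>The sign \<open>s\<close> decides which of the two triangles at the far segment is the bulge side.\<close>

definition bulge_coords :: "(r3 \<Rightarrow> real ^ 3) \<Rightarrow> real \<Rightarrow> 3 \<Rightarrow> r3 \<Rightarrow> real ^ 3" where
  "bulge_coords A s k = coords A k \<circ> sign_change 1 s (-1)"

lemma coords_simps:
  "coords A 1 = A \<circ> rotate3 \<circ> rotate3" "coords A 2 = A" "coords A 3 = A \<circ> rotate3"
  by (simp_all add: coords_def)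

lemma coords_Suc: "coords A (k + 1) = coords A k \<circ> rotate3"
proof -
  have r: "rotate3 \<circ> rotate3 \<circ> rotate3 = (id :: r3 \<Rightarrow> r3)" by (auto simp: rotate3_def)
  have a: "(1::3) + 1 = 2" "(2::3) + 1 = 3" "(3::3) + 1 = 1" by simp_all
  have "coords A 2 = coords A 1 \<circ> rotate3"
    unfolding coords_simps using r by (metis comp_assoc comp_id)
  then show ?thesis using exhaust_3[of k] a coords_simps[of A] by metis
qed

lemma adapted_coords:
  assumes "adapted L 2 A"
  shows "adapted L k (coords A k)"
proof -
  have a: "(1::3) + 1 = 2" "(2::3) + 1 = 3" "(3::3) + 1 = 1" by simp_all
  have 3: "adapted L 3 (coords A 3)"
    using adapted_rotate3[OF assms] unfolding a coords_simps .
  have "adapted L 1 (coords A 1)"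
    using adapted_rotate3[OF 3] unfolding a coords_simps .
  then show ?thesis using 3 assms exhaust_3[of k] coords_simps(2)[of A] by metis
qed

lemma octant_coords: "octant (coords A k) 1 1 1 = octant A 1 1 1"
  by (simp add: coords_def octant_rotate3)

text \<open>Coordinates of a common point in the two charts have the same sum of absolute values, so
  they agree up to sign, and positivity of \<open>x\<close> and \<open>z'\<close> makes them
  opposite. The point then lies on a foot of one disk and on the bulge of the other, where the two
  distance bounds leave only a few boundary points to exclude.\<close>

lemma neighbouring_disks_disjoint:
  assumes M: "homogeneous_coordinates M"
    and cases: "s = 1 \<and> G = gauge_A \<or> s = -1 \<and> G = gauge_P"
  shows "chart (M \<circ> sign_change 1 s (-1)) ` plane_fold ` {w. G w \<le> 1} \<inter>
    chart (M \<circ> rotate3 \<circ> sign_change 1 s (-1)) ` plane_fold ` {w. G w \<le> 1} = {}"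
proof (rule ccontr)
  interpret homogeneous_coordinates M by (rule M)
  assume "\<not> ?thesis"
  then obtain r where r: "r \<in> chart (M \<circ> sign_change 1 s (-1)) ` plane_fold ` {w. G w \<le> 1}"
    "r \<in> chart (M \<circ> rotate3 \<circ> sign_change 1 s (-1)) ` plane_fold ` {w. G w \<le> 1}" by blast
  from r(1) obtain p where p: "r = chart (M \<circ> sign_change 1 s (-1)) p" "p \<in> plane_fold ` {w. G w \<le> 1}"
    by (rule imageE)
  from r(2) obtain q where q: "r = chart (M \<circ> rotate3 \<circ> sign_change 1 s (-1)) q" "q \<in> plane_fold ` {w. G w \<le> 1}"
    by (rule imageE)
  obtain x y x' y' where pq: "p = (x, y)" "q = (x', y')" by (cases p, cases q)
  have xy: "(x, y) \<in> plane_fold ` {w. G w \<le> 1}" "(x', y') \<in> plane_fold ` {w. G w \<le> 1}"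
    using p(2) q(2) pq by simp_all
  have e: "chart (M \<circ> sign_change 1 s (-1)) (x, y) = chart (M \<circ> rotate3 \<circ> sign_change 1 s (-1)) (x', y')"
    using trans[OF p(1)[symmetric] q(1)] unfolding pq .
  define z z' where "z = 8 - x - \<bar>y\<bar>" and "z' = 8 - x' - \<bar>y'\<bar>"
  have b: "0 < x" "0 < z" "0 < x'" "0 < z'"
    "y < 0 \<longrightarrow> - 1 < y \<or> y = -1 \<and> (x = 3 \<or> x = 5)" "y' < 0 \<longrightarrow> - 1 < y' \<or> y' = -1 \<and> (x' = 3 \<or> x' = 5)"
  proof -
    have m: "(x, y) \<in> plane_fold ` {w. gauge_A w \<le> 1} \<union> plane_fold ` {w. gauge_P w \<le> 1}"
      "(x', y') \<in> plane_fold ` {w. gauge_A w \<le> 1} \<union> plane_fold ` {w. gauge_P w \<le> 1}"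
      using xy cases by blast+
    show "0 < x" "0 < z" "0 < x'" "0 < z'" "y < 0 \<longrightarrow> - 1 < y \<or> y = -1 \<and> (x = 3 \<or> x = 5)"
      "y' < 0 \<longrightarrow> - 1 < y' \<or> y' = -1 \<and> (x' = 3 \<or> x' = 5)"
      using plane_fold_gauge_bounds[OF m(1)] plane_fold_gauge_bounds[OF m(2)]
      unfolding z_def z'_def by simp_all
  qed
  have "proj_pt M (x, s * y, - z) = proj_pt M (- z', x', s * y')"
    using e by (simp add: chart_def proj_pt_def lift_def sign_change_def rotate3_def z_def z'_def)
  moreover have "(x, s * y, - z) \<noteq> 0" "(- z', x', s * y') \<noteq> 0" using b by (auto simp: zero_prod_def)
  ultimately obtain c where "(x, s * y, - z) = c *\<^sub>R (- z', x', s * y')"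
    using proj_pt_eq_iff by metis
  then have c: "x = c * (- z')" "s * y = c * x'" "- z = c * (s * y')" by auto
  have "c < 0" using c(1) b(1,4) by (metis mult_pos_neg mult_zero_left neg_less_0_iff_less not_less_iff_gr_or_eq order_less_asym)
  have s: "\<bar>s\<bar> = 1" using cases by auto
  have n: "\<bar>x\<bar> = \<bar>c\<bar> * \<bar>z'\<bar>" "\<bar>y\<bar> = \<bar>c\<bar> * \<bar>x'\<bar>" "\<bar>z\<bar> = \<bar>c\<bar> * \<bar>y'\<bar>"
    using arg_cong[OF c(1), of abs] arg_cong[OF c(2), of abs] arg_cong[OF c(3), of abs] s
    by (simp_all add: abs_mult)
  have "\<bar>x\<bar> + \<bar>y\<bar> + \<bar>z\<bar> = 8" "\<bar>x'\<bar> + \<bar>y'\<bar> + \<bar>z'\<bar> = 8" using b by (auto simp: z_def z'_def)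
  \<comment> \<open>Both points lie on the octahedron of size 8, which a scalar preserves only if
    its absolute value is 1.\<close>
  then have "8 = \<bar>c\<bar> * 8" unfolding n by (metis add.assoc add.commute distrib_left)
  then have "c = -1" using \<open>c < 0\<close> by auto
  then have d: "x = z'" "s * y = - x'" "z = s * y'" using c by auto
  from cases show False
  proof
    assume G: "s = 1 \<and> G = gauge_A"
    \<comment> \<open>Here \<open>y = - x'\<close> is negative, so \<open>p\<close> is on a foot and
      \<open>q\<close> on the bulge. The bounds force \<open>y = -1\<close> and
      \<open>y' = 6\<close>, hence \<open>z = 6\<close>, whereas \<open>x = 3\<close> or
      \<open>x = 5\<close> gives 4 or 2.\<close>
    then have "1 < x' \<or> x' = 1 \<and> y' = 6" using plane_fold_gauge_A_above[of x' y'] xy d b by auto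
    then show False using b(5) d b(1-4) G unfolding z_def z'_def by auto
  next
    assume G: "s = -1 \<and> G = gauge_P"
    \<comment> \<open>Here the foot belongs to \<open>q\<close>, with depth \<open>z\<close>. The
      bounds force \<open>z = 1\<close> and \<open>y \<le> 1\<close>, whereas \<open>y = x'\<close>
      must be 3 or 5.\<close>
    then have "x + y < 7 \<or> x + y = 7 \<and> y \<le> 1" using plane_fold_gauge_P_above[of x y] xy d b by auto
    then show False using b(6) d b(1-4) G unfolding z_def z'_def by auto
  qed
qed

lemma arrangement_A_polygons:
  assumes L: "lines_in_general_position L" "T0 \<in> triangles L"
    and A: "adapted L 2 A" "T0 = octant A 1 1 1"
    and cases: "s = 1 \<and> V = VA \<and> W = WA \<or> s = -1 \<and> V = VP \<and> W = WP"
  shows "arrangement_A L T0 (\<lambda>k. chart (bulge_coords A s k) ` polygon V W)"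
proof -
  have s: "s = 1 \<or> s = -1" using cases by auto
  obtain G where G: "s = 1 \<and> G = gauge_A \<or> s = -1 \<and> G = gauge_P" using s by blast
  define D where "D k = chart (bulge_coords A s k) ` plane_fold ` {w. G w \<le> 1}" for k
  have ad: "adapted L k (coords A k)" for k using A(1) by (rule adapted_coords)
  have adb: "adapted L k (bulge_coords A s k)" for k
    unfolding bulge_coords_def using ad s by (intro adapted_sign_change) auto
  then have hc: "homogeneous_coordinates (bulge_coords A s k)" for k by (simp add: adapted_def)
  have disk: "bounds_disk (chart (bulge_coords A s k) ` polygon V W) (D k)" for k
  proof -
    have "G = gauge_A \<and> V = VA \<and> W = WA \<or> G = gauge_P \<and> V = VP \<and> W = WP" using G cases by auto
    then show ?thesis
      unfolding D_def
      by (elim disjE conjE) (simp_all only: homogeneous_coordinates.bounds_disk_polygon[OF hc])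
  qed
  have D1: "D k \<inter> D (k + 1) = {}" for k
    unfolding D_def bulge_coords_def coords_Suc
    using ad[of k] G by (intro neighbouring_disks_disjoint) (auto simp: adapted_def)
  have disj: "D j \<inter> D k = {}" if "j \<noteq> k" for j k
  proof -
    \<comment> \<open>Of three cyclically ordered labels any two distinct ones are consecutive, so
      the statement about neighbours suffices.\<close>
    have "j = k + 1 \<or> k = j + 1" using that exhaust_3_shift[of j k] UNIV_3_shift(4)[of k] by metis
    then show ?thesis using D1[of j] D1[of k] by blast
  qed
  define B where "B k = octant (bulge_coords A s k) 1 1 1" for k
  have B: "B k = octant (coords A k) 1 s (-1)" for k
    using s by (simp add: B_def bulge_coords_def octant_sign_change)
  interpret A: homogeneous_coordinates A using A(1) by (simp add: adapted_def)
  have u: "octant A (-1) (-1) 1 = octant A 1 1 (-1)" "octant A 1 (-1) (-1) = octant A (-1) 1 1"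
    "octant A (-1) 1 (-1) = octant A 1 (-1) 1"
    using A.octant_uminus[of 1 1 "-1"] A.octant_uminus[of "-1" 1 1] A.octant_uminus[of 1 "-1" 1] by simp_all
  have B123: "B 1 = octant A s (-1) 1" "B 2 = octant A 1 s (-1)" "B 3 = octant A (-1) 1 s"
    unfolding B coords_simps octant_rotate3 by (rule refl)+
  \<comment> \<open>The two values of \<open>s\<close> assign the three outer triangles to the lines
    in different ways, both of them bijective.\<close>
  have B': "B 1 = octant A 1 (-1) 1 \<and> B 2 = octant A 1 1 (-1) \<and> B 3 = octant A (-1) 1 1 \<or>
      B 1 = octant A 1 1 (-1) \<and> B 2 = octant A (-1) 1 1 \<and> B 3 = octant A 1 (-1) 1"
    using s unfolding B123 by (elim disjE) (simp_all only: u simp_thms)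
  have Bval: "{B 1, B 2, B 3} = {octant A (-1) 1 1, octant A 1 (-1) 1, octant A 1 1 (-1)}"
    using B' by (elim disjE conjE) (simp_all only:, blast+)
  have d: "octant A (-1) 1 1 \<noteq> octant A 1 (-1) 1" "octant A (-1) 1 1 \<noteq> octant A 1 1 (-1)"
    "octant A 1 (-1) 1 \<noteq> octant A 1 1 (-1)" using A.octants_distinct by simp_all
  have ne: "B 1 \<noteq> B 2" "B 1 \<noteq> B 3" "B 2 \<noteq> B 3"
    using B' d by argo+
  have bijB: "bij_betw B UNIV (triangles L - {T0})"
    unfolding bij_betw_def
  proof
    have e: "j = 1 \<or> j = 2 \<or> j = 3" for j :: 3 by (rule exhaust_3)
    have "x = y" if xy: "B x = B y" for x y
    proof (rule ccontr)
      assume "x \<noteq> y"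
      then consider "x = 1" "y = 2" | "x = 1" "y = 3" | "x = 2" "y = 3" | "y = 1" "x = 2" | "y = 1" "x = 3" | "y = 2" "x = 3"
        using e[of x] e[of y] by blast
      then show False by cases (use ne xy in \<open>metis\<close>)+
    qed
    then show "inj B" by (rule injI)
    have "triangles L - {T0} = {octant A (-1) 1 1, octant A 1 (-1) 1, octant A 1 1 (-1)}"
      unfolding triangles_adapted[OF A(1)] A(2) using A.octants_distinct by auto
    then show "range B = triangles L - {T0}" unfolding UNIV_3 using Bval by simp
  qed
  have pos: "oval_position L (far_segment L T0 k) (B k) (chart (bulge_coords A s k) ` polygon V W)" for k
  proof -
    have "far_segment L T0 k = side (coords A k) (-1)"
      by (rule far_segment_adapted[OF ad]) (simp add: A(2) octant_coords)
    then have far: "far_segment L T0 k = side (bulge_coords A s k) 1"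
      unfolding bulge_coords_def using side_sign_change[OF s] by simp
    have "adjacent_triangles L (side (bulge_coords A s k) 1) =
        {octant (coords A k) 1 1 (-1), octant (coords A k) (-1) 1 1}"
      unfolding bulge_coords_def side_sign_change[OF s] by (rule adjacent_triangles_far_side[OF ad])
    moreover have e: "octant (coords A k) 1 (-1) (-1) = octant (coords A k) (-1) 1 1"
      using homogeneous_coordinates.octant_uminus[of "coords A k" 1 "-1" "-1"] ad[of k] by (simp add: adapted_def)
    have o: "octant (bulge_coords A s k) 1 1 1 = octant (coords A k) 1 s (-1)"
      "octant (bulge_coords A s k) 1 (-1) 1 = octant (coords A k) 1 (- s) (-1)"
      using s by (simp_all add: bulge_coords_def octant_sign_change)
    have "{octant (bulge_coords A s k) 1 1 1, octant (bulge_coords A s k) 1 (-1) 1} =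
        {octant (coords A k) 1 1 (-1), octant (coords A k) (-1) 1 1}"
      using s unfolding o by (elim disjE) (simp_all only: minus_minus e insert_commute)
    ultimately have "{octant (bulge_coords A s k) 1 1 1, octant (bulge_coords A s k) 1 (-1) 1} \<subseteq>
        adjacent_triangles L (side (bulge_coords A s k) 1)" by simp
    then show ?thesis
      unfolding far B_def using cases adapted_Union[OF adb]
      by (intro homogeneous_coordinates.oval_position_polygon[OF hc]) auto
  qed
  show ?thesis
    unfolding arrangement_A_def
  proof (intro conjI)
    show "\<exists>D. (\<forall>k. bounds_disk (chart (bulge_coords A s k) ` polygon V W) (D k)) \<and>
        (\<forall>j k. j \<noteq> k \<longrightarrow> D j \<inter> D k = {})"
      by (rule exI[of _ D]) (use disk disj in blast)
    show "\<exists>B. bij_betw B UNIV (triangles L - {T0}) \<and>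
        (\<forall>k. oval_position L (far_segment L T0 k) (B k) (chart (bulge_coords A s k) ` polygon V W))"
      by (rule exI[of _ B]) (use bijB pos in blast)
  qed (use L in auto)
qed

section \<open>The octahedral model of the patchworked plane\<close>

lemma big_triangle_eq: "big_triangle = {(x, y). 0 \<le> x \<and> 0 \<le> y \<and> x + y \<le> 4}"
proof (intro set_eqI iffI)
  fix w assume "w \<in> big_triangle"
  then show "w \<in> {(x, y). 0 \<le> x \<and> 0 \<le> y \<and> x + y \<le> 4}"
    unfolding big_triangle_def convex_hull_3 by auto
next
  fix w :: "real \<times> real" assume w: "w \<in> {(x, y). 0 \<le> x \<and> 0 \<le> y \<and> x + y \<le> 4}"
  then obtain x y where xy: "w = (x, y)" "0 \<le> x" "0 \<le> y" "x + y \<le> 4" by auto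
  have "w = (1 - (x + y) / 4) *\<^sub>R (0, 0) + (x / 4) *\<^sub>R (4, 0) + (y / 4) *\<^sub>R (0, 4)"
    by (simp add: xy)
  moreover have "0 \<le> 1 - (x + y) / 4" "0 \<le> x / 4" "0 \<le> y / 4" "(1 - (x + y) / 4) + x / 4 + y / 4 = 1"
    using xy by (simp_all add: field_simps)
  ultimately show "w \<in> big_triangle"
    unfolding big_triangle_def convex_hull_3 by blast
qed

lemma T_star_eq: "T_star = {(x, y). \<bar>x\<bar> + \<bar>y\<bar> \<le> 4}"
proof (intro set_eqI iffI)
  fix w assume "w \<in> T_star"
  then show "w \<in> {(x, y). \<bar>x\<bar> + \<bar>y\<bar> \<le> 4}"
    by (auto simp: T_star_def quadrants_def reflect_def big_triangle_eq)
next
  fix w :: "real \<times> real" assume w: "w \<in> {(x, y). \<bar>x\<bar> + \<bar>y\<bar> \<le> 4}"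
  then obtain x y where xy: "w = (x, y)" "\<bar>x\<bar> + \<bar>y\<bar> \<le> 4" by auto
  define e :: "int \<times> int" where "e = (if 0 \<le> x then 1 else -1, if 0 \<le> y then 1 else -1)"
  have "e \<in> quadrants" by (simp add: e_def quadrants_def)
  moreover have "w = reflect e (\<bar>x\<bar>, \<bar>y\<bar>)" by (simp add: e_def reflect_def xy)
  moreover have "(\<bar>x\<bar>, \<bar>y\<bar>) \<in> big_triangle" using xy by (simp add: big_triangle_eq)
  ultimately show "w \<in> T_star" unfolding T_star_def by blast
qed

lemma closed_T_star: "closed T_star"
proof -
  have "closed {w :: real \<times> real. \<bar>fst w\<bar> + \<bar>snd w\<bar> \<le> 4}"
    by (intro closed_Collect_le continuous_intros)
  then show ?thesis by (simp add: T_star_eq case_prod_beta')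
qed

lemma compact_T_star: "compact T_star"
proof -
  have "norm w \<le> 4" if "w \<in> T_star" for w
  proof -
    obtain x y where "w = (x, y)" by (cases w)
    then show ?thesis using that norm_Pair_le[of x y] by (auto simp: T_star_eq)
  qed
  then have "bounded T_star" unfolding bounded_iff by blast
  then show ?thesis using closed_T_star compact_eq_bounded_closed by blast
qed

text \<open>An interior point can be pushed slightly outwards along its ray without leaving the
  square, so the sum of its absolute coordinates is less than 4.\<close>

lemma frontier_T_star: "frontier T_star = {(x, y). \<bar>x\<bar> + \<bar>y\<bar> = 4}"
proof -
  have "interior T_star = {(x, y). \<bar>x\<bar> + \<bar>y\<bar> < 4}"
  proof
    have "open {w :: real \<times> real. \<bar>fst w\<bar> + \<bar>snd w\<bar> < 4}"
      by (intro open_Collect_less continuous_intros)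
    then have "open {(x, y). \<bar>x\<bar> + \<bar>y\<bar> < (4::real)}" by (simp add: case_prod_beta')
    then show "{(x, y). \<bar>x\<bar> + \<bar>y\<bar> < 4} \<subseteq> interior T_star"
      by (intro interior_maximal) (auto simp: T_star_eq)
    show "interior T_star \<subseteq> {(x, y). \<bar>x\<bar> + \<bar>y\<bar> < 4}"
    proof
      fix w assume "w \<in> interior T_star"
      then obtain e where e: "0 < e" "ball w e \<subseteq> T_star" unfolding mem_interior by blast
      obtain x y where xy: "w = (x, y)" by (cases w)
      define t where "t = e / (2 * (norm w + 1))"
      have n: "0 < norm w + 1" using norm_ge_zero[of w] by linarith
      have t: "0 < t" using e(1) n by (simp add: t_def)
      have "dist w ((1 + t) *\<^sub>R w) = t * norm w"
        using t by (simp add: dist_norm algebra_simps)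
      also have "\<dots> < t * (norm w + 1) * 2"
      proof -
        have "0 \<le> t * norm w" using t by simp
        then have "t * norm w < t * norm w + (t * norm w + t * 2)" using t by linarith
        then show ?thesis by (simp add: algebra_simps)
      qed
      also have "\<dots> = e" using n unfolding t_def by (simp add: nonzero_divide_eq_eq)
      finally have "(1 + t) *\<^sub>R w \<in> T_star" using e(2) by auto
      then have "(1 + t) * (\<bar>x\<bar> + \<bar>y\<bar>) \<le> 4" using t by (simp add: T_star_eq xy abs_mult algebra_simps)
      moreover have "\<bar>x\<bar> + \<bar>y\<bar> < (1 + t) * (\<bar>x\<bar> + \<bar>y\<bar>)" if "4 \<le> \<bar>x\<bar> + \<bar>y\<bar>"
        using that t by (simp add: algebra_simps) (smt (verit) mult_pos_pos distrib_left)
      ultimately have "\<bar>x\<bar> + \<bar>y\<bar> < 4" by linarith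
      then show "w \<in> {(x, y). \<bar>x\<bar> + \<bar>y\<bar> < 4}" unfolding xy by simp
    qed
  qed
  then show ?thesis
    unfolding frontier_def closure_closed[OF closed_T_star] by (auto simp: T_star_eq)
qed

lemma antipodal_class_eq_iff:
  assumes "v \<in> T_star" "w \<in> T_star"
  shows "antipodal_class v = antipodal_class w \<longleftrightarrow> v = w \<or> v \<in> frontier T_star \<and> v = - w"
proof -
  have neg: "- u \<in> frontier T_star \<longleftrightarrow> u \<in> frontier T_star" for u :: "real \<times> real"
    by (cases u) (auto simp: frontier_T_star)
  show ?thesis
    using neg[of w] unfolding antipodal_class_def by (auto simp: doubleton_eq_iff)
qed

definition octahedral_map :: "(r3 \<Rightarrow> real ^ 3) \<Rightarrow> real \<times> real \<Rightarrow> rp2_point" where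
  "octahedral_map A w = proj_pt A (fst w, snd w, 4 - \<bar>fst w\<bar> - \<bar>snd w\<bar>)"

lemma octahedral_point_nonzero: "(fst w, snd w, 4 - \<bar>fst w\<bar> - \<bar>snd w\<bar>) \<noteq> (0 :: r3)"
  by (auto simp: zero_prod_def)

section \<open>The homeomorphism between the patchworked plane and the projective plane\<close>

context homogeneous_coordinates
begin

text \<open>The lifted points lie on the octahedron of size 4, so a scalar relating them is 1 or -1.
  As third coordinates are nonnegative, -1 is possible only when both vanish, that is, on the
  boundary.\<close>

lemma octahedral_map_eq_iff:
  assumes "v \<in> T_star" "w \<in> T_star"
  shows "octahedral_map M v = octahedral_map M w \<longleftrightarrow> antipodal_class v = antipodal_class w"
proof -
  obtain x y x' y' where xy: "v = (x, y)" "w = (x', y')" by (cases v, cases w)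
  have T: "\<bar>x\<bar> + \<bar>y\<bar> \<le> 4" "\<bar>x'\<bar> + \<bar>y'\<bar> \<le> 4" using assms by (auto simp: xy T_star_eq)
  have "octahedral_map M v = octahedral_map M w \<longleftrightarrow>
      (\<exists>c. c \<noteq> 0 \<and> x = c * x' \<and> y = c * y' \<and> 4 - \<bar>x\<bar> - \<bar>y\<bar> = c * (4 - \<bar>x'\<bar> - \<bar>y'\<bar>))"
    using proj_pt_eq_iff[OF octahedral_point_nonzero[of v] octahedral_point_nonzero[of w]]
    by (simp add: octahedral_map_def xy)
  also have "\<dots> \<longleftrightarrow> x = x' \<and> y = y' \<or> \<bar>x\<bar> + \<bar>y\<bar> = 4 \<and> x = - x' \<and> y = - y'"
  proof
    assume "\<exists>c. c \<noteq> 0 \<and> x = c * x' \<and> y = c * y' \<and> 4 - \<bar>x\<bar> - \<bar>y\<bar> = c * (4 - \<bar>x'\<bar> - \<bar>y'\<bar>)"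
    then obtain c where c: "c \<noteq> 0" "x = c * x'" "y = c * y'" "4 - \<bar>x\<bar> - \<bar>y\<bar> = c * (4 - \<bar>x'\<bar> - \<bar>y'\<bar>)" by blast
    have a: "\<bar>x\<bar> = \<bar>c\<bar> * \<bar>x'\<bar>" "\<bar>y\<bar> = \<bar>c\<bar> * \<bar>y'\<bar>" using c by (simp_all add: abs_mult)
    have "\<bar>4 - \<bar>x\<bar> - \<bar>y\<bar>\<bar> = \<bar>c\<bar> * \<bar>4 - \<bar>x'\<bar> - \<bar>y'\<bar>\<bar>" unfolding c(4) by (rule abs_mult)
    then have "4 - \<bar>x\<bar> - \<bar>y\<bar> = \<bar>c\<bar> * (4 - \<bar>x'\<bar> - \<bar>y'\<bar>)" using T by simp
    then have "4 = \<bar>c\<bar> * 4" unfolding a by (simp add: algebra_simps)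
    then have "c = 1 \<or> c = -1" by auto
    then show "x = x' \<and> y = y' \<or> \<bar>x\<bar> + \<bar>y\<bar> = 4 \<and> x = - x' \<and> y = - y'"
      using c T by auto
  next
    assume "x = x' \<and> y = y' \<or> \<bar>x\<bar> + \<bar>y\<bar> = 4 \<and> x = - x' \<and> y = - y'"
    then show "\<exists>c. c \<noteq> 0 \<and> x = c * x' \<and> y = c * y' \<and> 4 - \<bar>x\<bar> - \<bar>y\<bar> = c * (4 - \<bar>x'\<bar> - \<bar>y'\<bar>)"
    proof
      assume "x = x' \<and> y = y'"
      then show ?thesis by (intro exI[of _ 1]) auto
    next
      assume "\<bar>x\<bar> + \<bar>y\<bar> = 4 \<and> x = - x' \<and> y = - y'"
      then show ?thesis by (intro exI[of _ "-1"]) auto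
    qed
  qed
  also have "\<dots> \<longleftrightarrow> antipodal_class v = antipodal_class w"
    using antipodal_class_eq_iff[OF assms] unfolding frontier_T_star xy by simp
  finally show ?thesis .
qed

text \<open>The map descends to classes, and a continuous bijection from a compact space onto a
  Hausdorff space is a homeomorphism.\<close>

lemma octahedral_map_homeomorphism:
  obtains f where "homeomorphic_map patchwork_plane rp2 f"
    "\<And>w. w \<in> T_star \<Longrightarrow> f (antipodal_class w) = octahedral_map M w"
proof -
  define f where "f C = octahedral_map M (SOME w. w \<in> T_star \<and> antipodal_class w = C)" for C
  have f: "f (antipodal_class w) = octahedral_map M w" if "w \<in> T_star" for w
  proof -
    have "(SOME v. v \<in> T_star \<and> antipodal_class v = antipodal_class w) \<in> T_star \<and>
        antipodal_class (SOME v. v \<in> T_star \<and> antipodal_class v = antipodal_class w) = antipodal_class w"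
      by (rule someI[of "\<lambda>v. v \<in> T_star \<and> antipodal_class v = antipodal_class w" w]) (use that in simp)
    then show ?thesis unfolding f_def using octahedral_map_eq_iff that by blast
  qed
  have q: "quotient_map (top_of_set T_star) patchwork_plane antipodal_class"
    unfolding patchwork_plane_def by (rule quotient_map_quotient_topology)
  have top: "topspace patchwork_plane = antipodal_class ` T_star"
    by (simp add: patchwork_plane_def topspace_quotient_topology)
  have "continuous_map (top_of_set T_star) rp2 (octahedral_map M)"
    unfolding octahedral_map_def[abs_def]
    by (intro continuous_map_proj_pt_comp continuous_intros octahedral_point_nonzero)
  then have "continuous_map (top_of_set T_star) rp2 (f \<circ> antipodal_class)"
    by (rule continuous_map_eq) (simp add: f)
  then have cont: "continuous_map patchwork_plane rp2 f"
    by (rule continuous_compose_quotient_map[OF q])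
  have "compact_space (top_of_set T_star)" using compact_T_star by (simp add: compact_space_subtopology)
  then have comp: "compact_space patchwork_plane"
    using image_compactin[OF _ quotient_imp_continuous_map[OF q], of T_star] top
    by (simp add: compact_space_def)
  have inj: "inj_on f (topspace patchwork_plane)"
    unfolding top inj_on_def using f octahedral_map_eq_iff by auto
  have surj: "f ` topspace patchwork_plane = topspace rp2"
  proof
    show "f ` topspace patchwork_plane \<subseteq> topspace rp2" using cont by (rule continuous_map_image_subset_topspace)
    show "topspace rp2 \<subseteq> f ` topspace patchwork_plane"
    proof
      fix p assume "p \<in> topspace rp2"
      then obtain x y z where p: "(x, y, z) \<noteq> 0" "p = proj_pt M (x, y, z)" by (rule rp2_point_cases)
      \<comment> \<open>This scalar brings a representative to the octahedron of size 4 with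
        nonnegative third coordinate, so that it is the lift of a point of the square.\<close>
      define r where "r = (if 0 \<le> z then 4 else -4) / (\<bar>x\<bar> + \<bar>y\<bar> + \<bar>z\<bar>)"
      have n: "0 < \<bar>x\<bar> + \<bar>y\<bar> + \<bar>z\<bar>" using p(1) by (auto simp: zero_prod_def)
      have r: "r \<noteq> 0" "\<bar>r\<bar> * (\<bar>x\<bar> + \<bar>y\<bar> + \<bar>z\<bar>) = 4" "r * z = \<bar>r\<bar> * \<bar>z\<bar>"
        using n by (auto simp: r_def abs_if)
      have z: "4 - \<bar>r * x\<bar> - \<bar>r * y\<bar> = r * z"
        using r(2,3) by (simp add: abs_mult algebra_simps)
      have "0 \<le> r * z" unfolding r(3) by simp
      then have "(r * x, r * y) \<in> T_star" using z by (simp add: T_star_eq)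
      moreover have "octahedral_map M (r * x, r * y) = p"
        using proj_pt_scale[OF r(1) p(1)] p(2) z by (simp add: octahedral_map_def)
      ultimately show "p \<in> f ` topspace patchwork_plane" using f top by (metis imageI)
    qed
  qed
  have "homeomorphic_map patchwork_plane rp2 f"
    by (rule continuous_imp_homeomorphic_map[OF cont comp Hausdorff_rp2 surj inj])
  then show ?thesis using f by (rule that)
qed

lemma octahedral_map_lines:
  "octahedral_map M ` (T_star \<inter> {w. snd w = 0} \<union> T_star \<inter> {w. fst w = 0} \<union> frontier T_star) =
    region M (\<lambda>(x, y, z). x = 0 \<or> y = 0 \<or> z = 0)"
proof
  show "octahedral_map M ` (T_star \<inter> {w. snd w = 0} \<union> T_star \<inter> {w. fst w = 0} \<union> frontier T_star) \<subseteq>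
      region M (\<lambda>(x, y, z). x = 0 \<or> y = 0 \<or> z = 0)"
  proof
    fix p assume "p \<in> octahedral_map M ` (T_star \<inter> {w. snd w = 0} \<union> T_star \<inter> {w. fst w = 0} \<union> frontier T_star)"
    then obtain w where w: "p = octahedral_map M w" "snd w = 0 \<or> fst w = 0 \<or> w \<in> frontier T_star"
      by blast
    obtain x y where wxy: "w = (x, y)" by (cases w)
    have xy: "p = octahedral_map M (x, y)" "y = 0 \<or> x = 0 \<or> \<bar>x\<bar> + \<bar>y\<bar> = 4"
      using w unfolding wxy frontier_T_star by simp_all
    then show "p \<in> region M (\<lambda>(x, y, z). x = 0 \<or> y = 0 \<or> z = 0)"
      using proj_pt_on_lines[of x y "4 - \<bar>x\<bar> - \<bar>y\<bar>"] octahedral_point_nonzero[of "(x, y)"]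
      by (auto simp: octahedral_map_def)
  qed
  show "region M (\<lambda>(x, y, z). x = 0 \<or> y = 0 \<or> z = 0) \<subseteq>
      octahedral_map M ` (T_star \<inter> {w. snd w = 0} \<union> T_star \<inter> {w. fst w = 0} \<union> frontier T_star)"
  proof
    fix p assume pr: "p \<in> region M (\<lambda>(x, y, z). x = 0 \<or> y = 0 \<or> z = 0)"
    then have "p \<in> topspace rp2" using region_subset_topspace by blast
    moreover obtain f where f: "homeomorphic_map patchwork_plane rp2 f"
      "\<And>w. w \<in> T_star \<Longrightarrow> f (antipodal_class w) = octahedral_map M w"
      using octahedral_map_homeomorphism by blast
    ultimately have "p \<in> f ` antipodal_class ` T_star"
      using homeomorphic_imp_surjective_map[OF f(1)] by (simp add: patchwork_plane_def topspace_quotient_topology)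
    then obtain x y where xy: "(x, y) \<in> T_star" "p = octahedral_map M (x, y)" using f(2) by auto
    then have "x = 0 \<or> y = 0 \<or> 4 - \<bar>x\<bar> - \<bar>y\<bar> = 0"
      using pr proj_pt_on_lines[of x y "4 - \<bar>x\<bar> - \<bar>y\<bar>"] octahedral_point_nonzero[of "(x, y)"]
      by (simp add: octahedral_map_def)
    then show "p \<in> octahedral_map M ` (T_star \<inter> {w. snd w = 0} \<union> T_star \<inter> {w. fst w = 0} \<union> frontier T_star)"
      using xy by (auto simp: frontier_T_star)
  qed
qed

lemma realizes_patchwork:
  assumes "drawn_segments \<tau> \<delta> \<subseteq> T_star" "octahedral_map M ` drawn_segments \<tau> \<delta> = N"
    and "(\<Union>k. L k) = region M (\<lambda>(x, y, z). x = 0 \<or> y = 0 \<or> z = 0)"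
  shows "realizes patchwork_plane coordinate_lines (patchworked_curve \<tau> \<delta>) L N"
proof -
  obtain f where f: "homeomorphic_map patchwork_plane rp2 f"
    "\<And>w. w \<in> T_star \<Longrightarrow> f (antipodal_class w) = octahedral_map M w"
    using octahedral_map_homeomorphism by blast
  have im: "f ` antipodal_class ` S = octahedral_map M ` S" if "S \<subseteq> T_star" for S
    unfolding image_image using f(2) that by (intro image_cong) auto
  have "coordinate_lines = antipodal_class ` (T_star \<inter> {w. snd w = 0} \<union> T_star \<inter> {w. fst w = 0} \<union> frontier T_star)"
    by (simp only: coordinate_lines_def image_Un)
  moreover have "frontier T_star \<subseteq> T_star" using closed_T_star frontier_subset_closed by blast
  ultimately have "f ` coordinate_lines = (\<Union>k. L k)"
    using im[of "T_star \<inter> {w. snd w = 0} \<union> T_star \<inter> {w. fst w = 0} \<union> frontier T_star"] octahedral_map_lines assms(3)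
    by simp
  moreover have "f ` patchworked_curve \<tau> \<delta> = N"
    unfolding patchworked_curve_def using im assms(1,2) by simp
  ultimately show ?thesis unfolding realizes_def using f(1) by blast
qed

end

section \<open>Matching the drawn segments with the ovals\<close>

type_synonym i3 = "int \<times> int \<times> int"

definition real2 :: "int \<times> int \<Rightarrow> real \<times> real" where
  "real2 = (\<lambda>(x, y). (of_int x, of_int y))"

definition real3 :: "i3 \<Rightarrow> r3" where
  "real3 = (\<lambda>(x, y, z). (of_int x, of_int y, of_int z))"

text \<open>Scaling both ends by a common nonzero factor does not change the image as long as the
  segment misses 0. Hence a drawn segment can be encoded by its doubled, integral ends.\<close>

definition segment_at :: "(r3 \<Rightarrow> real ^ 3) \<Rightarrow> i3 \<times> i3 \<Rightarrow> rp2_point set" where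
  "segment_at A = (\<lambda>(a, b). proj_pt A ` closed_segment (real3 a) (real3 b))"

text \<open>Twice the midpoint of an edge, in the octahedral coordinates of the quadrant \<open>e\<close>.\<close>

definition edge_point :: "int \<times> int \<Rightarrow> nat \<times> nat \<Rightarrow> nat \<times> nat \<Rightarrow> i3" where
  "edge_point e p q = (fst e * int (fst p + fst q), snd e * int (snd p + snd q),
     8 - int (fst p + fst q + snd p + snd q))"

lemma affine_image_closed_segment:
  assumes "\<And>u. h ((1 - u) *\<^sub>R a + u *\<^sub>R b) = (1 - u) *\<^sub>R h a + u *\<^sub>R h b"
  shows "h ` closed_segment a b = closed_segment (h a) (h b)"
  unfolding closed_segment_def by (force simp: assms[symmetric])

lemma (in homogeneous_coordinates) proj_pt_image_segment_scale:
  assumes "c \<noteq> 0" "0 \<notin> closed_segment a b"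
  shows "proj_pt M ` closed_segment (c *\<^sub>R a) (c *\<^sub>R b) = proj_pt M ` closed_segment a b"
proof -
  have "closed_segment (c *\<^sub>R a) (c *\<^sub>R b) = (*\<^sub>R) c ` closed_segment a b"
    using closed_segment_linear_image[OF linear_scaleR] by blast
  moreover have "proj_pt M (c *\<^sub>R v) = proj_pt M v" if "v \<in> closed_segment a b" for v
    using that assms by (intro proj_pt_scale) auto
  ultimately show ?thesis by (simp add: image_image)
qed

definition cell_segment :: "int \<times> int \<Rightarrow> nat \<times> nat \<Rightarrow> nat \<times> nat \<Rightarrow> nat \<times> nat \<Rightarrow> (real \<times> real) set" where
  "cell_segment e p q r = closed_segment
     (midpoint (reflect e (lattice_pt p)) (reflect e (lattice_pt q)))
     (midpoint (reflect e (lattice_pt p)) (reflect e (lattice_pt r)))"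

text \<open>Within one quadrant the absolute values are linear, so the octahedral lift is affine
  there and takes segments to segments.\<close>

lemma cell_segment:
  assumes e: "e \<in> quadrants" and "fst p + snd p \<le> 4" "fst q + snd q \<le> 4" "fst r + snd r \<le> 4"
  shows "cell_segment e p q r \<subseteq> T_star"
    and "homogeneous_coordinates A \<Longrightarrow>
      octahedral_map A ` cell_segment e p q r = segment_at A (edge_point e p q, edge_point e p r)"
proof -
  define a b :: real where "a = of_int (fst e)" and "b = of_int (snd e)"
  have ab: "a = 1 \<or> a = -1" "b = 1 \<or> b = -1" using e by (auto simp: quadrants_def a_def b_def)
  \<comment> \<open>The copy of T in the quadrant \<open>e\<close>. It is convex and contains both
    midpoints, hence the whole segment.\<close>
  define K where "K = {w :: real \<times> real. 0 \<le> a * fst w \<and> 0 \<le> b * snd w \<and> a * fst w + b * snd w \<le> 4}"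
  have "K = {w. inner (- a, 0) w \<le> 0} \<inter> {w. inner (0, - b) w \<le> 0} \<inter> {w. inner (a, b) w \<le> 4}"
    by (auto simp: K_def inner_prod_def)
  then have convK: "convex K" by (simp only:) (intro convex_Int convex_halfspace_le)
  have mid: "midpoint (reflect e (lattice_pt p)) (reflect e (lattice_pt q)) \<in> K"
    if "fst p + snd p \<le> 4" "fst q + snd q \<le> 4" for p q
  proof -
    have "real (fst p) + real (snd p) \<le> 4" "real (fst q) + real (snd q) \<le> 4" using that by linarith+
    then show ?thesis
      using ab by (auto simp: K_def midpoint_def reflect_def lattice_pt_def a_def[symmetric] b_def[symmetric]
          add_divide_distrib)
  qed
  then have sub: "cell_segment e p q r \<subseteq> K"
    unfolding cell_segment_def using assms(2-4) convK by (intro closed_segment_subset) auto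
  have abs: "\<bar>fst w\<bar> = a * fst w" "\<bar>snd w\<bar> = b * snd w" if "w \<in> K" for w
    using that ab by (auto simp: K_def)
  then have "K \<subseteq> T_star" by (auto simp: T_star_eq K_def)
  then show "cell_segment e p q r \<subseteq> T_star" using sub by blast
  assume "homogeneous_coordinates A"
  then interpret homogeneous_coordinates A .
  define h :: "real \<times> real \<Rightarrow> r3" where "h w = (fst w, snd w, 4 - a * fst w - b * snd w)" for w
  have h: "h ` closed_segment v w = closed_segment (h v) (h w)" for v w
    by (rule affine_image_closed_segment) (simp add: h_def algebra_simps)
  have nz: "0 \<notin> h ` S" for S by (auto simp: h_def zero_prod_def)
  have "octahedral_map A ` cell_segment e p q r = proj_pt A ` h ` cell_segment e p q r"
    unfolding image_image octahedral_map_def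
    by (rule image_cong) (use sub abs in \<open>auto simp: h_def\<close>)
  also have "h ` cell_segment e p q r = closed_segment
      (h (midpoint (reflect e (lattice_pt p)) (reflect e (lattice_pt q))))
      (h (midpoint (reflect e (lattice_pt p)) (reflect e (lattice_pt r))))"
    unfolding cell_segment_def by (rule h)
  also have "proj_pt A ` \<dots> = proj_pt A ` closed_segment
      (2 *\<^sub>R h (midpoint (reflect e (lattice_pt p)) (reflect e (lattice_pt q))))
      (2 *\<^sub>R h (midpoint (reflect e (lattice_pt p)) (reflect e (lattice_pt r))))"
    using nz by (subst proj_pt_image_segment_scale) (simp_all add: h[symmetric])
  finally have im: "octahedral_map A ` cell_segment e p q r = proj_pt A ` closed_segment
      (2 *\<^sub>R h (midpoint (reflect e (lattice_pt p)) (reflect e (lattice_pt q))))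
      (2 *\<^sub>R h (midpoint (reflect e (lattice_pt p)) (reflect e (lattice_pt r))))" .
  have dbl: "2 *\<^sub>R h (midpoint (reflect e (lattice_pt p)) (reflect e (lattice_pt q))) = real3 (edge_point e p q)" for q
    using ab by (auto simp: h_def midpoint_def reflect_def lattice_pt_def real3_def edge_point_def
        a_def[symmetric] b_def[symmetric] algebra_simps)
  show "octahedral_map A ` cell_segment e p q r = segment_at A (edge_point e p q, edge_point e p r)"
    unfolding im dbl segment_at_def by simp
qed

section \<open>The drawn segments as an explicit finite list\<close>

definition triangle_list :: "((nat \<times> nat) \<times> (nat \<times> nat) \<times> (nat \<times> nat)) list" where
  "triangle_list =
    [((1, 1), (2, 1), (1, 2)), ((0, 0), (1, 1), (2, 1)), ((4, 0), (2, 1), (1, 2)), ((0, 4), (1, 2), (1, 1)),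
     ((0, 0), (1, 0), (2, 1)), ((1, 0), (2, 0), (2, 1)), ((2, 0), (3, 0), (2, 1)), ((3, 0), (4, 0), (2, 1)),
     ((0, 0), (0, 1), (1, 1)), ((0, 1), (0, 2), (1, 1)), ((0, 2), (0, 3), (1, 1)), ((0, 3), (0, 4), (1, 1)),
     ((0, 4), (1, 3), (1, 2)), ((1, 3), (2, 2), (1, 2)), ((2, 2), (3, 1), (1, 2)), ((3, 1), (4, 0), (1, 2))]"

lemma irregular_triangulation_eq:
  "irregular_triangulation = (\<lambda>(a, b, c). {a, b, c}) ` set triangle_list"
  by (simp add: irregular_triangulation_def triangle_list_def eval_nat_numeral insert_commute Un_commute)

lemma triangle_list_properties:
  assumes "(a, b, c) \<in> set triangle_list"
  shows "a \<noteq> b \<and> b \<noteq> c \<and> c \<noteq> a \<and> fst a + snd a \<le> 4 \<and> fst b + snd b \<le> 4 \<and> fst c + snd c \<le> 4"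
proof -
  have "list_all (\<lambda>(a, b, c). a \<noteq> b \<and> b \<noteq> c \<and> c \<noteq> a \<and> fst a + snd a \<le> 4 \<and> fst b + snd b \<le> 4 \<and> fst c + snd c \<le> 4) triangle_list"
    by (simp add: triangle_list_def)
  then show ?thesis using assms by (auto simp: list_all_iff)
qed

text \<open>Only the choice of the isolated vertex \<open>p\<close> matters, since exchanging
  \<open>q\<close> and \<open>r\<close> gives the same segment. Three rotations of each listed
  triangle therefore replace its six orderings.\<close>

definition rotation_list :: "((nat \<times> nat) \<times> (nat \<times> nat) \<times> (nat \<times> nat)) list" where
  "rotation_list = concat (map (\<lambda>(a, b, c). [(a, b, c), (b, c, a), (c, a, b)]) triangle_list)"

lemma mem_rotation_list: "(p, q, r) \<in> set rotation_list \<longleftrightarrow>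
    (\<exists>a b c. (a, b, c) \<in> set triangle_list \<and> (p, q, r) \<in> {(a, b, c), (b, c, a), (c, a, b)})"
proof
  assume "(p, q, r) \<in> set rotation_list"
  then have "\<exists>t\<in>set triangle_list. (p, q, r) \<in> set ((\<lambda>(a, b, c). [(a, b, c), (b, c, a), (c, a, b)]) t)"
    unfolding rotation_list_def set_concat set_map image_image UN_iff .
  then obtain t where t: "t \<in> set triangle_list"
    "(p, q, r) \<in> set ((\<lambda>(a, b, c). [(a, b, c), (b, c, a), (c, a, b)]) t)" ..
  obtain a b c where "t = (a, b, c)" by (rule prod_cases3)
  show "\<exists>a b c. (a, b, c) \<in> set triangle_list \<and> (p, q, r) \<in> {(a, b, c), (b, c, a), (c, a, b)}"
    using t unfolding \<open>t = (a, b, c)\<close> prod.case list.set by blast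
next
  assume "\<exists>a b c. (a, b, c) \<in> set triangle_list \<and> (p, q, r) \<in> {(a, b, c), (b, c, a), (c, a, b)}"
  then obtain a b c where abc: "(a, b, c) \<in> set triangle_list" "(p, q, r) \<in> {(a, b, c), (b, c, a), (c, a, b)}"
    by blast
  then have "(p, q, r) \<in> set ((\<lambda>(a, b, c). [(a, b, c), (b, c, a), (c, a, b)]) (a, b, c))" by simp
  then show "(p, q, r) \<in> set rotation_list"
    unfolding rotation_list_def set_concat set_map image_image UN_iff using abc(1) by (rule bexI)
qed

lemma rotation_list_properties:
  assumes "(p, q, r) \<in> set rotation_list"
  shows "q \<noteq> r" "fst p + snd p \<le> 4" "fst q + snd q \<le> 4" "fst r + snd r \<le> 4"
    "{p, q, r} \<in> irregular_triangulation"
proof -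
  obtain a b c where abc: "(a, b, c) \<in> set triangle_list" "(p, q, r) \<in> {(a, b, c), (b, c, a), (c, a, b)}"
    using assms unfolding mem_rotation_list by blast
  then show "q \<noteq> r" "fst p + snd p \<le> 4" "fst q + snd q \<le> 4" "fst r + snd r \<le> 4"
    using triangle_list_properties[OF abc(1)] by blast+
  have "{p, q, r} = {a, b, c}" using abc(2) by blast
  moreover have "{a, b, c} \<in> irregular_triangulation"
    unfolding irregular_triangulation_eq by (rule image_eqI[OF _ abc(1)]) simp
  ultimately show "{p, q, r} \<in> irregular_triangulation" by simp
qed

lemma irregular_triangulation_rotation:
  assumes "{p, q, r} \<in> irregular_triangulation" "p \<noteq> q" "p \<noteq> r" "q \<noteq> r"
  shows "(p, q, r) \<in> set rotation_list \<or> (p, r, q) \<in> set rotation_list"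
proof -
  obtain a b c where abc: "(a, b, c) \<in> set triangle_list" "{p, q, r} = {a, b, c}"
    using assms(1) unfolding irregular_triangulation_eq by auto
  have "p \<in> {a, b, c}" "q \<in> {a, b, c}" "r \<in> {a, b, c}" unfolding abc(2)[symmetric] by blast+
  then have "(p, q, r) \<in> {(a, b, c), (b, c, a), (c, a, b)} \<or> (p, r, q) \<in> {(a, b, c), (b, c, a), (c, a, b)}"
    using assms(2-4) by (elim insertE emptyE) simp_all
  then show ?thesis unfolding mem_rotation_list using abc(1) by blast
qed

definition drawn_list :: "(nat \<times> nat \<Rightarrow> int) \<Rightarrow> (i3 \<times> i3) list" where
  "drawn_list \<delta> = map (\<lambda>(e, p, q, r). (edge_point e p q, edge_point e p r))
     (filter (\<lambda>(e, p, q, r). copy_sign \<delta> e p \<noteq> copy_sign \<delta> e q \<and> copy_sign \<delta> e p \<noteq> copy_sign \<delta> e r)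
       (List.product [(1, 1), (1, -1), (-1, 1), (-1, -1)] rotation_list))"

lemma mem_drawn_list: "x \<in> set (drawn_list \<delta>) \<longleftrightarrow>
   (\<exists>e p q r. e \<in> quadrants \<and> (p, q, r) \<in> set rotation_list \<and>
      copy_sign \<delta> e p \<noteq> copy_sign \<delta> e q \<and> copy_sign \<delta> e p \<noteq> copy_sign \<delta> e r \<and>
      x = (edge_point e p q, edge_point e p r))"
proof -
  have q: "set [(1, 1), (1, -1), (-1, 1), (-1, -1)] = quadrants"
    by (auto simp: quadrants_def)
  show ?thesis
    unfolding drawn_list_def set_map set_filter set_product q by (auto simp: image_iff)
qed

lemma drawn_segments_eq:
  "drawn_segments irregular_triangulation \<delta> = \<Union>{cell_segment e p q r | e p q r.
      e \<in> quadrants \<and> (p, q, r) \<in> set rotation_list \<and>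
      copy_sign \<delta> e p \<noteq> copy_sign \<delta> e q \<and> copy_sign \<delta> e p \<noteq> copy_sign \<delta> e r}"
  (is "_ = \<Union>?R")
proof
  have comm: "cell_segment e p q r = cell_segment e p r q" for e p q r
    by (simp add: cell_segment_def closed_segment_commute)
  show "drawn_segments irregular_triangulation \<delta> \<subseteq> \<Union>?R"
  proof
    fix w assume "w \<in> drawn_segments irregular_triangulation \<delta>"
    then obtain e p q r where w: "w \<in> cell_segment e p q r" "e \<in> quadrants"
        "{p, q, r} \<in> irregular_triangulation" "q \<noteq> r"
        "copy_sign \<delta> e p \<noteq> copy_sign \<delta> e q" "copy_sign \<delta> e p \<noteq> copy_sign \<delta> e r"
      unfolding drawn_segments_def cell_segment_def by blast
    have "p \<noteq> q" "p \<noteq> r" using w(5,6) by auto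
    then have "(p, q, r) \<in> set rotation_list \<or> (p, r, q) \<in> set rotation_list"
      using irregular_triangulation_rotation w(3,4) by blast
    then show "w \<in> \<Union>?R" using w comm by blast
  qed
  show "\<Union>?R \<subseteq> drawn_segments irregular_triangulation \<delta>"
  proof
    fix w assume "w \<in> \<Union>?R"
    then obtain e p q r where w: "w \<in> cell_segment e p q r" "e \<in> quadrants" "(p, q, r) \<in> set rotation_list"
        "copy_sign \<delta> e p \<noteq> copy_sign \<delta> e q" "copy_sign \<delta> e p \<noteq> copy_sign \<delta> e r"
      by blast
    then show "w \<in> drawn_segments irregular_triangulation \<delta>"
      using rotation_list_properties[OF w(3)] unfolding drawn_segments_def cell_segment_def by blast
  qed
qed

lemma drawn_segments_patchwork:
  shows "drawn_segments irregular_triangulation \<delta> \<subseteq> T_star"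
    and "homogeneous_coordinates A \<Longrightarrow> octahedral_map A ` drawn_segments irregular_triangulation \<delta> =
      (\<Union>x\<in>set (drawn_list \<delta>). segment_at A x)"
proof -
  show "drawn_segments irregular_triangulation \<delta> \<subseteq> T_star"
  proof
    fix w assume "w \<in> drawn_segments irregular_triangulation \<delta>"
    then obtain e p q r where w: "w \<in> cell_segment e p q r" "e \<in> quadrants"
        "(p, q, r) \<in> set rotation_list"
      unfolding drawn_segments_eq by blast
    then show "w \<in> T_star" using cell_segment(1)[OF w(2), of p q r] rotation_list_properties[OF w(3)] by blast
  qed
  assume A: "homogeneous_coordinates A"
  show "octahedral_map A ` drawn_segments irregular_triangulation \<delta> = (\<Union>x\<in>set (drawn_list \<delta>). segment_at A x)"
  proof
    show "octahedral_map A ` drawn_segments irregular_triangulation \<delta> \<subseteq> (\<Union>x\<in>set (drawn_list \<delta>). segment_at A x)"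
    proof
      fix z assume "z \<in> octahedral_map A ` drawn_segments irregular_triangulation \<delta>"
      then obtain e p q r where w: "z \<in> octahedral_map A ` cell_segment e p q r" "e \<in> quadrants"
        "(p, q, r) \<in> set rotation_list"
        "copy_sign \<delta> e p \<noteq> copy_sign \<delta> e q" "copy_sign \<delta> e p \<noteq> copy_sign \<delta> e r"
        unfolding drawn_segments_eq by blast
      then have "z \<in> segment_at A (edge_point e p q, edge_point e p r)"
        using cell_segment(2)[OF w(2) _ _ _ A, of p q r] rotation_list_properties[OF w(3)] by blast
      moreover have "(edge_point e p q, edge_point e p r) \<in> set (drawn_list \<delta>)"
        unfolding mem_drawn_list using w(2-5) by blast
      ultimately show "z \<in> (\<Union>x\<in>set (drawn_list \<delta>). segment_at A x)" by blast
    qed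
    show "(\<Union>x\<in>set (drawn_list \<delta>). segment_at A x) \<subseteq> octahedral_map A ` drawn_segments irregular_triangulation \<delta>"
    proof
      fix z assume "z \<in> (\<Union>x\<in>set (drawn_list \<delta>). segment_at A x)"
      then obtain x where x: "x \<in> set (drawn_list \<delta>)" "z \<in> segment_at A x" by blast
      then obtain e p q r where w: "x = (edge_point e p q, edge_point e p r)" "e \<in> quadrants"
        "(p, q, r) \<in> set rotation_list"
        "copy_sign \<delta> e p \<noteq> copy_sign \<delta> e q" "copy_sign \<delta> e p \<noteq> copy_sign \<delta> e r"
        unfolding mem_drawn_list by blast
      then have "z \<in> octahedral_map A ` cell_segment e p q r"
        using x cell_segment(2)[OF w(2) _ _ _ A, of p q r] rotation_list_properties[OF w(3)] by blast
      moreover have "cell_segment e p q r \<subseteq> drawn_segments irregular_triangulation \<delta>"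
        unfolding drawn_segments_eq using w(2-5) by blast
      ultimately show "z \<in> octahedral_map A ` drawn_segments irregular_triangulation \<delta>" by blast
    qed
  qed
qed

section \<open>The ovals as lists of integer segments\<close>

definition lift_int :: "int \<times> int \<Rightarrow> i3" where
  "lift_int = (\<lambda>(x, y). (x, y, 8 - x - \<bar>y\<bar>))"

definition edges :: "'a list \<Rightarrow> ('a \<times> 'a) list" where
  "edges xs = zip xs (tl xs)"

text \<open>The lift involves \<open>\<bar>y\<bar>\<close>, so it is affine on either closed side of
  the axis but not across it. This condition ensures that an edge remains a segment after
  lifting.\<close>

definition same_side :: "(int \<times> int) \<times> (int \<times> int) \<Rightarrow> bool" where
  "same_side = (\<lambda>((x, y), (x', y')). 0 \<le> y \<and> 0 \<le> y' \<or> y \<le> 0 \<and> y' \<le> 0)"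

lemma chart_segment:
  assumes "same_side (a, b)"
  shows "chart N ` closed_segment (real2 a) (real2 b) = segment_at N (lift_int a, lift_int b)"
proof -
  obtain x y x' y' where ab: "a = (x, y)" "b = (x', y')" by (cases a, cases b)
  have "\<exists>\<sigma> :: real. (\<sigma> = 1 \<or> \<sigma> = -1) \<and> 0 \<le> \<sigma> * of_int y \<and> 0 \<le> \<sigma> * of_int y'"
    using assms unfolding ab same_side_def
    by (auto intro: exI[of _ 1] exI[of _ "-1"])
  then obtain \<sigma> :: real where \<sigma>: "\<sigma> = 1 \<or> \<sigma> = -1" "0 \<le> \<sigma> * of_int y" "0 \<le> \<sigma> * of_int y'" by blast
  define h :: "real \<times> real \<Rightarrow> r3" where "h w = (fst w, snd w, 8 - fst w - \<sigma> * snd w)" for w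
  have "convex {w :: real \<times> real. inner (0, - \<sigma>) w \<le> 0}" by (rule convex_halfspace_le)
  then have "closed_segment (real2 a) (real2 b) \<subseteq> {w. inner (0, - \<sigma>) w \<le> 0}"
    by (intro closed_segment_subset) (use \<sigma> in \<open>auto simp: real2_def ab inner_prod_def\<close>)
  then have "lift w = h w" if "w \<in> closed_segment (real2 a) (real2 b)" for w
    using that \<sigma>(1) by (auto simp: lift_def h_def inner_prod_def)
  then have "lift ` closed_segment (real2 a) (real2 b) = h ` closed_segment (real2 a) (real2 b)"
    by (rule image_cong[OF refl])
  also have "\<dots> = closed_segment (h (real2 a)) (h (real2 b))"
    by (rule affine_image_closed_segment) (simp add: h_def algebra_simps)
  finally have im: "lift ` closed_segment (real2 a) (real2 b) = closed_segment (h (real2 a)) (h (real2 b))" .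
  have "h (real2 a) = real3 (lift_int a)" "h (real2 b) = real3 (lift_int b)"
    using \<sigma> by (auto simp: h_def real2_def real3_def lift_int_def ab)
  then have "proj_pt N ` lift ` closed_segment (real2 a) (real2 b) =
      proj_pt N ` closed_segment (real3 (lift_int a)) (real3 (lift_int b))" using im by simp
  then show ?thesis by (simp add: segment_at_def chart_def[abs_def] image_image)
qed

lemma segment_at_comp:
  assumes "linear g" "\<And>t. g (real3 t) = real3 (f t)"
  shows "segment_at (A \<circ> g) (a, b) = segment_at A (f a, f b)"
proof -
  have "proj_pt (A \<circ> g) ` S = proj_pt A ` g ` S" for S
    by (simp add: image_image proj_pt_def)
  then show ?thesis
    using closed_segment_linear_image[OF assms(1)] by (simp add: segment_at_def assms(2)[symmetric])
qed

definition oval_polylines :: "(int \<times> int) list \<Rightarrow> ((int \<times> int) \<times> (int \<times> int)) list" where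
  "oval_polylines xs = edges xs @ edges [(3, 0), (4, 1), (5, 0)] @
     edges [(1, 0), (3, -1), (3, 0)] @ edges [(5, 0), (5, -1), (7, 0)]"

text \<open>In contrast to the vertex description, the list also names the points where the curve
  passes a lattice edge without turning: the drawn segments come one per triangle.\<close>

definition outer_A :: "(int \<times> int) list" where
  "outer_A = [(1, 0), (2, 1), (3, 2), (2, 3), (1, 6), (2, 5), (3, 4), (4, 3), (5, 2), (6, 1), (7, 0)]"

definition outer_P :: "(int \<times> int) list" where
  "outer_P = [(1, 0), (2, 1), (3, 2), (3, 3), (6, 1), (7, 0)]"

definition central_polyline :: "(int \<times> int) list" where
  "central_polyline = [(1, 1), (2, 1), (3, 1), (4, 1), (5, 1), (6, 1), (5, 2), (4, 3), (3, 4), (2, 5),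
     (1, 6), (1, 5), (1, 4), (1, 3), (1, 2), (1, 1)]"

abbreviation edge_union :: "((int \<times> int) \<times> (int \<times> int)) list \<Rightarrow> (real \<times> real) set" where
  "edge_union es \<equiv> (\<Union>(a, b)\<in>set es. closed_segment (real2 a) (real2 b))"

lemma closed_segment_split: "b \<in> closed_segment a c \<Longrightarrow> closed_segment a c = closed_segment a b \<union> closed_segment b (c :: real \<times> real)"
  by (rule Un_closed_segment[symmetric])

text \<open>Subdivides the straight sides at these collinear points, to match the individual drawn
  segments.\<close>

lemma long_edges:
  "closed_segment (1, 0) (3, 2) = closed_segment (1, 0) (2, 1) \<union> closed_segment (2, 1) (3 :: real, 2 :: real)"
  "closed_segment (1, 6) (7, 0) = closed_segment (1, 6) (2, 5) \<union> closed_segment (2, 5) (3, 4) \<union>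
    closed_segment (3, 4) (4, 3) \<union> closed_segment (4, 3) (5, 2) \<union> closed_segment (5, 2) (6, 1) \<union>
    closed_segment (6, 1) (7 :: real, 0 :: real)"
  "closed_segment (1, 1) (6, 1) = closed_segment (1, 1) (2, 1) \<union> closed_segment (2, 1) (3, 1) \<union>
    closed_segment (3, 1) (4, 1) \<union> closed_segment (4, 1) (5, 1) \<union> closed_segment (5, 1) (6 :: real, 1 :: real)"
  "closed_segment (6, 1) (1, 6) = closed_segment (6, 1) (5, 2) \<union> closed_segment (5, 2) (4, 3) \<union>
    closed_segment (4, 3) (3, 4) \<union> closed_segment (3, 4) (2, 5) \<union> closed_segment (2, 5) (1 :: real, 6 :: real)"
  "closed_segment (1, 6) (1, 1) = closed_segment (1, 6) (1, 5) \<union> closed_segment (1, 5) (1, 4) \<union>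
    closed_segment (1, 4) (1, 3) \<union> closed_segment (1, 3) (1, 2) \<union> closed_segment (1, 2) (1 :: real, 1 :: real)"
proof -
  note split = closed_segment_split and mem = mem_segment_up mem_segment_down mem_segment_horizontal
  show "closed_segment (1, 0) (3, 2) = closed_segment (1, 0) (2, 1) \<union> closed_segment (2, 1) (3 :: real, 2 :: real)"
    by (rule split) (simp add: mem)
  show "closed_segment (1, 6) (7, 0) = closed_segment (1, 6) (2, 5) \<union> closed_segment (2, 5) (3, 4) \<union>
    closed_segment (3, 4) (4, 3) \<union> closed_segment (4, 3) (5, 2) \<union> closed_segment (5, 2) (6, 1) \<union>
    closed_segment (6, 1) (7 :: real, 0 :: real)"
    using split[of "(6, 1)" "(1, 6)" "(7, 0)"] split[of "(5, 2)" "(1, 6)" "(6, 1)"]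
      split[of "(4, 3)" "(1, 6)" "(5, 2)"] split[of "(3, 4)" "(1, 6)" "(4, 3)"] split[of "(2, 5)" "(1, 6)" "(3, 4)"]
    by (simp add: mem)
  show "closed_segment (1, 1) (6, 1) = closed_segment (1, 1) (2, 1) \<union> closed_segment (2, 1) (3, 1) \<union>
    closed_segment (3, 1) (4, 1) \<union> closed_segment (4, 1) (5, 1) \<union> closed_segment (5, 1) (6 :: real, 1 :: real)"
    using split[of "(5, 1)" "(1, 1)" "(6, 1)"] split[of "(4, 1)" "(1, 1)" "(5, 1)"]
      split[of "(3, 1)" "(1, 1)" "(4, 1)"] split[of "(2, 1)" "(1, 1)" "(3, 1)"]
    by (simp add: mem)
  show "closed_segment (6, 1) (1, 6) = closed_segment (6, 1) (5, 2) \<union> closed_segment (5, 2) (4, 3) \<union>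
    closed_segment (4, 3) (3, 4) \<union> closed_segment (3, 4) (2, 5) \<union> closed_segment (2, 5) (1 :: real, 6 :: real)"
    using split[of "(2, 5)" "(6, 1)" "(1, 6)"] split[of "(3, 4)" "(6, 1)" "(2, 5)"]
      split[of "(4, 3)" "(6, 1)" "(3, 4)"] split[of "(5, 2)" "(6, 1)" "(4, 3)"]
    by (simp add: mem)
  show "closed_segment (1, 6) (1, 1) = closed_segment (1, 6) (1, 5) \<union> closed_segment (1, 5) (1, 4) \<union>
    closed_segment (1, 4) (1, 3) \<union> closed_segment (1, 3) (1, 2) \<union> closed_segment (1, 2) (1 :: real, 1 :: real)"
    using split[of "(1, 2)" "(1, 6)" "(1, 1)"] split[of "(1, 3)" "(1, 6)" "(1, 2)"]
      split[of "(1, 4)" "(1, 6)" "(1, 3)"] split[of "(1, 5)" "(1, 6)" "(1, 4)"]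
    by (simp add: mem)
qed

lemma polygon_edges:
  "polygon VA WA = edge_union (oval_polylines outer_A)"
  "polygon VP WP = edge_union (oval_polylines outer_P)"
  "closed_segment (1, 1) (6, 1) \<union> closed_segment (6, 1) (1, 6) \<union> closed_segment (1, 6) (1, 1) =
    edge_union (edges central_polyline)"
  unfolding polygon_def path_images long_edges oval_polylines_def edges_def outer_A_def outer_P_def central_polyline_def
  by (simp_all add: real2_def Un_assoc)

text \<open>The three maps are the coordinate changes of \<open>bulge_coords\<close> for the labels
  2, 3, 1, written on integer triples.\<close>

definition oval_list :: "int \<Rightarrow> ((int \<times> int) \<times> (int \<times> int)) list \<Rightarrow> (i3 \<times> i3) list" where
  "oval_list s es = concat (map (\<lambda>f. map (\<lambda>(a, b). (f (lift_int a), f (lift_int b))) es)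
     [\<lambda>(x, y, z). (x, s * y, - z), \<lambda>(x, y, z). (- z, x, s * y), \<lambda>(x, y, z). (s * y, - z, x)])"

lemma bulge_coords_segments:
  assumes "list_all same_side es"
  shows "(\<Union>k. chart (bulge_coords A (of_int s) k) ` edge_union es) = (\<Union>x\<in>set (oval_list s es). segment_at A x)"
proof -
  have one: "chart (bulge_coords A (of_int s) k) ` edge_union es = (\<Union>(a, b)\<in>set es. segment_at A (f (lift_int a), f (lift_int b)))"
    if "linear g" "bulge_coords A (of_int s) k = A \<circ> g" "\<And>t. g (real3 t) = real3 (f t)" for k g f
  proof -
    have "chart (bulge_coords A (of_int s) k) ` edge_union es =
        (\<Union>(a, b)\<in>set es. chart (A \<circ> g) ` closed_segment (real2 a) (real2 b))"
      unfolding that(2) image_UN by (simp add: case_prod_beta)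
    also have "\<dots> = (\<Union>(a, b)\<in>set es. segment_at A (f (lift_int a), f (lift_int b)))"
    proof (rule SUP_cong[OF refl])
      fix ab assume "ab \<in> set es"
      then have "same_side ab" using assms by (auto simp: list_all_iff)
      then show "(case ab of (a, b) \<Rightarrow> chart (A \<circ> g) ` closed_segment (real2 a) (real2 b)) =
          (case ab of (a, b) \<Rightarrow> segment_at A (f (lift_int a), f (lift_int b)))"
        by (cases ab) (simp add: chart_segment segment_at_comp[OF that(1,3)])
    qed
    finally show ?thesis .
  qed
  let ?c = "sign_change 1 (of_int s) (-1)"
  have lin: "linear ?c" "linear (rotate3 \<circ> ?c)" "linear (rotate3 \<circ> rotate3 \<circ> ?c)"
    by (auto intro!: linear_compose linear_sign_change linear_rotate3)
  have 2: "chart (bulge_coords A (of_int s) 2) ` edge_union es = (\<Union>(a, b)\<in>set es. segment_at A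
      ((\<lambda>(x, y, z). (x, s * y, - z)) (lift_int a), (\<lambda>(x, y, z). (x, s * y, - z)) (lift_int b)))"
    by (rule one[OF lin(1)]) (auto simp: bulge_coords_def coords_simps sign_change_def real3_def)
  have 3: "chart (bulge_coords A (of_int s) 3) ` edge_union es = (\<Union>(a, b)\<in>set es. segment_at A
      ((\<lambda>(x, y, z). (- z, x, s * y)) (lift_int a), (\<lambda>(x, y, z). (- z, x, s * y)) (lift_int b)))"
    by (rule one[OF lin(2)]) (auto simp: bulge_coords_def coords_simps sign_change_def real3_def rotate3_def o_assoc)
  have 1: "chart (bulge_coords A (of_int s) 1) ` edge_union es = (\<Union>(a, b)\<in>set es. segment_at A
      ((\<lambda>(x, y, z). (s * y, - z, x)) (lift_int a), (\<lambda>(x, y, z). (s * y, - z, x)) (lift_int b)))"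
    by (rule one[OF lin(3)]) (auto simp: bulge_coords_def coords_simps sign_change_def real3_def rotate3_def o_assoc)
  have "(\<Union>k. chart (bulge_coords A (of_int s) k) ` edge_union es) =
      chart (bulge_coords A (of_int s) 2) ` edge_union es \<union> chart (bulge_coords A (of_int s) 3) ` edge_union es \<union>
      chart (bulge_coords A (of_int s) 1) ` edge_union es"
    unfolding UNIV_3 by blast
  also have "\<dots> = (\<Union>x\<in>set (oval_list s es). segment_at A x)"
    unfolding 1 2 3 oval_list_def by (simp add: case_prod_unfold Un_assoc)
  finally show ?thesis .
qed

section \<open>Comparison of segment lists up to orientation and antipode\<close>

definition negate3 :: "i3 \<Rightarrow> i3" where
  "negate3 = (\<lambda>(x, y, z). (- x, - y, - z))"

definition same_segment :: "i3 \<times> i3 \<Rightarrow> i3 \<times> i3 \<Rightarrow> bool" where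
  "same_segment = (\<lambda>(a, b) (c, d). a = c \<and> b = d \<or> a = d \<and> b = c \<or>
     a = negate3 c \<and> b = negate3 d \<or> a = negate3 d \<and> b = negate3 c)"

text \<open>A criterion that can be evaluated on integers: if the inner product of the ends is
  positive, every point of the segment has positive inner product with the second end, so 0 is not
  on it.\<close>

definition avoids_origin :: "i3 \<times> i3 \<Rightarrow> bool" where
  "avoids_origin = (\<lambda>((x, y, z), (x', y', z')). 0 < x * x' + y * y' + z * z')"

lemma avoids_origin:
  assumes "avoids_origin (a, b)"
  shows "0 \<notin> closed_segment (real3 a) (real3 b)"
proof
  assume "0 \<in> closed_segment (real3 a) (real3 b)"
  then obtain u where u: "0 \<le> u" "u \<le> 1" "0 = (1 - u) *\<^sub>R real3 a + u *\<^sub>R real3 b"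
    unfolding closed_segment_def by blast
  obtain x y z x' y' z' where ab: "a = (x, y, z)" "b = (x', y', z')" by (cases a, cases b)
  have "inner (real3 a) (real3 b) = of_int (x * x' + y * y' + z * z')"
    by (simp add: real3_def ab inner_prod_def)
  then have p: "0 < inner (real3 a) (real3 b)"
    using assms by (simp only: of_int_0_less_iff) (simp add: avoids_origin_def ab)
  have "0 = inner ((1 - u) *\<^sub>R real3 a + u *\<^sub>R real3 b) (real3 b)" unfolding u(3)[symmetric] by simp
  then have "0 = (1 - u) * inner (real3 a) (real3 b) + u * inner (real3 b) (real3 b)"
    by (simp add: inner_add_left)
  moreover have "0 \<le> (1 - u) * inner (real3 a) (real3 b)" "0 \<le> u * inner (real3 b) (real3 b)" using u p by simp_all
  ultimately have "(1 - u) * inner (real3 a) (real3 b) = 0" "u * inner (real3 b) (real3 b) = 0" by linarith+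
  then have "real3 b = 0" using p by auto
  then show False using p by simp
qed

definition same_segments :: "(i3 \<times> i3) list \<Rightarrow> (i3 \<times> i3) list \<Rightarrow> bool" where
  "same_segments xs ys \<longleftrightarrow> list_all (\<lambda>x. list_ex (same_segment x) ys) xs \<and>
     list_all (\<lambda>y. avoids_origin y \<and> list_ex (\<lambda>x. same_segment x y) xs) ys"

lemma segment_at_same:
  assumes "homogeneous_coordinates A" "same_segment x y" and off: "avoids_origin y"
  shows "segment_at A x = segment_at A y"
proof -
  interpret homogeneous_coordinates A by (rule assms(1))
  have n: "real3 (negate3 t) = (-1) *\<^sub>R real3 t" for t
    by (cases t) (simp add: real3_def negate3_def)
  obtain c d where y: "y = (c, d)" by (cases y)
  have "proj_pt A ` closed_segment (real3 (negate3 c)) (real3 (negate3 d)) =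
      proj_pt A ` closed_segment (real3 c) (real3 d)"
    unfolding n by (rule proj_pt_image_segment_scale) (use avoids_origin[of c d] off y in auto)
  then have neg: "segment_at A (negate3 c, negate3 d) = segment_at A (c, d)"
    by (simp add: segment_at_def)
  have comm: "segment_at A (a, b) = segment_at A (b, a)" for a b
    by (simp add: segment_at_def closed_segment_commute)
  have "x = (c, d) \<or> x = (d, c) \<or> x = (negate3 c, negate3 d) \<or> x = (negate3 d, negate3 c)"
    using assms(2) unfolding y by (cases x) (simp add: same_segment_def)
  then show ?thesis
    unfolding y using neg comm by metis
qed

lemma segments_union_eq:
  assumes "homogeneous_coordinates A" "same_segments xs ys"
  shows "(\<Union>x\<in>set xs. segment_at A x) = (\<Union>y\<in>set ys. segment_at A y)"
proof -
  have "\<exists>y\<in>set ys. segment_at A x = segment_at A y" if "x \<in> set xs" for x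
    using that assms(2) segment_at_same[OF assms(1)]
    unfolding same_segments_def list_all_iff list_ex_iff by meson
  moreover have "\<exists>x\<in>set xs. segment_at A x = segment_at A y" if "y \<in> set ys" for y
    using that assms(2) segment_at_same[OF assms(1)]
    unfolding same_segments_def list_all_iff list_ex_iff by meson
  ultimately show ?thesis by (intro equalityI UN_least) blast+
qed

definition vertex_sign :: "int \<Rightarrow> nat \<times> nat \<Rightarrow> int" where
  "vertex_sign s p = (if p = (1, 1) \<or> p = (2, 1) \<or> p = (1, 2) then s else 1)"

text \<open>An evaluation on integer data: four quadrants times 48 rotated triples are filtered by
  sign and compared, in both directions, with the edges of three rotated polygons.\<close>

lemma drawn_list_matches_A: "same_segments (drawn_list (vertex_sign 1)) (oval_list 1 (oval_polylines outer_A))"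
  by code_simp

lemma drawn_list_matches_A_plus: "same_segments (drawn_list (vertex_sign (-1)))
    (oval_list (-1) (oval_polylines outer_P) @ map (\<lambda>(a, b). (lift_int a, lift_int b)) (edges central_polyline))"
  by code_simp

theorem mainTheorem2:
  fixes L :: "3 \<Rightarrow> rp2_point set" and T0 :: "rp2_point set"
  assumes "lines_in_general_position L" and "T0 \<in> triangles L"
  shows "(\<exists>\<delta> \<in> lattice_points \<rightarrow> {1, -1}. \<exists>Q. arrangement_A L T0 Q \<and>
            realizes patchwork_plane coordinate_lines
              (patchworked_curve irregular_triangulation \<delta>) L (\<Union>k. Q k)) \<and>
         (\<exists>\<delta> \<in> lattice_points \<rightarrow> {1, -1}. \<exists>Q P. arrangement_A_plus L T0 Q P \<and>
            realizes patchwork_plane coordinate_lines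
              (patchworked_curve irregular_triangulation \<delta>) L ((\<Union>k. Q k) \<union> P))"
proof -
  obtain A where A: "adapted L 2 A" "T0 = octant A 1 1 1"
    using triangle_adapted_coordinates[OF assms] .
  then have hc: "homogeneous_coordinates A" by (simp add: adapted_def)
  interpret homogeneous_coordinates A by (rule hc)
  note realizes = realizes_patchwork[OF drawn_segments_patchwork(1) _ adapted_Union[OF A(1)]]
  define QA where "QA k = chart (bulge_coords A (of_int 1) k) ` polygon VA WA" for k
  define QP where "QP k = chart (bulge_coords A (of_int (-1)) k) ` polygon VP WP" for k
  \<comment> \<open>The central oval lies in the positive octant, so it uses the coordinates
    \<open>A\<close> without sign change or rotation.\<close>
  define P where "P = chart A ` (closed_segment (1, 1) (6, 1) \<union> closed_segment (6, 1) (1, 6) \<union> closed_segment (1, 6) (1, 1))"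
  have side: "list_all same_side (oval_polylines outer_A)" "list_all same_side (oval_polylines outer_P)"
      "list_all same_side (edges central_polyline)"
    by code_simp+
  have "vertex_sign 1 \<in> lattice_points \<rightarrow> {1, -1}" "vertex_sign (-1) \<in> lattice_points \<rightarrow> {1, -1}"
    by (auto simp: vertex_sign_def)
  moreover have "arrangement_A L T0 QA"
    using arrangement_A_polygons[OF assms A, of 1] by (simp add: QA_def[abs_def])
  moreover have "arrangement_A_plus L T0 QP P"
    using arrangement_A_polygons[OF assms A, of "-1"] central_oval A(2)
    by (simp add: arrangement_A_plus_def QP_def[abs_def] P_def)
  moreover have "realizes patchwork_plane coordinate_lines
      (patchworked_curve irregular_triangulation (vertex_sign 1)) L (\<Union>k. QA k)"
  proof (rule realizes)
    show "octahedral_map A ` drawn_segments irregular_triangulation (vertex_sign 1) = (\<Union>k. QA k)"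
      unfolding drawn_segments_patchwork(2)[OF hc] segments_union_eq[OF hc drawn_list_matches_A] QA_def polygon_edges
      by (rule bulge_coords_segments[OF side(1), symmetric])
  qed
  moreover have "realizes patchwork_plane coordinate_lines
      (patchworked_curve irregular_triangulation (vertex_sign (-1))) L ((\<Union>k. QP k) \<union> P)"
  proof (rule realizes)
    have "P = (\<Union>(a, b)\<in>set (edges central_polyline). chart A ` closed_segment (real2 a) (real2 b))"
      unfolding P_def polygon_edges image_UN by (simp add: case_prod_beta)
    also have "\<dots> = (\<Union>x\<in>set (map (\<lambda>(a, b). (lift_int a, lift_int b)) (edges central_polyline)). segment_at A x)"
      unfolding set_map image_image
    proof (rule SUP_cong[OF refl])
      fix e assume "e \<in> set (edges central_polyline)"
      then have "same_side e" using side(3) by (auto simp: list_all_iff)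
      then show "(case e of (a, b) \<Rightarrow> chart A ` closed_segment (real2 a) (real2 b)) =
          segment_at A (case e of (a, b) \<Rightarrow> (lift_int a, lift_int b))"
        by (cases e) (simp add: chart_segment)
    qed
    finally have P: "P = \<dots>" .
    show "octahedral_map A ` drawn_segments irregular_triangulation (vertex_sign (-1)) = (\<Union>k. QP k) \<union> P"
      unfolding drawn_segments_patchwork(2)[OF hc] segments_union_eq[OF hc drawn_list_matches_A_plus] set_append UN_Un
        QP_def polygon_edges bulge_coords_segments[OF side(2)] P ..
  qed
  ultimately show ?thesis by blast
qed

end
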